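(* Let $0<\alpha\le1$ and $1\le p\le\infty$. Let $N$ be a prime number and $s$ a natural number with $1\le s<N$. Let $P_{N,s}=\{\boldsymbol{x}_0,\dots,\boldsymbol{x}_{N-1}\}$ with $\boldsymbol{x}_n=(\{n/N\},\{n^2/N\},\dots,\{n^s/N\})$. Then $$\mathrm{e}(K_{\alpha,p},P_{N,s})\le\max\Big(\frac{s-1}{\sqrt N},\frac{s^{\alpha/p}}{N^\alpha}\Big).$$
   Context: $\{x\}=x-\lfloor x\rfloor$ is the fractional part; $s^{\alpha/p}=1$ when $p=\infty$. For $\boldsymbol{k},\boldsymbol{x}\in\mathbb{R}^s$, $\boldsymbol{k}\cdot\boldsymbol{x}=\sum_j k_jx_j$. Fourier coefficients: $\widetilde f(\boldsymbol{k})=\int_{[0,1]^s}f(\boldsymbol{x})e^{-2\pi i\boldsymbol{k}\cdot\boldsymbol{x}}\,d\boldsymbol{x}$. Hölder seminorm: $|f|_{H_{\alpha,p}}=\sup\{|f(\boldsymbol{x}+\boldsymbol{h})-f(\boldsymbol{x})|/\|\boldsymbol{h}\|_{\ell^p}^\alpha:\ \boldsymbol{h}\ne\boldsymbol{0},\ \boldsymbol{x},\boldsymbol{x}+\boldsymbol{h}\in[0,1)^s\}$. A function $f:[0,1]^s\to\mathbb{R}$ is one-periodic if $f(\boldsymbol{x}_u,\boldsymbol{0})=f(\boldsymbol{x}_u,\boldsymbol{1})$ for all $u\subseteq\{1,\dots,s\}$, $\boldsymbol{x}_u\in[0,1]^u$ (coordinates outside $u$ set to $0$, resp. $1$). $K_{\alpha,p}$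 is the space of one-periodic $f\in L^2([0,1]^s)$ with finite norm $\|f\|_{K_{\alpha,p}}=\sum_{\boldsymbol{k}\in\mathbb{Z}^s}|\widetilde f(\boldsymbol{k})|+|f|_{H_{\alpha,p}}$. For a normed function space $B$ on $[0,1]^s$ and a finite point set $U\subset[0,1]^s$, the worst-case error is $\mathrm{e}(B,U)=\sup_{f\in B,\|f\|_B\le1}\big|\int_{[0,1]^s}f(\boldsymbol{x})\,d\boldsymbol{x}-\frac1{|U|}\sum_{\boldsymbol{x}\in U}f(\boldsymbol{x})\big|$ (points counted with multiplicity). *)

theory Defs
  imports "HOL-Analysis.Analysis" "HOL-Probability.Probability"
begin

text \<open>Points of [0,1]^s are represented as extensional functions nat => real on {..<s}
  (coordinate j of the paper is index j-1 here).\<close>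

definition cube_measure :: "nat \<Rightarrow> (nat \<Rightarrow> real) measure" where
  "cube_measure s = PiM {..<s} (\<lambda>_. restrict_space lborel {0..1})"

definition cube :: "nat \<Rightarrow> (nat \<Rightarrow> real) set" where
  "cube s = PiE {..<s} (\<lambda>_. {0..1})"

definition half_open_cube :: "nat \<Rightarrow> (nat \<Rightarrow> real) set" where
  "half_open_cube s = PiE {..<s} (\<lambda>_. {0..<1})"

definition fourier_coeff :: "nat \<Rightarrow> ((nat \<Rightarrow> real) \<Rightarrow> real) \<Rightarrow> (nat \<Rightarrow> int) \<Rightarrow> complex" where
  "fourier_coeff s f k = integral\<^sup>L (cube_measure s)
     (\<lambda>x. complex_of_real (f x) * cis (- 2 * pi * (\<Sum>j<s. real_of_int (k j) * x j)))"

definition int_lattice :: "nat \<Rightarrow> (nat \<Rightarrow> int) set" where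
  "int_lattice s = PiE {..<s} (\<lambda>_. UNIV)"

definition lp_norm :: "nat \<Rightarrow> ereal \<Rightarrow> (nat \<Rightarrow> real) \<Rightarrow> real" where
  "lp_norm s p h = (if p = \<infinity> then Max (insert 0 ((\<lambda>j. \<bar>h j\<bar>) ` {..<s}))
      else (\<Sum>j<s. \<bar>h j\<bar> powr real_of_ereal p) powr (1 / real_of_ereal p))"

definition holder_seminorm :: "nat \<Rightarrow> real \<Rightarrow> ereal \<Rightarrow> ((nat \<Rightarrow> real) \<Rightarrow> real) \<Rightarrow> ereal" where
  "holder_seminorm s \<alpha> p f = (SUP (x, h) \<in> {(x, h). x \<in> half_open_cube s \<and> h \<in> PiE {..<s} (\<lambda>_. UNIV)
       \<and> h \<noteq> (\<lambda>_\<in>{..<s}. 0) \<and> (\<lambda>j\<in>{..<s}. x j + h j) \<in> half_open_cube s}.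
     ereal (\<bar>f (\<lambda>j\<in>{..<s}. x j + h j) - f x\<bar> / lp_norm s p h powr \<alpha>))"

definition one_periodic :: "nat \<Rightarrow> ((nat \<Rightarrow> real) \<Rightarrow> real) \<Rightarrow> bool" where
  "one_periodic s f \<longleftrightarrow> (\<forall>u \<subseteq> {..<s}. \<forall>x \<in> cube s.
      f (\<lambda>j\<in>{..<s}. if j \<in> u then x j else 0) = f (\<lambda>j\<in>{..<s}. if j \<in> u then x j else 1))"

definition in_K :: "nat \<Rightarrow> real \<Rightarrow> ereal \<Rightarrow> ((nat \<Rightarrow> real) \<Rightarrow> real) \<Rightarrow> bool" where
  "in_K s \<alpha> p f \<longleftrightarrow> one_periodic s f
     \<and> f \<in> borel_measurable (cube_measure s)
     \<and> integrable (cube_measure s) (\<lambda>x. (f x)\<^sup>2)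
     \<and> (\<lambda>k. norm (fourier_coeff s f k)) summable_on int_lattice s
     \<and> holder_seminorm s \<alpha> p f < \<infinity>"

definition K_norm :: "nat \<Rightarrow> real \<Rightarrow> ereal \<Rightarrow> ((nat \<Rightarrow> real) \<Rightarrow> real) \<Rightarrow> ereal" where
  "K_norm s \<alpha> p f = ereal (\<Sum>\<^sub>\<infinity>k\<in>int_lattice s. norm (fourier_coeff s f k)) + holder_seminorm s \<alpha> p f"

definition wce_K :: "nat \<Rightarrow> real \<Rightarrow> ereal \<Rightarrow> (nat \<Rightarrow> nat \<Rightarrow> real) \<Rightarrow> nat \<Rightarrow> ereal" where
  "wce_K s \<alpha> p X M = (SUP f \<in> {f. in_K s \<alpha> p f \<and> K_norm s \<alpha> p f \<le> 1}.
      ereal \<bar>integral\<^sup>L (cube_measure s) f - (1 / real M) * (\<Sum>n<M. f (X n))\<bar>)"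

definition korobov_pt :: "nat \<Rightarrow> nat \<Rightarrow> nat \<Rightarrow> nat \<Rightarrow> real" where
  "korobov_pt N s n = (\<lambda>j\<in>{..<s}. frac (real (n ^ (j + 1)) / real N))"

end

theory Submission
  imports "HOL-Algebra.Algebraic_Closure_Type" "Berlekamp_Zassenhaus.Finite_Field"
    "HOL-Analysis.Kronecker_Approximation_Theorem" Defs
begin

text \<open>
  A function of the class is the sum of its Fourier series on the half-open cube, so the error splits
  into the frequencies not divisible by $N$, which contribute at most the absolute sum of the Fourier
  coefficients times the largest normalised exponential sum, and the error of the rectangle rule on the
  grid of mesh $1/N$ (which aliases exactly the same frequencies divisible by $N$ as the Korobov points
  do); the latter is controlled by the Hoelder seminorm.

  The exponential sums are bounded by Weil's theorem. Writing $S_r$ for the sum over the field with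
  $p^r$ elements, a sum over monic polynomials shows that the $L$-function of the $S_r$ is a polynomial
  of degree below $d$, so that $-S_r$ is the $r$-th power sum of at most $d - 1$ complex numbers.
  Bombieri's form of Stepanov's method on the curve $y^p - y = f(x)$ gives $S_r = O(p^{r/2})$ for even
  $r$, and by Dirichlet approximation this forces each of these numbers to have modulus at most $\sqrt p$.
\<close>

section \<open>Finite subfields of an algebraically closed field\<close>

text \<open>Absolute summability gives no gain in N for the Fourier coefficients at frequencies
  divisible by N, so these are never estimated: they are traded for a quadrature error in physical
  space. Each of the two errors is weighted by one of the two summands of the norm, which is why a
  maximum results and not a sum. The condition s < N keeps all occurring degrees between 1 and N -
  1, hence prime to the characteristic. Two steps rest on this: the pole orders p of x and d of y
  are coprime, so that weights do not collide, and d times the leading coefficient is invertible,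
  which kills the coefficients of the L-function from d on. Stepanov's method bounds numbers of
  solutions only from above; the matching lower bound is free because the p fibres of the trace
  partition the field. Its constants may depend on p and d as crudely as convenient, since only the
  growth in r matters. All extensions live in one algebraically closed field, where the field with
  p^r elements is the fixed set of a power of Frobenius, so no chain of types is needed.\<close>

lemma map_poly_mult_hom:
  fixes \<phi> :: "'a::comm_ring_1 \<Rightarrow> 'b::comm_ring_1"
  assumes zero: "\<phi> 0 = 0" and add: "\<And>x y. \<phi> (x + y) = \<phi> x + \<phi> y" and mult: "\<And>x y. \<phi> (x * y) = \<phi> x * \<phi> y"
  shows "map_poly \<phi> (f * g) = map_poly \<phi> f * map_poly \<phi> g"
proof -
  have sum: "\<phi> (sum h A) = (\<Sum>i\<in>A. \<phi> (h i))" for h :: "nat \<Rightarrow> 'a" and A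
    by (induction A rule: infinite_finite_induct) (auto simp: zero add)
  show ?thesis
    by (rule poly_eqI) (simp add: coeff_map_poly zero coeff_mult sum mult)
qed

lemma poly_eq_zero_if_many_roots:
  fixes f :: "'a::idom poly"
  assumes "finite A" "\<And>x. x \<in> A \<Longrightarrow> poly f x = 0" "degree f < card A"
  shows "f = 0"
proof (rule ccontr)
  assume "f \<noteq> 0"
  then have "card A \<le> card {x. poly f x = 0}"
    using assms by (intro card_mono poly_roots_finite) auto
  then show False
    using card_poly_roots_bound[OF \<open>f \<noteq> 0\<close>] assms(3) by simp
qed

text \<open>The polynomial splits, and the order at \<open>x\<close> is the multiplicity of
  \<open>x\<close> in the multiset of its linear factors. This count yields both the size of the
  finite subfields and the factor \<open>n\<close> in the recurrence of the L-function.\<close>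

lemma alg_closed_sum_order:
  fixes f :: "'a::alg_closed_field poly"
  assumes "f \<noteq> 0"
  shows "(\<Sum>x | poly f x = 0. order x f) = degree f"
proof -
  obtain A where A: "size A = degree f" "f = smult (lead_coeff f) (\<Prod>x\<in>#A. [:- x, 1:])"
    using alg_closed_imp_factorization[OF assms] by blast
  have prod_nz: "(\<Prod>x\<in>#B. [:- x, 1:]) \<noteq> (0::'a poly)" for B
    by (subst prod_mset_zero_iff) auto
  have "order x (\<Prod>x\<in>#B. [:- x, 1:]) = count B x" for x :: 'a and B
  proof (induction B)
    case (add b B)
    have "order x ([:- b, 1:] * (\<Prod>x\<in>#B. [:- x, 1:])) = order x [:- b, 1:] + count B x"
      using add.IH prod_nz[of "add_mset b B"] by (subst order_mult) auto
    moreover have "order x [:- b, 1:] = (if x = b then 1 else 0)"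
      using order_power_n_n[of b 1] by (auto simp: order_0I)
    ultimately show ?case by simp
  qed auto
  moreover have "order x f = order x (\<Prod>x\<in>#A. [:- x, 1:])" for x
    using assms A(2) order_smult[of "lead_coeff f" x "\<Prod>x\<in>#A. [:- x, 1:]"] by (metis leading_coeff_0_iff)
  ultimately have ord: "order x f = count A x" for x by simp
  have "{x. poly f x = 0} = set_mset A"
    using ord order_root[of f] assms by (auto simp flip: count_greater_zero_iff)
  then show ?thesis
    using A(1) unfolding ord size_multiset_overloaded_eq by metis
qed

lemma power_power_swap: "((x::'a::monoid_mult) ^ m) ^ n = (x ^ n) ^ m"
  by (metis mult.commute power_mult)

section \<open>Frobenius and the finite subfields\<close>

locale char_p_closed =
  fixes p :: nat and K :: "'k::alg_closed_field itself"
  assumes CHAR_K: "CHAR('k) = p" and prime_p: "prime p"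
begin

lemma p_gt_0: "p > 0" and p_gt_1: "p > 1"
  using prime_p prime_gt_0_nat prime_gt_1_nat by auto

lemma frob_add: "(x + y) ^ (p ^ r) = x ^ (p ^ r) + (y :: 'k) ^ (p ^ r)"
  using freshmans_dream'[where 'a = 'k] CHAR_K prime_p by simp

lemma frob_sum: "(sum f A) ^ (p ^ r) = (\<Sum>i\<in>A. (f i :: 'k) ^ (p ^ r))"
  by (rule freshmans_dream_sum') (simp_all add: CHAR_K prime_p)

lemma frob_zero [simp]: "(0 :: 'k) ^ (p ^ r) = 0"
  using p_gt_0 by (simp add: power_0_left)

lemma frob_minus: "(- x :: 'k) ^ (p ^ r) = - (x ^ (p ^ r))"
proof -
  have "(x + - x) ^ (p ^ r) = x ^ (p ^ r) + (- x) ^ (p ^ r)"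
    by (rule frob_add)
  then show ?thesis
    by (simp add: eq_neg_iff_add_eq_0 add.commute)
qed

lemma frob_diff: "(x - y :: 'k) ^ (p ^ r) = x ^ (p ^ r) - y ^ (p ^ r)"
  using frob_add[of x "- y" r] by (simp add: frob_minus)

lemma frob_eq_iff: "(x :: 'k) ^ (p ^ r) = y ^ (p ^ r) \<longleftrightarrow> x = y"
  using frob_diff[of x y r] by auto

text \<open>For \<open>r > 0\<close> this is the field with \<open>p ^ r\<close> elements. For
  \<open>r = 0\<close> it is the whole field, hence the positivity conditions on \<open>r\<close>
  below.\<close>

definition subfield :: "nat \<Rightarrow> 'k set" where
  "subfield r = {x. x ^ (p ^ r) = x}"

text \<open>On \<open>subfield r\<close> this is the field trace to the prime field. As an additive
  polynomial it makes sense on the whole closed field, where it can also be evaluated at y^p - y for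
  \<open>y\<close> outside \<open>subfield r\<close>.\<close>

definition tr :: "nat \<Rightarrow> 'k \<Rightarrow> 'k" where
  "tr r x = (\<Sum>i<r. x ^ (p ^ i))"

lemma subfield_closed [simp, intro]:
  "0 \<in> subfield r" "1 \<in> subfield r"
  "x \<in> subfield r \<Longrightarrow> y \<in> subfield r \<Longrightarrow> x + y \<in> subfield r"
  "x \<in> subfield r \<Longrightarrow> y \<in> subfield r \<Longrightarrow> x - y \<in> subfield r"
  "x \<in> subfield r \<Longrightarrow> y \<in> subfield r \<Longrightarrow> x * y \<in> subfield r"
  "x \<in> subfield r \<Longrightarrow> - x \<in> subfield r"
  "x \<in> subfield r \<Longrightarrow> inverse x \<in> subfield r"
  "x \<in> subfield r \<Longrightarrow> x ^ n \<in> subfield r"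
proof -
  show "x \<in> subfield r \<Longrightarrow> x ^ n \<in> subfield r"
    unfolding subfield_def using power_power_swap[of x n "p ^ r"] by simp
qed (auto simp: subfield_def frob_add frob_diff frob_minus power_mult_distrib power_inverse)

lemma subfield_sum: "(\<And>i. i \<in> A \<Longrightarrow> f i \<in> subfield r) \<Longrightarrow> sum f A \<in> subfield r"
  by (induction A rule: infinite_finite_induct) auto

lemma of_nat_in_subfield [simp]: "of_nat n \<in> subfield r"
  by (induction n) auto

lemma subfield_mult_period: "x \<in> subfield r \<Longrightarrow> x \<in> subfield (r * k)"
proof (induction k)
  case (Suc k)
  have "x ^ (p ^ (r * Suc k)) = (x ^ (p ^ r)) ^ (p ^ (r * k))"
    by (simp add: power_mult power_add)
  then show ?case using Suc by (simp add: subfield_def)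
qed (simp add: subfield_def)

lemma subfield_1_subset: "subfield 1 \<subseteq> subfield r"
  using subfield_mult_period[of _ 1 r] by auto

lemma of_nat_p_eq_0: "of_nat p = (0::'k)"
  using CHAR_K by auto

text \<open>The polynomial X^q - X with q = p^r has derivative -1, because q vanishes in the field.
  So all its roots are simple and their number is its degree.\<close>

lemma finite_subfield: "r > 0 \<Longrightarrow> finite (subfield r)"
  and card_subfield: "r > 0 \<Longrightarrow> card (subfield r) = p ^ r"
proof -
  assume r: "r > 0"
  define f where "f = monom (1::'k) (p ^ r) - monom 1 1"
  have q: "p ^ r > 1" by (rule one_less_power[OF p_gt_1 r])
  have deg: "degree f = p ^ r"
    unfolding f_def using q by (subst diff_conv_add_uminus, subst degree_add_eq_left) (auto simp: degree_monom_eq)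
  then have f_nz: "f \<noteq> 0" using p_gt_0 by auto
  have roots: "{x. poly f x = 0} = subfield r"
    by (auto simp: f_def subfield_def poly_monom)
  show "finite (subfield r)" using poly_roots_finite[OF f_nz] roots by simp
  have "poly (pderiv f) x = - 1" for x
    using of_nat_p_eq_0 r by (simp add: f_def pderiv_diff pderiv_monom poly_monom)
  have "order x f = 1" if "poly f x = 0" for x
  proof -
    have "\<not> [:- x, 1:] ^ Suc 1 dvd f"
    proof
      assume "[:- x, 1:] ^ Suc 1 dvd f"
      then obtain g where "f = [:- x, 1:] ^ Suc 1 * g" by (rule dvdE)
      then have "f = [:- x, 1:] * ([:- x, 1:] * g)"
        by (simp only: power_Suc power_one_right mult.assoc)
      then have "poly (pderiv f) x = 0"
        by (simp only: pderiv_mult poly_add poly_mult) simp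
      then show False using \<open>\<And>x. poly (pderiv f) x = - 1\<close> by simp
    qed
    moreover have "order x f \<noteq> 0" using that f_nz by (simp add: order_root)
    ultimately show ?thesis using order_divides[of x "Suc 1" f] f_nz by linarith
  qed
  then have "(\<Sum>x | poly f x = 0. order x f) = (\<Sum>x | poly f x = 0. 1)"
    by (intro sum.cong) auto
  then have "(\<Sum>x | poly f x = 0. order x f) = card (subfield r)"
    by (simp add: roots)
  then show "card (subfield r) = p ^ r"
    using alg_closed_sum_order[OF f_nz] deg by simp
qed

lemma of_nat_eq_iff_mod: "(of_nat m :: 'k) = of_nat n \<longleftrightarrow> m mod p = n mod p"
proof -
  have "(of_nat m :: 'k) = of_nat n \<longleftrightarrow> m mod p = n mod p" if "m \<le> n" for m n
  proof -
    have "(of_nat m :: 'k) = of_nat n \<longleftrightarrow> of_nat (n - m) = (0::'k)"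
      using that by (auto simp: of_nat_diff)
    also have "\<dots> \<longleftrightarrow> p dvd n - m"
      by (simp add: of_nat_eq_0_iff_char_dvd CHAR_K)
    also have "\<dots> \<longleftrightarrow> m mod p = n mod p"
      using mod_eq_dvd_iff_nat[OF that, of p] by metis
    finally show ?thesis .
  qed
  from this[of m n] this[of n m] show ?thesis
    by (cases "m \<le> n") auto
qed

lemma bij_betw_of_nat_subfield: "bij_betw (of_nat :: nat \<Rightarrow> 'k) {..<p} (subfield 1)"
proof -
  have inj: "inj_on (of_nat :: nat \<Rightarrow> 'k) {..<p}"
    by (auto simp: inj_on_def of_nat_eq_iff_mod)
  moreover have "of_nat ` {..<p} = subfield 1"
    using card_subfield[of 1] finite_subfield[of 1] card_image[OF inj]
    by (intro card_subset_eq) auto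
  ultimately show ?thesis by (simp add: bij_betw_def)
qed

section \<open>The trace and the Artin-Schreier equation\<close>

lemma tr_add: "tr r (x + y) = tr r x + tr r y"
  by (simp add: tr_def frob_add sum.distrib)

lemma tr_zero [simp]: "tr r 0 = 0"
  by (simp add: tr_def)

lemma tr_sum: "tr r (sum f A) = (\<Sum>i\<in>A. tr r (f i))"
  by (induction A rule: infinite_finite_induct) (auto simp: tr_add)

lemma tr_diff: "tr r (x - y) = tr r x - tr r y"
  by (simp add: tr_def frob_diff sum_subtractf)

lemma tr_scale: "c \<in> subfield 1 \<Longrightarrow> tr r (c * x) = c * tr r x"
proof -
  assume "c \<in> subfield 1"
  then have "c ^ (p ^ i) = c" for i
    using subfield_mult_period[of c 1 i] by (simp add: subfield_def)
  then show ?thesis by (simp add: tr_def power_mult_distrib sum_distrib_left)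
qed

text \<open>A telescoping sum. It makes a solution of y^p - y = b lie in \<open>subfield r\<close>
  exactly when \<open>tr r b = 0\<close>, which is how trace conditions become points on a
  curve.\<close>

lemma tr_artin_schreier: "tr r (y ^ p - y) = y ^ (p ^ r) - y"
proof -
  have "tr r (y ^ p - y) = (\<Sum>i<r. y ^ (p ^ Suc i) - y ^ (p ^ i))"
    by (simp add: tr_def frob_diff power_mult)
  also have "\<dots> = y ^ (p ^ r) - y"
    by (subst sum_lessThan_telescope) simp
  finally show ?thesis .
qed

lemma tr_in_subfield: "x \<in> subfield r \<Longrightarrow> tr r x \<in> subfield 1"
proof -
  assume x: "x \<in> subfield r"
  have "(tr r x) ^ (p ^ 1) - tr r x = (\<Sum>i<r. x ^ (p ^ Suc i) - x ^ (p ^ i))"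
    by (simp only: tr_def frob_sum sum_subtractf) (simp add: power_mult power_power_swap[of x p])
  also have "\<dots> = 0"
    using x by (subst sum_lessThan_telescope) (simp add: subfield_def)
  finally show ?thesis by (simp add: subfield_def)
qed

lemma artin_schreier_root: "n > 1 \<Longrightarrow> \<exists>y::'k. y ^ n - y = z"
proof -
  assume "n > 1"
  define f where "f = monom (1::'k) n - (monom 1 1 + [:z:])"
  have "degree (monom (1::'k) 1 + [:z:]) \<le> 1"
    by (simp add: degree_add_le degree_monom_le)
  then have "degree f = n"
    unfolding f_def using \<open>n > 1\<close>
    by (subst diff_conv_add_uminus, subst degree_add_eq_left) (simp_all only: degree_minus degree_monom_eq, auto simp: degree_monom_eq)
  then obtain y where "poly f y = 0"
    using alg_closed_imp_poly_has_root[of f] \<open>n > 1\<close> by auto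
  then show ?thesis by (intro exI[of _ y]) (simp add: f_def poly_monom algebra_simps)
qed

text \<open>Take \<open>y\<close> with \<open>y ^ (p ^ r) - y = c\<close>. As \<open>c\<close> is in
  the prime field, y^p - y does not change when \<open>y\<close> is replaced by
  \<open>y + c = y ^ (p ^ r)\<close>; so it is fixed by the r-th power of Frobenius, and its trace
  telescopes to \<open>c\<close>.\<close>

lemma tr_surj:
  assumes "c \<in> subfield 1" "r > 0"
  obtains b where "b \<in> subfield r" "tr r b = c"
proof -
  have "p ^ r > 1" by (rule one_less_power[OF p_gt_1 assms(2)])
  then obtain y where y: "y ^ (p ^ r) - y = c" using artin_schreier_root by blast
  define b where "b = y ^ p - y"
  have "b ^ (p ^ r) = (y ^ (p ^ r)) ^ p - y ^ (p ^ r)"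
    by (simp add: b_def frob_diff power_power_swap[of y p])
  also have "y ^ (p ^ r) = y + c" using y by (simp add: algebra_simps)
  also have "(y + c) ^ p - (y + c) = b"
    using frob_add[of y c 1] assms(1) by (simp add: b_def subfield_def)
  finally have "b \<in> subfield r" by (simp add: subfield_def)
  moreover have "tr r b = c" using y by (simp add: b_def tr_artin_schreier)
  ultimately show ?thesis using that by blast
qed

end

section \<open>Points on Artin--Schreier curves\<close>

locale artin_schreier = char_p_closed p K for p :: nat and K :: "'k::alg_closed_field itself" +
  fixes f :: "'k poly" and r :: nat
  assumes coeffs_f: "\<And>i. coeff f i \<in> subfield r"
    and r_pos: "r > 0" and degree_f_pos: "degree f > 0" and coprime_degree: "\<not> p dvd degree f"
begin

abbreviation wt :: "nat \<times> nat \<Rightarrow> nat" where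
  "wt w \<equiv> p * fst w + degree f * snd w"

abbreviation mon :: "nat \<times> nat \<Rightarrow> 'k \<times> 'k \<Rightarrow> 'k" where
  "mon w P \<equiv> fst P ^ fst w * snd P ^ snd w"

text \<open>
  The weight is the pole order at infinity of the monomial $x^i y^j$ on the curve $y^p - y = f(x)$;
  the monomials with $j < p$ form a basis of the coordinate ring with pairwise distinct pole orders.
\<close>

definition W :: "nat \<Rightarrow> (nat \<times> nat) set" where
  "W M = {w. snd w < p \<and> wt w \<le> M}"

definition curve :: "('k \<times> 'k) set" where
  "curve = {P. snd P ^ p - snd P = poly f (fst P)}"

lemma W_mono: "M \<le> M' \<Longrightarrow> W M \<subseteq> W M'"
  by (auto simp: W_def)

lemma finite_W [simp]: "finite (W M)"
proof (rule finite_subset)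
  show "W M \<subseteq> {..M} \<times> {..<p}"
  proof
    fix w assume "w \<in> W M"
    moreover have "fst w \<le> p * fst w" using p_gt_0 by simp
    ultimately have "fst w \<le> M" "snd w < p" unfolding W_def by (simp, linarith, simp)
    then show "w \<in> {..M} \<times> {..<p}" by (cases w) auto
  qed
qed auto

text \<open>Modulo \<open>p\<close> the weight determines \<open>degree f * snd w\<close>, hence
  \<open>snd w\<close> modulo \<open>p\<close> because \<open>p\<close> does not divide
  \<open>degree f\<close>; the bound \<open>snd w < p\<close> then fixes \<open>snd w\<close>, and
  the weight fixes \<open>fst w\<close>.\<close>

lemma wt_inj:
  assumes "w \<in> W M" "w' \<in> W M'" "wt w = wt w'"
  shows "w = w'"
proof -
  obtain i j i' j' where [simp]: "w = (i, j)" "w' = (i', j')" by (cases w, cases w')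
  have *: "j = j'" if "j \<le> j'" "j' < p" "p * i + degree f * j = p * i' + degree f * j'" for i j i' j'
  proof -
    have "p * i = p * i' + degree f * (j' - j)"
      using that by (auto simp: diff_mult_distrib2)
    then have "p dvd degree f * (j' - j)"
      by (metis dvd_add_right_iff dvd_triv_left)
    then have "p dvd j' - j"
      using prime_p coprime_degree prime_dvd_mult_iff by blast
    then show ?thesis
      using that by (metis diff_is_0_eq dvd_imp_le less_imp_diff_less linorder_not_le nat_less_le zero_less_diff)
  qed
  have "j = j'"
    using *[of j j' i i'] *[of j' j i' i] assms by (cases "j \<le> j'") (auto simp: W_def)
  then show ?thesis using assms p_gt_0 by auto
qed

lemma card_W_le: "card (W M) \<le> M + 1"
proof -
  have "card (W M) = card (wt ` W M)"
    by (rule card_image[symmetric]) (intro inj_onI wt_inj)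
  also have "\<dots> \<le> card {..M}"
    by (rule card_mono) (auto simp: W_def)
  finally show ?thesis by simp
qed

text \<open>Every \<open>n\<close> beyond \<open>degree f * p\<close> is a weight: choose
  \<open>j < p\<close> with \<open>degree f * j\<close> congruent to \<open>n\<close> modulo
  \<open>p\<close>; the difference is then nonnegative and divisible by \<open>p\<close>. This
  elementary count takes the place of the Riemann-Roch theorem.\<close>

lemma card_W_ge: "M \<le> card (W M) + degree f * p"
proof -
  have "{degree f * p<..M} \<subseteq> wt ` W M"
  proof
    fix n assume n: "n \<in> {degree f * p<..M}"
    have "coprime (degree f) p"
      using prime_p coprime_degree prime_imp_coprime coprime_commute by blast
    then obtain a where a: "[degree f * a = 1] (mod p)"
      using cong_solve_coprime_nat[of "degree f" p] by auto
    define j where "j = (a * n) mod p"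
    have "[degree f * j = degree f * (a * n)] (mod p)"
      unfolding j_def by (intro cong_mult) (auto simp: unique_euclidean_semiring_class.cong_def)
    also have "[degree f * (a * n) = 1 * n] (mod p)"
      using cong_mult[OF a cong_refl[of n]] by (simp add: mult.assoc)
    finally have "[degree f * j = n] (mod p)" by simp
    moreover have j: "j < p" unfolding j_def using p_gt_0 by simp
    then have le: "degree f * j \<le> n"
      using n by (meson greaterThanAtMost_iff le_trans less_imp_le mult_le_mono2)
    ultimately have "p dvd n - degree f * j"
      using cong_altdef_nat[OF le, of p] cong_sym by blast
    then obtain i where i: "n = degree f * j + p * i"
      using le by (metis dvdE le_add_diff_inverse)
    have "(i, j) \<in> W M" "wt (i, j) = n"
      using i j n by (auto simp: W_def)
    then show "n \<in> wt ` W M" by force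
  qed
  then have "card {degree f * p<..M} \<le> card (wt ` W M)"
    by (intro card_mono) auto
  also have "\<dots> \<le> card (W M)" by (rule card_image_le) simp
  finally show ?thesis by simp
qed

lemma curve_reduce:
  assumes "P \<in> curve" "p \<le> j"
  shows "mon (i, j) P = mon (i, j - p + 1) P + (\<Sum>k\<le>degree f. coeff f k * mon (i + k, j - p) P)"
proof -
  obtain x y where P: "P = (x, y)" by (cases P)
  have "y ^ p = y + poly f x"
    using assms(1) P by (simp add: curve_def algebra_simps)
  moreover have "y ^ j = y ^ (j - p) * y ^ p"
    using assms(2) by (simp add: power_add[symmetric])
  ultimately have "x ^ i * y ^ j = x ^ i * y ^ (j - p + 1) + x ^ i * y ^ (j - p) * poly f x"
    by (simp add: algebra_simps)
  also have "x ^ i * y ^ (j - p) * poly f x = (\<Sum>k\<le>degree f. coeff f k * (x ^ (i + k) * y ^ (j - p)))"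
    by (simp add: poly_altdef sum_distrib_left power_add mult_ac)
  finally show ?thesis by (simp add: P)
qed

text \<open>Repeated substitution of y + f(x) for y^p. Only the leading term of f preserves the
  weight, all others lower it, so the top weight survives with a nonzero coefficient. The
  coefficients stay in the finite field, as the pigeonhole argument requires.\<close>

lemma monomial_rep:
  "\<exists>e. (\<forall>w. e w \<in> subfield r) \<and> (\<forall>w. e w \<noteq> 0 \<longrightarrow> w \<in> W (wt (i, j))) \<and>
     (\<exists>w. wt w = wt (i, j) \<and> e w \<noteq> 0) \<and>
     (\<forall>P\<in>curve. \<forall>M \<ge> wt (i, j). mon (i, j) P = (\<Sum>w\<in>W M. e w * mon w P))"
proof (induction j arbitrary: i rule: less_induct)
  case (less j)
  show ?case
  proof (cases "j < p")
    case True
    define e :: "nat \<times> nat \<Rightarrow> 'k" where "e = (\<lambda>w. if w = (i, j) then 1 else 0)"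
    have "(\<Sum>w\<in>W M. e w * mon w P) = mon (i, j) P" if "M \<ge> wt (i, j)" for M P
    proof -
      have "(\<Sum>w\<in>W M. e w * mon w P) = (\<Sum>w\<in>W M. if w = (i, j) then mon (i, j) P else 0)"
        by (intro sum.cong) (auto simp: e_def)
      moreover have "(i, j) \<in> W M" using that True by (simp add: W_def)
      ultimately show ?thesis by (simp add: sum.delta)
    qed
    moreover have "wt (i, j) = wt (i, j) \<and> e (i, j) \<noteq> 0" by (simp add: e_def)
    moreover have "e w \<noteq> 0 \<longrightarrow> w \<in> W (wt (i, j))" for w
      using True by (auto simp: e_def W_def)
    ultimately show ?thesis
      by (intro exI[of _ e]) (auto simp: e_def)
  next
    case False
    then have pj: "p \<le> j" by simp
    define M0 where "M0 = wt (i, j)"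
    have j_lt: "j - p + 1 < j" using pj p_gt_1 by linarith
    obtain e0 where e0: "\<And>w. e0 w \<in> subfield r" "\<And>w. e0 w \<noteq> 0 \<Longrightarrow> w \<in> W (wt (i, j - p + 1))"
      "\<And>P M. P \<in> curve \<Longrightarrow> M \<ge> wt (i, j - p + 1) \<Longrightarrow> mon (i, j - p + 1) P = (\<Sum>w\<in>W M. e0 w * mon w P)"
      using less[OF j_lt, of i] by blast
    have "\<forall>k. \<exists>e. (\<forall>w. e w \<in> subfield r) \<and> (\<forall>w. e w \<noteq> 0 \<longrightarrow> w \<in> W (wt (i + k, j - p))) \<and>
     (\<exists>w. wt w = wt (i + k, j - p) \<and> e w \<noteq> 0) \<and>
     (\<forall>P\<in>curve. \<forall>M \<ge> wt (i + k, j - p). mon (i + k, j - p) P = (\<Sum>w\<in>W M. e w * mon w P))"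
      using less[of "j - p"] pj p_gt_0 by simp
    from choice[OF this] obtain e1 where e1: "\<And>k w. e1 k w \<in> subfield r"
      "\<And>k w. e1 k w \<noteq> 0 \<Longrightarrow> w \<in> W (wt (i + k, j - p))"
      "\<And>k. \<exists>w. wt w = wt (i + k, j - p) \<and> e1 k w \<noteq> 0"
      "\<And>k P M. P \<in> curve \<Longrightarrow> M \<ge> wt (i + k, j - p) \<Longrightarrow>
         mon (i + k, j - p) P = (\<Sum>w\<in>W M. e1 k w * mon w P)"
      by blast
    \<comment> \<open>The monomials y^p and x^(degree f) have the same weight; all the weight
      estimates that follow come from this balance.\<close>
    have j_eq: "degree f * j = degree f * (j - p) + p * degree f"
      using pj by (simp add: diff_mult_distrib2 mult.commute)
    have wt0: "wt (i, j - p + 1) < M0"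
    proof -
      have "degree f * (j - p + 1) < degree f * j"
        using pj p_gt_1 degree_f_pos by (intro mult_strict_left_mono) auto
      then show ?thesis by (simp add: M0_def)
    qed
    have wt1: "wt (i + k, j - p) < M0" if "k < degree f" for k
    proof -
      have "p * k < p * degree f" using that p_gt_0 by simp
      then show ?thesis using j_eq by (simp add: M0_def add_mult_distrib2)
    qed
    have wtd: "wt (i + degree f, j - p) = M0"
      using j_eq by (simp add: M0_def add_mult_distrib2)
    have wt1': "wt (i + k, j - p) \<le> M0" if "k \<le> degree f" for k
      using wt1[of k] wtd that by (cases "k = degree f") auto
    define e where "e = (\<lambda>w. e0 w + (\<Sum>k\<le>degree f. coeff f k * e1 k w))"
    have "e w \<in> subfield r" for w
      unfolding e_def using e0(1) e1(1) coeffs_f by (intro subfield_closed subfield_sum) auto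
    moreover have "w \<in> W M0" if "e w \<noteq> 0" for w
    proof -
      have "e0 w \<noteq> 0 \<or> (\<exists>k\<le>degree f. e1 k w \<noteq> 0)"
      proof (rule ccontr)
        assume "\<not> ?thesis"
        then have "e w = 0" by (simp add: e_def)
        then show False using that by simp
      qed
      then show ?thesis
      proof
        assume "e0 w \<noteq> 0"
        then show ?thesis using e0(2) W_mono[OF less_imp_le[OF wt0]] by blast
      next
        assume "\<exists>k\<le>degree f. e1 k w \<noteq> 0"
        then obtain k where "k \<le> degree f" "e1 k w \<noteq> 0" by blast
        then show ?thesis using e1(2) W_mono[OF wt1'] by blast
      qed
    qed
    \<comment> \<open>Only the summand with \<open>k = degree f\<close> reaches the weight
      \<open>M0\<close>; the other expansions are supported strictly below it, so nothing can cancel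
      the leading coefficient.\<close>
    moreover have "\<exists>w. wt w = M0 \<and> e w \<noteq> 0"
    proof -
      obtain w where w: "wt w = M0" "e1 (degree f) w \<noteq> 0"
        using e1(3)[of "degree f"] wtd by auto
      have "e0 w = 0"
        using e0(2)[of w] w wt0 by (auto simp: W_def)
      moreover have "e1 k w = 0" if "k < degree f" for k
        using e1(2)[of k w] w wt1[OF that] by (auto simp: W_def)
      ultimately have "e w = coeff f (degree f) * e1 (degree f) w"
        by (auto simp: e_def lessThan_Suc_atMost[symmetric])
      also have "\<dots> \<noteq> 0" using w degree_f_pos by auto
      finally show ?thesis using w by blast
    qed
    moreover have "mon (i, j) P = (\<Sum>w\<in>W M. e w * mon w P)" if "P \<in> curve" "M \<ge> M0" for P M
    proof -
      have "mon (i, j) P = mon (i, j - p + 1) P + (\<Sum>k\<le>degree f. coeff f k * mon (i + k, j - p) P)"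
        using curve_reduce[OF that(1) pj] .
      also have "mon (i, j - p + 1) P = (\<Sum>w\<in>W M. e0 w * mon w P)"
        using e0(3)[OF that(1), of M] wt0 that(2) by simp
      also have "(\<Sum>k\<le>degree f. coeff f k * mon (i + k, j - p) P) =
                 (\<Sum>k\<le>degree f. coeff f k * (\<Sum>w\<in>W M. e1 k w * mon w P))"
      proof (rule sum.cong[OF refl])
        fix k assume "k \<in> {..degree f}"
        then have "wt (i + k, j - p) \<le> M" using wt1'[of k] that(2) by simp
        from e1(4)[OF that(1) this]
        show "coeff f k * mon (i + k, j - p) P = coeff f k * (\<Sum>w\<in>W M. e1 k w * mon w P)"
          by (rule arg_cong)
      qed
      also have "\<dots> = (\<Sum>w\<in>W M. (\<Sum>k\<le>degree f. coeff f k * e1 k w) * mon w P)"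
        by (simp add: sum_distrib_left sum_distrib_right mult.assoc) (rule sum.swap)
      finally show ?thesis
        by (simp add: e_def sum.distrib distrib_right)
    qed
    ultimately show ?thesis unfolding M0_def by blast
  qed
qed

text \<open>
  With $q = Q^2$, a rational point satisfies $t^q = t$ for every coordinate function $t$. By the pigeonhole
  principle there are $\delta_{ab}$, not all zero, such that $\sum \delta_{ab}^Q b^Q a$ vanishes on the curve;
  hence $u = \sum \delta_{ab} b a^Q$, whose $Q$-th power agrees with it at the rational points, vanishes there.
  It is not zero, because its terms have distinct pole orders, and as the fibres of $x$ consist of $p$
  points each, every coefficient of $u$ in the basis over the polynomials in $x$ vanishes at each such $x$.
\<close>

theorem card_trace_zero_le:
  assumes r: "r = 2 * h" and Q: "Q = p ^ h" and G: "G = degree f * p"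
    and large: "Q \<ge> (G + 1) * (G + 2) + 2 * G + 4"
  shows "p * card {x \<in> subfield r. tr r (poly f x) = 0} \<le> Q\<^sup>2 + (2 * G + 3) * Q"
proof -
  \<comment> \<open>The choice \<open>l < Q\<close> lets division by \<open>Q\<close> separate the
    two weights in a product. The choice of \<open>m\<close> gives (Q - 1 - G)(Q + G + 2) = Q^2 + Q
    - (G + 1)(G + 2) unknowns or more against at most Q^2 + 2G + 3 equations; the gain of one Q is
    what the hypothesis on the size of \<open>Q\<close> exploits.\<close>
  define l where "l = Q - 1"
  define m where "m = Q + 2 * G + 2"
  define E where "E = subfield r"
  define I where "I = W m \<times> W l"
  define M where "M = Q * l + m"
  define M' where "M' = l + Q * m"
  have Q_pos: "Q > 0" using large by simp
  have l_less: "l < Q" using Q_pos by (simp add: l_def)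
  have "h > 0" using r r_pos by simp
  have Q2: "p ^ r = Q * Q" by (simp add: r Q power_add[symmetric] mult_2)
  have [simp]: "finite I" by (simp add: I_def)
  have "finite E" and card_E: "card E > 1"
    unfolding E_def using finite_subfield card_subfield r_pos one_less_power[OF p_gt_1 r_pos] by auto
  have "\<forall>v. \<exists>e. (\<forall>w. e w \<in> subfield r) \<and> (\<forall>w. e w \<noteq> 0 \<longrightarrow> w \<in> W (wt v)) \<and>
     (\<exists>w. wt w = wt v \<and> e w \<noteq> 0) \<and>
     (\<forall>P\<in>curve. \<forall>M \<ge> wt v. mon v P = (\<Sum>w\<in>W M. e w * mon w P))"
  proof
    fix v :: "nat \<times> nat"
    show "\<exists>e. (\<forall>w. e w \<in> subfield r) \<and> (\<forall>w. e w \<noteq> 0 \<longrightarrow> w \<in> W (wt v)) \<and>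
     (\<exists>w. wt w = wt v \<and> e w \<noteq> 0) \<and>
     (\<forall>P\<in>curve. \<forall>M \<ge> wt v. mon v P = (\<Sum>w\<in>W M. e w * mon w P))"
      using monomial_rep[of "fst v" "snd v"] unfolding prod.collapse .
  qed
  from choice[OF this] obtain R where R: "\<And>v w. R v w \<in> E" "\<And>v w. R v w \<noteq> 0 \<Longrightarrow> w \<in> W (wt v)"
      "\<And>v. \<exists>w. wt w = wt v \<and> R v w \<noteq> 0"
      "\<And>v P M. P \<in> curve \<Longrightarrow> M \<ge> wt v \<Longrightarrow> mon v P = (\<Sum>w\<in>W M. R v w * mon w P)"
    unfolding E_def by blast
  \<comment> \<open>The exponent pair of the monomial \<open>a\<close> times the Q-th power of the
    monomial \<open>b\<close>. Its y-exponent may reach \<open>p\<close>, so it has to be expanded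
    by \<open>R\<close>.\<close>
  define comb :: "nat \<times> nat \<Rightarrow> nat \<times> nat \<Rightarrow> nat \<times> nat"
    where "comb = (\<lambda>a b. (fst a + Q * fst b, snd a + Q * snd b))"
  have wt_comb: "wt (comb a b) = wt a + Q * wt b" for a b
    by (simp add: comb_def algebra_simps)
  have mon_comb: "mon (comb a b) P = mon a P * mon b P ^ Q" for a b P
    by (simp add: comb_def power_add power_mult power_mult_distrib mult_ac power_power_swap[of _ Q])

  have card_lt: "card (W M) < card I"
  proof -
    have "card (W M) \<le> Q * Q + 2 * G + 3"
    proof -
      have "Q = Suc l" using Q_pos by (simp add: l_def)
      then have "Q * l + Q = Q * Q" by simp
      then show ?thesis using card_W_le[of M] by (simp add: M_def m_def)
    qed
    also have "\<dots> < (Q - 1 - G) * (Q + G + 2)"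
    proof -
      have "Q - 1 - G \<ge> 1" "int (Q - 1 - G) = int Q - 1 - int G" using large by auto
      moreover have "int Q * int Q + 2 * int G + 3 < (int Q - 1 - int G) * (int Q + int G + 2)"
      proof -
        have "int ((G + 1) * (G + 2) + 2 * G + 4) \<le> int Q"
          using large by (simp only: of_nat_le_iff)
        then show ?thesis by (simp add: algebra_simps)
      qed
      ultimately have "int (Q * Q + 2 * G + 3) < int ((Q - 1 - G) * (Q + G + 2))"
        by (simp only: of_nat_mult of_nat_add of_nat_numeral)
      then show ?thesis by (simp only: of_nat_less_iff)
    qed
    also have "\<dots> \<le> card (W l) * card (W m)"
    proof (rule mult_mono)
      show "Q - 1 - G \<le> card (W l)" using card_W_ge[of l] l_def G by linarith
      show "Q + G + 2 \<le> card (W m)" using card_W_ge[of m] m_def G by linarith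
    qed auto
    finally show ?thesis by (simp add: I_def card_cartesian_product mult.commute)
  qed

  \<comment> \<open>The coefficient vector of the sum of \<delta>^Q a b^Q in the monomial basis.
    Because \<open>Q\<close> is a power of the characteristic, \<open>\<Phi>\<close> is additive, so
    two arguments with the same value give a nonzero element of its kernel by subtraction.\<close>
  define \<Phi> where "\<Phi> = (\<lambda>\<delta>::(nat \<times> nat) \<times> (nat \<times> nat) \<Rightarrow> 'k.
    \<lambda>w\<in>W M. \<Sum>(a, b)\<in>I. \<delta> (a, b) ^ Q * R (comb a b) w)"
  have "\<Phi> ` (I \<rightarrow>\<^sub>E E) \<subseteq> W M \<rightarrow>\<^sub>E E"
  proof (rule image_subsetI)
    fix \<delta> assume "\<delta> \<in> I \<rightarrow>\<^sub>E E"
    then have \<delta>: "\<delta> x \<in> subfield r" if "x \<in> I" for x using that unfolding E_def by (rule PiE_mem)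
    have "(\<Sum>x\<in>I. \<delta> x ^ Q * R (comb (fst x) (snd x)) w) \<in> subfield r" for w
      using \<delta> R(1)[unfolded E_def] by (intro subfield_sum subfield_closed(5) subfield_closed(8))
    then show "\<Phi> \<delta> \<in> W M \<rightarrow>\<^sub>E E"
      by (simp add: \<Phi>_def E_def case_prod_beta)
  qed
  then have "card (\<Phi> ` (I \<rightarrow>\<^sub>E E)) \<le> card (W M \<rightarrow>\<^sub>E E)"
    using \<open>finite E\<close> by (intro card_mono finite_PiE) auto
  also have "\<dots> = card E ^ card (W M)"
    by (simp add: card_PiE)
  also have "\<dots> < card E ^ card I"
    using card_lt card_E by (intro power_strict_increasing) auto
  also have "\<dots> = card (I \<rightarrow>\<^sub>E E)" by (simp add: card_PiE)
  finally have "\<not> inj_on \<Phi> (I \<rightarrow>\<^sub>E E)"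
    using card_image by fastforce
  then obtain \<delta>1 \<delta>2 where \<delta>12: "\<delta>1 \<in> I \<rightarrow>\<^sub>E E" "\<delta>2 \<in> I \<rightarrow>\<^sub>E E" "\<delta>1 \<noteq> \<delta>2" "\<Phi> \<delta>1 = \<Phi> \<delta>2"
    by (auto simp: inj_on_def)
  define \<delta> where "\<delta> = (\<lambda>c. \<delta>1 c - \<delta>2 c)"
  have \<delta>_nz: "\<exists>c\<in>I. \<delta> c \<noteq> 0"
    using \<delta>12(1-3) by (auto simp: \<delta>_def fun_eq_iff PiE_def extensional_def) metis

  define c where "c = (\<lambda>w. \<Sum>(a, b)\<in>I. \<delta> (a, b) * R (comb b a) w)"
  have u_rep: "(\<Sum>(a, b)\<in>I. \<delta> (a, b) * (mon b P * mon a P ^ Q)) = (\<Sum>w\<in>W M'. c w * mon w P)"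
    if "P \<in> curve" for P
  proof -
    have "(\<Sum>(a, b)\<in>I. \<delta> (a, b) * (mon b P * mon a P ^ Q)) =
          (\<Sum>(a, b)\<in>I. \<Sum>w\<in>W M'. \<delta> (a, b) * R (comb b a) w * mon w P)"
    proof (intro sum.cong refl, clarify)
      fix a1 a2 b1 b2 assume I: "((a1, a2), (b1, b2)) \<in> I"
      define a where "a = (a1, a2)"
      define b where "b = (b1, b2)"
      have "wt b \<le> l" "wt a \<le> m" using I by (auto simp: I_def W_def a_def b_def)
      then have "wt (comb b a) \<le> M'"
        unfolding wt_comb M'_def by (intro add_mono mult_left_mono) auto
      from R(4)[OF that this]
      have "mon b P * mon a P ^ Q = (\<Sum>w\<in>W M'. R (comb b a) w * mon w P)"
        unfolding mon_comb .
      then show "\<delta> ((a1, a2), (b1, b2)) * (mon (b1, b2) P * mon (a1, a2) P ^ Q) =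
          (\<Sum>w\<in>W M'. \<delta> ((a1, a2), (b1, b2)) * R (comb (b1, b2) (a1, a2)) w * mon w P)"
        unfolding a_def[symmetric] b_def[symmetric] by (simp add: sum_distrib_left mult.assoc)
    qed
    also have "\<dots> = (\<Sum>w\<in>W M'. \<Sum>(a, b)\<in>I. \<delta> (a, b) * R (comb b a) w * mon w P)"
      unfolding case_prod_beta by (rule sum.swap)
    also have "\<dots> = (\<Sum>w\<in>W M'. c w * mon w P)"
      by (simp add: c_def sum_distrib_right case_prod_beta)
    finally show ?thesis .
  qed

  have F_zero: "(\<Sum>(a, b)\<in>I. \<delta> (a, b) ^ Q * (mon a P * mon b P ^ Q)) = 0" if "P \<in> curve" for P
  proof -
    have "(\<Sum>(a, b)\<in>I. \<delta> (a, b) ^ Q * (mon a P * mon b P ^ Q)) =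
          (\<Sum>(a, b)\<in>I. \<Sum>w\<in>W M. \<delta> (a, b) ^ Q * R (comb a b) w * mon w P)"
    proof (intro sum.cong refl, clarify)
      fix a1 a2 b1 b2 assume I: "((a1, a2), (b1, b2)) \<in> I"
      define a where "a = (a1, a2)"
      define b where "b = (b1, b2)"
      have "wt b \<le> l" "wt a \<le> m" using I by (auto simp: I_def W_def a_def b_def)
      then have "wt a + Q * wt b \<le> m + Q * l" by (intro add_mono mult_left_mono) auto
      then have "wt (comb a b) \<le> M"
        unfolding wt_comb M_def by simp
      from R(4)[OF that this]
      have "mon a P * mon b P ^ Q = (\<Sum>w\<in>W M. R (comb a b) w * mon w P)"
        unfolding mon_comb .
      then show "\<delta> ((a1, a2), (b1, b2)) ^ Q * (mon (a1, a2) P * mon (b1, b2) P ^ Q) =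
          (\<Sum>w\<in>W M. \<delta> ((a1, a2), (b1, b2)) ^ Q * R (comb (a1, a2) (b1, b2)) w * mon w P)"
        unfolding a_def[symmetric] b_def[symmetric] by (simp add: sum_distrib_left mult.assoc)
    qed
    also have "\<dots> = (\<Sum>w\<in>W M. \<Sum>(a, b)\<in>I. \<delta> (a, b) ^ Q * R (comb a b) w * mon w P)"
      unfolding case_prod_beta by (rule sum.swap)
    also have "\<dots> = (\<Sum>w\<in>W M. (\<Phi> \<delta>1 w - \<Phi> \<delta>2 w) * mon w P)"
    proof (intro sum.cong refl)
      fix w assume "w \<in> W M"
      then have "\<Phi> \<delta>1 w - \<Phi> \<delta>2 w = (\<Sum>(a, b)\<in>I. \<delta> (a, b) ^ Q * R (comb a b) w)"
        by (simp add: \<Phi>_def \<delta>_def Q frob_diff case_prod_beta sum_subtractf left_diff_distrib)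
      then show "(\<Sum>(a, b)\<in>I. \<delta> (a, b) ^ Q * R (comb a b) w * mon w P) = (\<Phi> \<delta>1 w - \<Phi> \<delta>2 w) * mon w P"
        by (simp add: sum_distrib_right case_prod_beta)
    qed
    finally show ?thesis by (simp add: \<delta>12(4))
  qed

  have c_zero: "(\<Sum>w\<in>W M'. c w * mon w P) = 0" if P: "P \<in> curve" "fst P \<in> E" "snd P \<in> E" for P
  proof -
    have pow_q: "mon a P ^ (Q * Q) = mon a P" for a
      using P(2,3) subfield_closed(5,8)[where r = r] unfolding E_def Q2[symmetric]
      by (metis (mono_tags, lifting) mem_Collect_eq subfield_def)
    have "(\<Sum>(a, b)\<in>I. \<delta> (a, b) * (mon b P * mon a P ^ Q)) ^ Q =
          (\<Sum>(a, b)\<in>I. \<delta> (a, b) ^ Q * (mon a P * mon b P ^ Q))"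
      using pow_q by (simp add: Q frob_sum case_prod_beta)
         (simp add: power_mult_distrib Q[symmetric] power_mult[symmetric] mult_ac)
    then show ?thesis using F_zero[OF P(1)] u_rep[OF P(1)] Q_pos by simp
  qed

  obtain w0 where w0: "w0 \<in> W M'" "c w0 \<noteq> 0"
  proof -
    define J where "J = {(a, b) \<in> I. \<delta> (a, b) \<noteq> 0}"
    have "finite J" "J \<noteq> {}" using \<delta>_nz by (auto simp: J_def intro: finite_subset[of _ I])
    \<comment> \<open>The top weight of b a^Q is \<open>wt b + Q * wt a\<close> with
      \<open>wt b < Q\<close>, a two-digit expansion in base \<open>Q\<close>. Hence distinct pairs
      have distinct top weights, and the largest one with a nonzero coefficient cannot be
      cancelled.\<close>
    define g where "g = (\<lambda>(a, b). wt (comb b a))"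
    have "inj_on g I"
    proof (rule inj_onI)
      fix x y assume xy: "x \<in> I" "y \<in> I" "g x = g y"
      obtain a b a' b' where [simp]: "x = (a, b)" "y = (a', b')" by (cases x, cases y)
      have less: "wt b < Q" "wt b' < Q" using xy l_less by (auto simp: I_def W_def)
      have eq: "wt b + Q * wt a = wt b' + Q * wt a'"
        using xy(3) by (simp add: g_def wt_comb)
      have "wt b = wt b'"
        using arg_cong[OF eq, of "\<lambda>n. n mod Q"] less by simp
      moreover from this have "wt a = wt a'" using eq Q_pos by simp
      ultimately have "wt b = wt b' \<and> wt a = wt a'" by simp
      then show "x = y" using xy wt_inj[of a m a' m] wt_inj[of b l b' l] by (auto simp: I_def)
    qed
    obtain a b where ab: "(a, b) \<in> J" "g (a, b) = Max (g ` J)"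
      using \<open>finite J\<close> \<open>J \<noteq> {}\<close> by (metis (no_types, lifting) Max_in finite_imageI image_iff image_is_empty surj_pair)
    have smaller: "g y < g (a, b)" if "y \<in> J" "y \<noteq> (a, b)" for y
    proof -
      have "g y \<le> g (a, b)" using that ab \<open>finite J\<close> by simp
      moreover have "g y \<noteq> g (a, b)"
        using inj_onD[OF \<open>inj_on g I\<close>, of y "(a, b)"] that ab(1) by (auto simp: J_def)
      ultimately show ?thesis by simp
    qed
    obtain w where w: "wt w = wt (comb b a)" "R (comb b a) w \<noteq> 0" using R(3) by blast
    have zero: "\<delta> y * R (comb (snd y) (fst y)) w = 0" if "y \<in> I - {(a, b)}" for y
    proof (cases "y \<in> J")
      case True
      then have "wt (comb (snd y) (fst y)) < wt w"
        using smaller[of y] that w(1) by (simp add: g_def case_prod_beta)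
      then show ?thesis using R(2)[of "comb (snd y) (fst y)" w] by (auto simp: W_def)
    next
      case False
      then show ?thesis using that by (auto simp: J_def)
    qed
    have abI: "(a, b) \<in> I" using ab by (simp add: J_def)
    have "c w = \<delta> (a, b) * R (comb b a) w"
      unfolding c_def case_prod_beta by (subst sum.remove[OF \<open>finite I\<close> abI]) (simp add: zero)
    then have "c w \<noteq> 0" using w ab by (simp add: J_def)
    moreover have "w \<in> W M'"
    proof -
      have "wt b \<le> l" "wt a \<le> m" using abI by (auto simp: I_def W_def)
      then have "wt (comb b a) \<le> M'"
        unfolding wt_comb M'_def by (intro add_mono mult_left_mono) auto
      then show ?thesis using R(2)[OF w(2)] W_mono by blast
    qed
    ultimately show ?thesis using that by blast
  qed

  define Xs where "Xs = {x \<in> E. tr r (poly f x) = 0}"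
  \<comment> \<open>The polynomial in x that multiplies y^j in u.\<close>
  define A where "A = (\<lambda>j. \<Sum>i | (i, j) \<in> W M'. monom (c (i, j)) i)"
  have fin_i: "finite {i. (i, j) \<in> W M'}" for j
  proof -
    have "{i. (i, j) \<in> W M'} \<subseteq> fst ` W M'" by force
    then show ?thesis using finite_surj[of "W M'" _ fst] by simp
  qed
  have poly_A: "poly (A j) x = (\<Sum>i | (i, j) \<in> W M'. c (i, j) * x ^ i)" for j x
    by (simp add: A_def poly_sum poly_monom)
  have A_zero: "poly (A j) x = 0" if "x \<in> Xs" "j < p" for x j
  proof -
    obtain y where y: "y ^ p - y = poly f x" using artin_schreier_root[OF p_gt_1] by blast
    then have "y ^ (p ^ r) - y = 0"
      using tr_artin_schreier[of r y] that by (simp add: Xs_def)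
    then have "y \<in> E" by (simp add: E_def subfield_def)
    \<comment> \<open>The whole fibre above \<open>x\<close>: since the trace vanishes one solution
      \<open>y\<close> is in \<open>E\<close>, and the others are its translates by the prime field.
      For fixed \<open>x\<close>, u is a polynomial in y of degree below \<open>p\<close> with these
      \<open>p\<close> roots.\<close>
    define Y where "Y = (\<lambda>n. y + of_nat n) ` {..<p}"
    have "inj_on (\<lambda>n. y + of_nat n) {..<p}"
      by (auto simp: inj_on_def of_nat_eq_iff_mod)
    then have card_Y: "finite Y" "card Y = p" by (auto simp: Y_def card_image)
    define B where "B = (\<Sum>j<p. monom (poly (A j) x) j)"
    have "poly B z = 0" if zY: "z \<in> Y" for z
    proof -
      obtain n where n: "z = y + of_nat n" using zY by (auto simp: Y_def)
      have "(of_nat n :: 'k) ^ p = of_nat n"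
        using of_nat_in_subfield[of n 1] by (simp add: subfield_def)
      then have "(x, z) \<in> curve"
        using y frob_add[of y "of_nat n" 1] by (simp add: curve_def n)
      moreover have "z \<in> E" "x \<in> E" using \<open>y \<in> E\<close> \<open>x \<in> Xs\<close> by (auto simp: n E_def Xs_def)
      ultimately have "(\<Sum>w\<in>W M'. c w * mon w (x, z)) = 0" using c_zero[of "(x, z)"] by simp
      also have "(\<Sum>w\<in>W M'. c w * mon w (x, z)) = (\<Sum>w\<in>(SIGMA j:{..<p}. {i. (i, j) \<in> W M'}). c (snd w, fst w) * (x ^ snd w * z ^ fst w))"
        by (rule sum.reindex_bij_witness[of _ "\<lambda>(j, i). (i, j)" "\<lambda>(i, j). (j, i)"]) (auto simp: W_def)
      also have "\<dots> = (\<Sum>j<p. \<Sum>i | (i, j) \<in> W M'. c (i, j) * (x ^ i * z ^ j))"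
        using fin_i by (subst sum.Sigma) (auto simp: case_prod_beta)
      also have "\<dots> = poly B z"
        by (simp add: B_def poly_sum poly_monom poly_A sum_distrib_right mult.assoc)
      finally show ?thesis .
    qed
    moreover have "degree B < p"
      unfolding B_def using p_gt_0
      by (intro degree_sum_less) (auto intro: le_less_trans[OF degree_monom_le])
    ultimately have "B = 0" using poly_eq_zero_if_many_roots[OF card_Y(1)] card_Y(2) by simp
    then have "coeff B j = 0" by simp
    then show ?thesis using \<open>j < p\<close> by (simp add: B_def coeff_sum)
  qed
  obtain i0 j0 where ij: "w0 = (i0, j0)" by (cases w0)
  have "coeff (A j0) i0 = c (i0, j0)"
    using w0 fin_i[of j0] by (simp add: A_def coeff_sum ij)
  then have A_nz: "A j0 \<noteq> 0" using w0 ij by auto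
  \<comment> \<open>The factor x^i alone contributes \<open>p * i\<close> to the weight, so
    \<open>i\<close> is at most \<open>M' div p\<close>. Multiplying back by \<open>p\<close> leaves
    \<open>M'\<close>, which equals Q^2 + (2G + 3)Q - 1.\<close>
  have "degree (A j0) \<le> M' div p"
  proof (unfold A_def, rule degree_sum_le[OF fin_i])
    fix i assume "i \<in> {i. (i, j0) \<in> W M'}"
    then have "p * i \<le> M'" by (simp add: W_def)
    then have "i \<le> M' div p" using p_gt_0 by (simp add: less_eq_div_iff_mult_less_eq mult.commute)
    then show "degree (monom (c (i, j0)) i) \<le> M' div p"
      using degree_monom_le le_trans by blast
  qed
  moreover have "card Xs \<le> degree (A j0)"
  proof -
    have "Xs \<subseteq> {x. poly (A j0) x = 0}"
      using A_zero w0 by (auto simp: ij W_def)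
    then have "card Xs \<le> card {x. poly (A j0) x = 0}"
      using poly_roots_finite[OF A_nz] by (intro card_mono) auto
    then show ?thesis using card_poly_roots_bound[OF A_nz] by simp
  qed
  ultimately have "p * card Xs \<le> p * (M' div p)" by (intro mult_left_mono) auto
  also have "\<dots> \<le> M'" by simp
  also have "\<dots> \<le> Q\<^sup>2 + (2 * G + 3) * Q"
    by (simp add: M'_def l_def m_def algebra_simps power2_eq_square)
  finally show ?thesis by (simp add: Xs_def E_def)
qed

end

section \<open>Additive character sums\<close>

text \<open>Cancellation could hide a large \<open>z i\<close> for some exponents, but not for all:
  for suitable, arbitrarily large \<open>k\<close> all the powers \<open>z j ^ k\<close> point
  almost in the positive real direction at once, and then the modulus of the sum is at least half of
  each single modulus.\<close>

lemma bounded_power_sums_imp_bounded: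
  fixes z :: "nat \<Rightarrow> complex"
  assumes B: "B > 0" and bound: "\<And>k. k \<ge> k0 \<Longrightarrow> cmod (\<Sum>i<n. z i ^ k) \<le> C * B ^ k" and i: "i < n"
  shows "cmod (z i) \<le> B"
proof (rule ccontr)
  assume "\<not> ?thesis"
  then have gt: "cmod (z i) / B > 1" using B by simp
  then obtain m where m: "2 * C < (cmod (z i) / B) ^ m"
    using real_arch_pow by blast
  \<comment> \<open>Approximating the multiples by \<open>M\<close> of the arguments forces the
    exponent \<open>k\<close> to be at least \<open>M\<close>, hence both in the range of the bound
    and large enough for the contradiction.\<close>
  define M where "M = max 1 (max k0 m)"
  \<comment> \<open>An error below 1/6 of a full turn is an angle below pi/3, whose cosine is at
    least 1/2.\<close>
  obtain q :: int and l where q: "0 < q"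
    "\<And>i. i < n \<Longrightarrow> \<bar>of_int q * (real M * Arg (z i) / (2 * pi)) - of_int (l i)\<bar> < 1 / real 6"
    by (rule Dirichlet_approx_simult[of 6 n "\<lambda>i. real M * Arg (z i) / (2 * pi)"]) auto
  define k where "k = M * nat q"
  have "M * 1 \<le> M * nat q" using q(1) by (intro mult_left_mono) auto
  then have k: "k \<ge> M" by (simp add: k_def)
  have Re_ge: "Re (z j ^ k) \<ge> cmod (z j) ^ k / 2" if "j < n" for j
  proof -
    define t where "t = of_int q * (real M * Arg (z j) / (2 * pi)) - of_int (l j)"
    have t: "\<bar>t\<bar> < 1 / 6" using q(2)[OF that] by (simp add: t_def)
    have "real k * Arg (z j) = 2 * pi * t + of_int (l j) * (2 * pi)"
      using q(1) by (simp add: k_def t_def field_simps)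
    then have "cos (real k * Arg (z j)) = cos (2 * pi * t)"
      by (simp add: cos_add mult.commute[of "of_int (l j)"])
    also have "\<dots> = cos \<bar>2 * pi * t\<bar>" by simp
    also have "\<dots> \<ge> cos (pi / 3)"
      using t by (intro cos_monotone_0_pi_le) (auto simp: abs_mult)
    finally have cos_ge: "cos (real k * Arg (z j)) \<ge> 1 / 2" by (simp add: cos_60)
    have "z j ^ k = (of_real (cmod (z j)) * cis (Arg (z j))) ^ k"
      using rcis_cmod_Arg[of "z j"] by (simp add: rcis_def)
    also have "\<dots> = of_real (cmod (z j) ^ k) * cis (real k * Arg (z j))"
      by (simp add: power_mult_distrib Complex.DeMoivre)
    finally have "Re (z j ^ k) = cmod (z j) ^ k * cos (real k * Arg (z j))" by simp
    moreover have "cmod (z j) ^ k * cos (real k * Arg (z j)) \<ge> cmod (z j) ^ k * (1 / 2)"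
      using cos_ge by (intro mult_left_mono) auto
    ultimately show ?thesis by simp
  qed
  have "cmod (z i) ^ k / 2 \<le> (\<Sum>j<n. cmod (z j) ^ k / 2)"
    using i by (intro member_le_sum) auto
  also have "\<dots> \<le> (\<Sum>j<n. Re (z j ^ k))" by (intro sum_mono Re_ge) auto
  also have "\<dots> \<le> cmod (\<Sum>j<n. z j ^ k)" using complex_Re_le_cmod[of "\<Sum>j<n. z j ^ k"] by simp
  also have "\<dots> \<le> C * B ^ k" using k by (intro bound) (simp add: M_def)
  finally have "(cmod (z i) / B) ^ k \<le> 2 * C" using B by (simp add: power_divide field_simps)
  moreover have "(cmod (z i) / B) ^ m \<le> (cmod (z i) / B) ^ k"
    using gt k by (intro power_increasing) (auto simp: M_def)
  ultimately show False using m by linarith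
qed

section \<open>The additive character, and estimates over extensions of even degree\<close>

context char_p_closed
begin

text \<open>The standard additive character of the prime field. Elsewhere the value is unspecified
  but still of modulus 1, so \<open>norm_psi\<close> is unconditional while \<open>psi_add\<close>
  asks for arguments in the prime field.\<close>

definition psi :: "'k \<Rightarrow> complex" where
  "psi x = cis (2 * pi * real (the_inv_into {..<p} of_nat x) / real p)"

lemma psi_of_nat: "psi (of_nat n) = cis (2 * pi * real n / real p)"
proof -
  have "(of_nat n :: 'k) = of_nat (n mod p)" by (simp add: of_nat_eq_iff_mod)
  then have "the_inv_into {..<p} of_nat (of_nat n :: 'k) = n mod p"
    using bij_betw_of_nat_subfield p_gt_0 by (simp add: the_inv_into_f_f bij_betw_def)
  then have "psi (of_nat n) = cis (2 * pi * real (n mod p) / real p)" by (simp add: psi_def)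
  also have "\<dots> = cis (2 * pi * real (n mod p) / real p) * cis (2 * pi * real (n div p))"
    using cis_multiple_2pi[of "real (n div p)"] by simp
  also have "\<dots> = cis (2 * pi * (real (n mod p) + real p * real (n div p)) / real p)"
    using p_gt_0 by (simp add: cis_mult field_simps del: of_nat_mult)
  also have "real (n mod p) + real p * real (n div p) = real n"
    by (simp only: of_nat_mult[symmetric] of_nat_add[symmetric] mod_mult_div_eq)
  finally show ?thesis .
qed

lemma subfield_1_cases:
  assumes "x \<in> subfield 1" obtains n where "x = of_nat n"
  using assms bij_betw_of_nat_subfield by (auto simp: bij_betw_def)

lemma psi_add: "x \<in> subfield 1 \<Longrightarrow> y \<in> subfield 1 \<Longrightarrow> psi (x + y) = psi x * psi y"
  by (elim subfield_1_cases, simp only: of_nat_add[symmetric] psi_of_nat)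
     (simp add: cis_mult add_divide_distrib distrib_left)

lemma norm_psi [simp]: "cmod (psi x) = 1"
  by (simp add: psi_def)

lemma psi_0 [simp]: "psi 0 = 1"
  using psi_of_nat[of 0] by simp

lemma psi_1: "psi 1 \<noteq> 1"
proof
  assume "psi 1 = 1"
  then have "cos (2 * pi / real p) = 1" using psi_of_nat[of 1] by (simp add: complex_eq_iff)
  then obtain n :: int where "2 * pi / real p = of_int n * 2 * pi"
    using cos_one_2pi_int by auto
  then have "1 = real p * of_int n" using p_gt_0 by (simp add: field_simps)
  then have "1 = int p * n" by (metis of_int_eq_1_iff of_int_mult of_int_of_nat_eq)
  then show False using p_gt_1 by (metis of_nat_1_eq_iff less_irrefl nat_int one_dvd zdvd1_eq dvd_triv_left abs_of_nat)
qed

text \<open>Translation by 1 permutes the prime field and multiplies the sum by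
  \<open>psi 1\<close>, which is not 1.\<close>

lemma sum_psi: "(\<Sum>x\<in>subfield 1. psi x) = 0"
proof -
  have "(\<Sum>x\<in>subfield 1. psi x) = (\<Sum>x\<in>subfield 1. psi (x + 1))"
    by (rule sum.reindex_bij_witness[of _ "\<lambda>x. x + 1" "\<lambda>x. x - 1"]) auto
  also have "\<dots> = (\<Sum>x\<in>subfield 1. psi x) * psi 1"
    by (simp add: psi_add sum_distrib_right)
  finally show ?thesis using psi_1 by (simp add: algebra_simps)
qed

definition char_sum :: "'k poly \<Rightarrow> nat \<Rightarrow> complex" where
  "char_sum f r = (\<Sum>x\<in>subfield r. psi (tr r (poly f x)))"

lemma poly_in_subfield:
  assumes "\<And>i. coeff f i \<in> subfield r" "x \<in> subfield r"
  shows "poly f x \<in> subfield r"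
  unfolding poly_altdef using assms by (intro subfield_sum subfield_closed(5) subfield_closed(8))

text \<open>Subtracting a constant \<open>b\<close> of trace \<open>c\<close> from \<open>f\<close>
  turns the fibre over \<open>c\<close> into the fibre over 0 and keeps the degree. Such a
  \<open>b\<close> lies in the extension and not necessarily in the prime field, which is why
  \<open>artin_schreier\<close> allows coefficients in \<open>subfield r\<close>.\<close>

lemma card_trace_fibre_le:
  assumes coeffs: "\<And>i. coeff f i \<in> subfield 1" and deg: "degree f > 0" "\<not> p dvd degree f"
    and h: "h > 0" and Q: "Q = p ^ h" and G: "G = degree f * p"
    and large: "Q \<ge> (G + 1) * (G + 2) + 2 * G + 4" and c: "c \<in> subfield 1"
  shows "p * card {x \<in> subfield (2 * h). tr (2 * h) (poly f x) = c} \<le> Q\<^sup>2 + (2 * G + 3) * Q"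
proof -
  obtain b where b: "b \<in> subfield (2 * h)" "tr (2 * h) b = c"
    using tr_surj[OF c, of "2 * h"] h by auto
  have deg_eq: "degree (f - [:b:]) = degree f"
    using deg(1) by (metis degree_add_eq_left degree_pCons_0 diff_conv_add_uminus degree_minus)
  interpret artin_schreier p K "f - [:b:]" "2 * h"
  proof
    show "coeff (f - [:b:]) i \<in> subfield (2 * h)" for i
      using coeffs b(1) subfield_1_subset[of "2 * h"]
      by (auto simp: coeff_pCons split: nat.splits intro!: subfield_closed(4))
  qed (use deg deg_eq h in auto)
  show ?thesis
    using card_trace_zero_le[OF refl Q _ large] G b(2) by (simp add: deg_eq tr_diff)
qed

text \<open>The deviations \<open>t c\<close> of the fibre sizes from their mean are bounded above
  by \<open>B\<close> and add up to zero, so their absolute values add up to at most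
  \<open>2 * p * B\<close>. The mean itself contributes nothing because \<open>psi\<close> sums to
  zero.\<close>

theorem norm_char_sum_le:
  assumes coeffs: "\<And>i. coeff f i \<in> subfield 1" and deg: "degree f > 0" "\<not> p dvd degree f"
    and h: "h > 0" and Q: "Q = p ^ h" and G: "G = degree f * p"
    and large: "Q \<ge> (G + 1) * (G + 2) + 2 * G + 4"
  shows "cmod (char_sum f (2 * h)) \<le> 2 * (2 * real G + 3) * real Q"
proof -
  define Xs where "Xs = (\<lambda>c. {x \<in> subfield (2 * h). tr (2 * h) (poly f x) = c})"
  define t where "t = (\<lambda>c. real (card (Xs c)) - real Q ^ 2 / real p)"
  define B where "B = (2 * real G + 3) * real Q / real p"
  have fin: "finite (subfield (2 * h))" "finite (subfield 1)" using finite_subfield h by auto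
  have fib: "tr (2 * h) (poly f x) \<in> subfield 1" if "x \<in> subfield (2 * h)" for x
    using coeffs subfield_1_subset that by (intro tr_in_subfield poly_in_subfield) blast+
  have t_le: "t c \<le> B" if "c \<in> subfield 1" for c
  proof -
    have "p * card (Xs c) \<le> Q\<^sup>2 + (2 * G + 3) * Q"
      unfolding Xs_def by (rule card_trace_fibre_le[OF assms that])
    then have "real (p * card (Xs c)) \<le> real (Q\<^sup>2 + (2 * G + 3) * Q)" by (simp only: of_nat_le_iff)
    then have "real (card (Xs c)) \<le> (real Q ^ 2 + (2 * real G + 3) * real Q) / real p"
      using p_gt_0 by (simp add: pos_le_divide_eq mult.commute)
    then show ?thesis by (simp add: t_def B_def add_divide_distrib)
  qed
  have card_p: "card (subfield 1) = p" using card_subfield[of 1] by simp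
  have "(\<Sum>c\<in>subfield 1. card (Xs c)) = card (\<Union>c\<in>subfield 1. Xs c)"
    using fin by (subst card_UN_disjoint) (auto simp: Xs_def)
  also have "(\<Union>c\<in>subfield 1. Xs c) = subfield (2 * h)" using fib by (auto simp: Xs_def)
  also have "card (subfield (2 * h)) = Q\<^sup>2"
    using card_subfield[of "2 * h"] h by (simp add: Q power_mult power_power_swap[of p 2])
  finally have sum_card: "(\<Sum>c\<in>subfield 1. real (card (Xs c))) = real Q ^ 2"
    by (metis of_nat_power of_nat_sum)
  have "char_sum f (2 * h) = (\<Sum>c\<in>subfield 1. \<Sum>x\<in>{x \<in> subfield (2 * h). tr (2 * h) (poly f x) = c}. psi (tr (2 * h) (poly f x)))"
    unfolding char_sum_def using fin fib by (intro sum.group[symmetric]) auto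
  also have "\<dots> = (\<Sum>c\<in>subfield 1. of_nat (card (Xs c)) * psi c)"
    by (intro sum.cong) (auto simp: Xs_def)
  also have "\<dots> = (\<Sum>c\<in>subfield 1. of_real (t c) * psi c)"
  proof -
    have "(\<Sum>c\<in>subfield 1. of_real (t c) * psi c) =
      (\<Sum>c\<in>subfield 1. of_nat (card (Xs c)) * psi c) - of_real (real Q ^ 2 / real p) * (\<Sum>c\<in>subfield 1. psi c)"
      by (simp add: t_def sum_subtractf left_diff_distrib sum_distrib_left)
    then show ?thesis using sum_psi by simp
  qed
  also have "cmod \<dots> \<le> (\<Sum>c\<in>subfield 1. \<bar>t c\<bar>)"
    by (rule order.trans[OF norm_sum]) (simp add: norm_mult)
  \<comment> \<open>If \<open>t c\<close> is nonnegative this is \<open>t c \<le> B\<close>; if it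
    is negative this is \<open>B \<ge> 0\<close>.\<close>
  also have "\<dots> \<le> (\<Sum>c\<in>subfield 1. 2 * B - t c)"
  proof (rule sum_mono)
    fix c assume "c \<in> subfield 1"
    moreover have "B \<ge> 0" by (simp add: B_def)
    ultimately show "\<bar>t c\<bar> \<le> 2 * B - t c" using t_le[of c] by linarith
  qed
  also have "\<dots> = 2 * (real p * B)"
    using p_gt_0 by (simp only: sum_subtractf sum_constant card_p t_def sum_card) simp
  also have "real p * B = (2 * real G + 3) * real Q" using p_gt_0 by (simp add: B_def)
  finally show ?thesis by (simp only: mult.assoc)
qed

end

section \<open>The L-function of a character sum\<close>

text \<open>For a monic \<open>g\<close> with roots x_i the reciprocal polynomial is the product of
  the factors 1 - x_i X, and minus X times its logarithmic derivative is the generating function of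
  the power sums of the x_i. In this form it is defined from the coefficients of \<open>g\<close>
  alone and is additive on products.\<close>

definition power_sum_fps :: "'a::field poly \<Rightarrow> 'a fps" where
  "power_sum_fps g = - fps_X * fps_deriv (fps_of_poly (reflect_poly g)) * inverse (fps_of_poly (reflect_poly g))"

lemma power_sum_fps_mult_self:
  assumes "g \<noteq> 0"
  shows "power_sum_fps g * fps_of_poly (reflect_poly g) = - fps_X * fps_deriv (fps_of_poly (reflect_poly g))"
proof -
  have "fps_nth (fps_of_poly (reflect_poly g)) 0 \<noteq> 0" using assms by simp
  then show ?thesis
    by (simp add: power_sum_fps_def mult.assoc inverse_mult_eq_1)
qed

lemma power_sum_fps_unique:
  assumes "g \<noteq> 0" "P * fps_of_poly (reflect_poly g) = - fps_X * fps_deriv (fps_of_poly (reflect_poly g))"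
  shows "P = power_sum_fps g"
proof -
  have "fps_of_poly (reflect_poly g) \<noteq> 0" using assms(1) by simp
  then show ?thesis
    using assms(2) power_sum_fps_mult_self[OF assms(1)] by (metis mult_right_cancel)
qed

lemma power_sum_fps_mult:
  assumes "g \<noteq> 0" "h \<noteq> 0"
  shows "power_sum_fps (g * h) = power_sum_fps g + power_sum_fps h"
proof (rule power_sum_fps_unique[symmetric])
  let ?G = "fps_of_poly (reflect_poly g)" and ?H = "fps_of_poly (reflect_poly h)"
  have "(power_sum_fps g + power_sum_fps h) * (?G * ?H) = power_sum_fps g * ?G * ?H + power_sum_fps h * ?H * ?G"
    by (simp add: algebra_simps)
  also have "\<dots> = - fps_X * fps_deriv (?G * ?H)"
    using assms by (simp add: power_sum_fps_mult_self algebra_simps)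
  finally show "(power_sum_fps g + power_sum_fps h) * fps_of_poly (reflect_poly (g * h)) =
      - fps_X * fps_deriv (fps_of_poly (reflect_poly (g * h)))"
    by (simp add: reflect_poly_mult fps_of_poly_mult)
qed (use assms in auto)

lemma power_sum_fps_1: "power_sum_fps 1 = 0"
  by (rule power_sum_fps_unique[symmetric]) auto

lemma power_sum_fps_linear:
  "power_sum_fps [:- x, 1:] = Abs_fps (\<lambda>n. if n = 0 then 0 else x ^ n)"
proof (rule power_sum_fps_unique[symmetric])
  have *: "fps_of_poly (reflect_poly [:- x, 1:]) = 1 - fps_const x * fps_X"
    by (rule fps_ext) (auto simp: coeff_reflect_poly coeff_pCons split: nat.splits)
  show "Abs_fps (\<lambda>n. if n = 0 then 0 else x ^ n) * fps_of_poly (reflect_poly [:- x, 1:]) =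
    - fps_X * fps_deriv (fps_of_poly (reflect_poly [:- x, 1:]))"
  proof (unfold *, rule fps_ext)
    fix n
    define F where "F = Abs_fps (\<lambda>n. if n = 0 then 0 else x ^ n)"
    have "F * (1 - fps_const x * fps_X) = F - fps_X * (fps_const x * F)"
      by (simp add: algebra_simps)
    moreover have "fps_nth F n - fps_nth (fps_X * (fps_const x * F)) n = fps_nth (fps_const x * fps_X) n"
      by (cases n rule: nat.exhaust[case_names 0 Suc]; cases "n = 1") (auto simp: F_def)
    ultimately show "fps_nth (F * (1 - fps_const x * fps_X)) n =
        fps_nth (- fps_X * fps_deriv (1 - fps_const x * fps_X)) n"
      by (simp add: mult.commute)
  qed
qed auto

lemma prod_linear_nonzero: "(\<Prod>i\<in>A. [:- x i, 1:]) \<noteq> (0::'a::field poly)"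
  by (cases "finite A") (auto simp: prod_zero_iff)

lemma power_sum_fps_prod:
  assumes "finite A"
  shows "n > 0 \<Longrightarrow> fps_nth (power_sum_fps (\<Prod>i\<in>A. [:- x i, 1:])) n = (\<Sum>i\<in>A. x i ^ n)"
  using assms
proof (induction A rule: finite_induct)
  case (insert a A)
  have "power_sum_fps (\<Prod>i\<in>insert a A. [:- x i, 1:]) =
        power_sum_fps [:- x a, 1:] + power_sum_fps (\<Prod>i\<in>A. [:- x i, 1:])"
    unfolding prod.insert[OF insert(1,2)] by (intro power_sum_fps_mult prod_linear_nonzero) simp
  then show ?case using insert by (simp add: power_sum_fps_linear)
qed (simp add: power_sum_fps_1)

lemma power_sum_fps_nth_0 [simp]: "fps_nth (power_sum_fps g) 0 = 0"
  by (simp add: power_sum_fps_def)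

text \<open>Newton's identities: the coefficient of X^(n - d) is, up to sign, the d-th elementary
  symmetric function of the roots. It does not enter the power sums below \<open>d\<close>, and it
  enters the d-th one linearly with factor \<open>- d\<close>.\<close>

lemma power_sum_fps_change_coeff:
  assumes "lead_coeff g = 1" "degree g = n" "0 < d" "d \<le> n" "j \<le> d"
  shows "fps_nth (power_sum_fps (g + monom t (n - d))) j =
         fps_nth (power_sum_fps g) j - (if j = d then of_nat d * t else 0)"
proof -
  define g' where "g' = g + monom t (n - d)"
  define G where "G = fps_of_poly (reflect_poly g)"
  define G' where "G' = fps_of_poly (reflect_poly g')"
  define D where "D = power_sum_fps g' - power_sum_fps g"
  have "degree (monom t (n - d)) < degree g"
    using assms degree_monom_le[of t "n - d"] by linarith
  then have deg': "degree g' = n" by (simp add: g'_def degree_add_eq_left assms)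
  have nz: "g \<noteq> 0" "g' \<noteq> 0" using deg' assms by auto
  have G': "G' = G + fps_const t * fps_X ^ d"
  proof (rule fps_ext)
    fix i show "fps_nth G' i = fps_nth (G + fps_const t * fps_X ^ d) i"
      using deg' assms by (auto simp: G'_def G_def fps_of_poly_nth coeff_reflect_poly g'_def)
  qed
  have "D * G + fps_const t * power_sum_fps g' * fps_X ^ d =
        power_sum_fps g' * G' - power_sum_fps g * G"
    by (simp add: D_def G' algebra_simps)
  also have "\<dots> = - fps_X * fps_deriv (fps_const t * fps_X ^ d)"
    unfolding power_sum_fps_mult_self[OF nz(1), folded G_def] power_sum_fps_mult_self[OF nz(2), folded G'_def]
    by (simp add: G' algebra_simps)
  finally have eq: "D * G = - fps_X * fps_deriv (fps_const t * fps_X ^ d) - fps_const t * power_sum_fps g' * fps_X ^ d"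
    by (simp add: algebra_simps)
  have G0: "fps_nth G 0 = 1" using assms by (simp add: G_def)
  have nth: "fps_nth (D * G) i = (if i = d then - (of_nat d * t) else 0)" if "i \<le> d" for i
  proof -
    have "fps_nth (- fps_X * fps_deriv (fps_const t * fps_X ^ d)) i = (if i = d then - (of_nat d * t) else 0)"
      using assms(3) by (cases i) (auto simp: mult_ac)
    \<comment> \<open>A power sum series has no constant term, so this product starts at degree
      \<open>d + 1\<close> or later.\<close>
    moreover have "fps_nth (fps_const t * power_sum_fps g' * fps_X ^ d) i = 0"
      using that by (simp add: fps_X_power_mult_right_nth)
    ultimately show ?thesis unfolding eq by simp
  qed
  have "fps_nth D i = (if i = d then - (of_nat d * t) else 0)" if "i \<le> d" for i
    using that
  proof (induction i rule: less_induct)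
    case (less i)
    have "fps_nth (D * G) i = (\<Sum>k=0..i. fps_nth D k * fps_nth G (i - k))" by (simp add: fps_mult_nth)
    also have "\<dots> = (\<Sum>k\<in>{i}. fps_nth D k * fps_nth G (i - k))"
      using less by (intro sum.mono_neutral_right) auto
    finally show ?case using nth[OF less.prems] G0 by simp
  qed
  from this[OF assms(5)] show ?thesis by (simp add: D_def g'_def algebra_simps)
qed

lemma prod_linear_power_dvd:
  fixes g :: "'a::field poly"
  assumes "finite A" "inj_on x A" "\<And>i. i \<in> A \<Longrightarrow> [:- x i, 1:] ^ k dvd g" "g \<noteq> 0"
  shows "(\<Prod>i\<in>A. [:- x i, 1:]) ^ k dvd g"
  using assms
proof (induction A rule: finite_induct)
  case (insert a A)
  define P where "P = (\<Prod>i\<in>A. [:- x i, 1:]) ^ k"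
  have "P dvd g" unfolding P_def using insert by (intro insert.IH) (auto simp: inj_on_def)
  then obtain h where h: "g = P * h" by (rule dvdE)
  have "poly P (x a) \<noteq> 0"
    using insert by (auto simp: P_def poly_power poly_prod prod_zero_iff inj_on_def)
  then have "order (x a) P = 0" by (rule order_0I)
  then have "order (x a) g = order (x a) h"
    using order_mult[of P h "x a"] h \<open>g \<noteq> 0\<close> by simp
  moreover have "k \<le> order (x a) g"
    using insert.prems(2)[of a] \<open>g \<noteq> 0\<close> by (simp add: order_divides)
  ultimately have "[:- x a, 1:] ^ k dvd h" by (simp add: order_divides)
  then have "[:- x a, 1:] ^ k * P dvd h * P" by (intro mult_dvd_mono) auto
  then show ?case unfolding prod.insert[OF insert(1,2)] power_mult_distrib
    by (simp only: h P_def mult.commute)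
qed simp

section \<open>Monic polynomials over the prime field and the conjugates of their roots\<close>

context char_p_closed
begin

definition monic_polys :: "nat \<Rightarrow> 'k poly set" where
  "monic_polys n = {g. lead_coeff g = 1 \<and> degree g = n \<and> (\<forall>i. coeff g i \<in> subfield 1)}"

definition frob_poly :: "'k poly \<Rightarrow> 'k poly" where
  "frob_poly = map_poly (\<lambda>c. c ^ p)"

lemma frob_poly_mult: "frob_poly (g * h) = frob_poly g * frob_poly h"
  unfolding frob_poly_def using frob_add[of _ _ 1] frob_zero[of 1]
  by (intro map_poly_mult_hom) (auto simp: power_mult_distrib)

lemma coeff_frob_poly: "coeff (frob_poly g) i = coeff g i ^ p"
  using frob_zero[of 1] by (simp add: frob_poly_def coeff_map_poly)

lemma frob_poly_eq_iff: "frob_poly g = g \<longleftrightarrow> (\<forall>i. coeff g i \<in> subfield 1)"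
  by (simp add: poly_eq_iff coeff_frob_poly subfield_def)

lemma frob_poly_linear: "frob_poly [:- x, 1:] = [:- (x ^ p), 1:]"
  using frob_minus[of x 1] frob_zero[of 1]
  by (intro poly_eqI) (simp add: coeff_frob_poly coeff_pCons split: nat.splits)

lemma frob_poly_1: "frob_poly 1 = 1"
  using frob_zero[of 1] by (intro poly_eqI) (simp add: coeff_frob_poly coeff_1)

lemma frob_poly_prod: "frob_poly (prod f A) = (\<Prod>i\<in>A. frob_poly (f i))"
  by (induction A rule: infinite_finite_induct) (auto simp: frob_poly_1 frob_poly_mult)

lemma poly_frob_poly: "poly (frob_poly g) (x ^ p) = poly g x ^ p"
proof -
  have "degree (frob_poly g) = degree g"
    unfolding frob_poly_def using p_gt_0 by (intro degree_map_poly) (auto simp: power_0_left)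
  then show ?thesis
    using frob_sum[of "\<lambda>i. coeff g i * x ^ i" "{..degree g}" 1]
    by (simp add: poly_altdef coeff_frob_poly power_mult_distrib power_power_swap[of x p])
qed

lemma monic_polys_nonzero: "g \<in> monic_polys n \<Longrightarrow> g \<noteq> 0"
  by (auto simp: monic_polys_def)

lemma monic_polys_0: "monic_polys 0 = {1}"
proof -
  have "g = 1" if "g \<in> monic_polys 0" for g
    using that by (auto simp: monic_polys_def elim!: degree_eq_zeroE)
  moreover have "1 \<in> monic_polys 0"
    by (auto simp: monic_polys_def coeff_1)
  ultimately show ?thesis by auto
qed

lemma finite_monic_polys: "finite (monic_polys n)"
proof -
  have "inj_on (\<lambda>g. \<lambda>i\<in>{..n}. coeff g i) (monic_polys n)"
  proof (rule inj_onI)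
    fix g h assume gh: "g \<in> monic_polys n" "h \<in> monic_polys n"
      "(\<lambda>i\<in>{..n}. coeff g i) = (\<lambda>i\<in>{..n}. coeff h i)"
    show "g = h"
    proof (rule poly_eqI)
      fix i show "coeff g i = coeff h i"
        using gh(1,2) fun_cong[OF gh(3), of i] by (cases "i \<le> n") (auto simp: monic_polys_def coeff_eq_0)
    qed
  qed
  moreover have "(\<lambda>g. \<lambda>i\<in>{..n}. coeff g i) ` monic_polys n \<subseteq> {..n} \<rightarrow>\<^sub>E subfield 1"
    by (rule image_subsetI) (simp add: monic_polys_def restrict_PiE_iff)
  ultimately show ?thesis
    using finite_subfield[of 1] by (metis finite_PiE finite_atMost finite_imageD finite_subset less_numeral_extra(1))
qed

lemma monic_polys_mult:
  "g \<in> monic_polys m \<Longrightarrow> h \<in> monic_polys n \<Longrightarrow> g * h \<in> monic_polys (m + n)"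
  using frob_poly_eq_iff[of g] frob_poly_eq_iff[of h] frob_poly_eq_iff[of "g * h"]
  by (auto simp: monic_polys_def lead_coeff_mult frob_poly_mult degree_mult_eq monic_polys_nonzero)

text \<open>Frobenius fixes \<open>g\<close> and \<open>g * h\<close>; cancelling \<open>g\<close>
  shows that it fixes \<open>h\<close>. So a quotient formed over the closed field automatically has
  its coefficients in the prime field.\<close>

lemma monic_polys_divide:
  assumes "g \<in> monic_polys m" "g * h \<in> monic_polys n"
  shows "h \<in> monic_polys (n - m)" "m \<le> n"
proof -
  have nz: "g \<noteq> 0" "h \<noteq> 0" using assms monic_polys_nonzero by fastforce+
  have "frob_poly g = g" "frob_poly (g * h) = g * h"
    using assms unfolding frob_poly_eq_iff monic_polys_def by auto
  then have "g * frob_poly h = g * h" by (simp add: frob_poly_mult)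
  then have "frob_poly h = h" using nz by simp
  moreover have "degree (g * h) = degree g + degree h" using nz by (simp add: degree_mult_eq)
  moreover have "lead_coeff (g * h) = lead_coeff g * lead_coeff h" by (rule lead_coeff_mult)
  ultimately show "h \<in> monic_polys (n - m)" "m \<le> n"
    using assms by (auto simp: monic_polys_def frob_poly_eq_iff)
qed

text \<open>For \<open>x\<close> in \<open>subfield r\<close> and \<open>r > 0\<close> this is the
  characteristic polynomial of multiplication by \<open>x\<close> on that field, a power of the
  minimal polynomial of \<open>x\<close> over the prime field.\<close>

definition conj_poly :: "'k \<Rightarrow> nat \<Rightarrow> 'k poly" where
  "conj_poly x r = (\<Prod>i<r. [:- (x ^ (p ^ i)), 1:])"

text \<open>Frobenius shifts the linear factors by one place, and the factor with index
  \<open>r\<close> equals the one with index 0; so it permutes the factors cyclically and fixes the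
  product.\<close>

lemma conj_poly_in_monic_polys:
  assumes "x \<in> subfield r"
  shows "conj_poly x r \<in> monic_polys r"
proof -
  define h where "h = (\<lambda>i. [:- (x ^ (p ^ i)), 1:])"
  have "degree (conj_poly x r) = (\<Sum>i<r. degree (h i))"
    unfolding conj_poly_def h_def by (rule degree_prod_eq_sum_degree) simp
  then have deg: "degree (conj_poly x r) = r" by (simp add: h_def)
  have lead: "lead_coeff (conj_poly x r) = 1"
    unfolding conj_poly_def lead_coeff_prod by simp
  have hr: "h r = h 0" using assms by (simp add: h_def subfield_def)
  have "(\<Prod>i<r. h i) * h r = h 0 * (\<Prod>i<r. h (Suc i))"
    by (simp only: prod.lessThan_Suc[symmetric] prod.lessThan_Suc_shift[symmetric])
  then have "h 0 * (\<Prod>i<r. h (Suc i)) = h 0 * (\<Prod>i<r. h i)"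
    unfolding hr by (metis mult.commute)
  moreover have "h 0 \<noteq> 0" by (simp add: h_def)
  ultimately have "(\<Prod>i<r. h (Suc i)) = (\<Prod>i<r. h i)" by (metis mult_left_cancel)
  moreover have "frob_poly (conj_poly x r) = (\<Prod>i<r. h (Suc i))"
    unfolding conj_poly_def frob_poly_prod frob_poly_linear h_def by (simp add: power_mult power_power_swap[of x _ p])
  ultimately have "frob_poly (conj_poly x r) = conj_poly x r"
    by (simp add: conj_poly_def h_def)
  then show ?thesis using deg lead by (simp add: monic_polys_def frob_poly_eq_iff)
qed

lemma conj_poly_add:
  assumes "x \<in> subfield a"
  shows "conj_poly x (a + b) = conj_poly x a * conj_poly x b"
proof (induction b)
  case (Suc b)
  have "x ^ (p ^ (a + b)) = (x ^ (p ^ a)) ^ (p ^ b)" by (simp add: power_add power_mult)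
  also have "\<dots> = x ^ (p ^ b)" using assms by (simp add: subfield_def)
  finally show ?case
    using Suc unfolding conj_poly_def add_Suc_right prod.lessThan_Suc by (simp only: mult.assoc)
qed (simp add: conj_poly_def)

lemma conj_poly_mult:
  assumes "x \<in> subfield a"
  shows "conj_poly x (a * k) = conj_poly x a ^ k"
proof (induction k)
  case (Suc k)
  show ?case using Suc conj_poly_add[OF assms, of "a * k"] by simp
qed (simp add: conj_poly_def)

text \<open>Frobenius fixes \<open>g\<close> and carries the decomposition of \<open>g\<close> at
  \<open>y\<close>, a power of X - y times a cofactor not vanishing at \<open>y\<close>, into the
  corresponding decomposition at y^p.\<close>

lemma order_frob:
  assumes "g \<in> monic_polys n"
  shows "order (x ^ (p ^ i)) g = order x g"
proof (induction i)
  case (Suc i)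
  define y where "y = x ^ (p ^ i)"
  have nz: "g \<noteq> 0" using assms by (rule monic_polys_nonzero)
  obtain h where h: "g = [:- y, 1:] ^ order y g * h" "\<not> [:- y, 1:] dvd h"
    using order_decomp[OF nz] by blast
  have "frob_poly ([:- y, 1:] ^ m) = [:- (y ^ p), 1:] ^ m" for m
    by (induction m) (auto simp only: power_0 power_Suc frob_poly_1 frob_poly_mult frob_poly_linear)
  then have "g = [:- (y ^ p), 1:] ^ order y g * frob_poly h"
    using arg_cong[OF h(1), of frob_poly] assms frob_poly_eq_iff[of g] by (simp add: frob_poly_mult monic_polys_def)
  moreover have "poly (frob_poly h) (y ^ p) \<noteq> 0"
    using h(2) by (simp add: poly_frob_poly poly_eq_0_iff_dvd)
  then have "order (y ^ p) (frob_poly h) = 0" by (rule order_0I)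
  ultimately have "order (y ^ p) g = order y g"
    using nz order_mult[of "[:- (y ^ p), 1:] ^ order y g" "frob_poly h" "y ^ p"] by (metis add.right_neutral order_power_n_n)
  moreover have "y ^ p = x ^ (p ^ Suc i)" by (simp add: y_def power_mult power_power_swap[of x p])
  ultimately show ?case using Suc by (simp add: y_def)
qed simp

text \<open>
  This and its sum over all roots replace the Euler product: they count the terms by which a monic
  polynomial contributes to the logarithmic derivative of the $L$-function.
\<close>

lemma card_conj_poly_dvd_root:
  assumes g: "g \<in> monic_polys n" and x: "poly g x = 0"
  shows "card {r \<in> {1..n}. x \<in> subfield r \<and> conj_poly x r dvd g} = order x g"
proof -
  have nz: "g \<noteq> 0" using g by (rule monic_polys_nonzero)
  \<comment> \<open>All conjugates of \<open>x\<close> are roots of \<open>g\<close>, so there are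
    finitely many. A coincidence among them puts \<open>x\<close> into some finite subfield.\<close>
  have "\<not> inj (\<lambda>i. x ^ (p ^ i))"
  proof
    assume "inj (\<lambda>i. x ^ (p ^ i))"
    moreover have "range (\<lambda>i. x ^ (p ^ i)) \<subseteq> {x. poly g x = 0}"
      using order_frob[OF g, of x] x nz by (auto simp: order_root)
    ultimately show False
      using poly_roots_finite[OF nz] finite_subset finite_imageD by (metis infinite_UNIV_nat)
  qed
  have period: "x \<in> subfield (j - i)" if "i < j" "x ^ (p ^ i) = x ^ (p ^ j)" for i j
  proof -
    have "(x ^ (p ^ (j - i))) ^ (p ^ i) = x ^ (p ^ i)"
      using that by (simp flip: power_mult power_add)
    then show ?thesis using frob_eq_iff by (auto simp: subfield_def)
  qed
  obtain i j where "i < j" "x ^ (p ^ i) = x ^ (p ^ j)"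
    using \<open>\<not> inj (\<lambda>i. x ^ (p ^ i))\<close> unfolding inj_def by (metis linorder_neqE_nat)
  then have ex: "j - i > 0 \<and> x \<in> subfield (j - i)" using period by simp
  \<comment> \<open>The degree of \<open>x\<close> over the prime field;
    \<open>conj_poly x \<delta>\<close> is the minimal polynomial.\<close>
  define \<delta> where "\<delta> = (LEAST k. k > 0 \<and> x \<in> subfield k)"
  have \<delta>: "\<delta> > 0" "x \<in> subfield \<delta>"
    unfolding \<delta>_def using LeastI[of "\<lambda>k. k > 0 \<and> x \<in> subfield k", OF ex] by auto
  have least: "k \<ge> \<delta>" if "k > 0" "x \<in> subfield k" for k
    unfolding \<delta>_def using that by (intro Least_le) auto
  have inj: "inj_on (\<lambda>i. x ^ (p ^ i)) {..<\<delta>}"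
  proof (rule linorder_inj_onI)
    fix i j assume "i < j" "i \<in> {..<\<delta>}" "j \<in> {..<\<delta>}"
    then show "x ^ (p ^ i) \<noteq> x ^ (p ^ j)"
      using period[of i j] least[of "j - i"] by fastforce
  qed auto
  have dvd: "\<delta> dvd r" if "x \<in> subfield r" for r
  proof -
    have "x ^ (p ^ r) = (x ^ (p ^ (\<delta> * (r div \<delta>)))) ^ (p ^ (r mod \<delta>))"
      by (simp flip: power_mult power_add)
    also have "x ^ (p ^ (\<delta> * (r div \<delta>))) = x"
      using subfield_mult_period[OF \<delta>(2)] by (simp add: subfield_def)
    finally have "x \<in> subfield (r mod \<delta>)" using that by (simp add: subfield_def)
    then have "r mod \<delta> = 0" using least[of "r mod \<delta>"] \<delta>(1) by (metis gr0I leD mod_less_divisor)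
    then show ?thesis by auto
  qed
  have dvd_iff: "conj_poly x (\<delta> * k) dvd g \<longleftrightarrow> k \<le> order x g" for k
  proof
    assume "conj_poly x (\<delta> * k) dvd g"
    moreover have "[:- x, 1:] dvd conj_poly x \<delta>"
      unfolding conj_poly_def using \<delta>(1) dvd_prodI[of "{..<\<delta>}" 0 "\<lambda>i. [:- (x ^ (p ^ i)), 1:]"] by simp
    ultimately have "[:- x, 1:] ^ k dvd g"
      unfolding conj_poly_mult[OF \<delta>(2)] using dvd_power_same dvd_trans by blast
    then show "k \<le> order x g" using nz by (simp add: order_divides)
  next
    assume "k \<le> order x g"
    then have "[:- (x ^ (p ^ i)), 1:] ^ k dvd g" for i
      using order_frob[OF g, of x i] by (simp add: order_divides)
    then show "conj_poly x (\<delta> * k) dvd g"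
      unfolding conj_poly_mult[OF \<delta>(2)] unfolding conj_poly_def
      using inj nz by (intro prod_linear_power_dvd) auto
  qed
  \<comment> \<open>The admissible \<open>r\<close> are the multiples \<open>\<delta> * k\<close>
    for which the k-th power of the minimal polynomial divides \<open>g\<close>, that is, with
    \<open>k\<close> up to the multiplicity of \<open>x\<close>. Comparing degrees makes
    \<open>r \<le> n\<close> automatic.\<close>
  have "{r \<in> {1..n}. x \<in> subfield r \<and> conj_poly x r dvd g} = (*) \<delta> ` {1..order x g}"
  proof (intro equalityI subsetI)
    fix r assume r: "r \<in> {r \<in> {1..n}. x \<in> subfield r \<and> conj_poly x r dvd g}"
    then obtain k where k: "r = \<delta> * k" using dvd by (auto simp: dvd_def)
    then have "k \<in> {1..order x g}" using r dvd_iff[of k] by (cases k) auto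
    then show "r \<in> (*) \<delta> ` {1..order x g}" using k by blast
  next
    fix r assume "r \<in> (*) \<delta> ` {1..order x g}"
    then obtain k where "r = \<delta> * k" "k \<in> {1..order x g}" by (rule imageE)
    then have k: "r = \<delta> * k" "1 \<le> k" "k \<le> order x g" by simp_all
    have "conj_poly x r dvd g" using dvd_iff k by simp
    moreover have xr: "x \<in> subfield r" using subfield_mult_period[OF \<delta>(2)] k by simp
    moreover have "r \<le> n"
      using dvd_imp_degree_le[OF \<open>conj_poly x r dvd g\<close> nz] conj_poly_in_monic_polys[OF xr] g
      by (simp add: monic_polys_def)
    ultimately show "r \<in> {r \<in> {1..n}. x \<in> subfield r \<and> conj_poly x r dvd g}"
      using k \<delta>(1) by simp
  qed
  moreover have "inj_on ((*) \<delta>) {1..order x g}" using \<delta>(1) by (auto simp: inj_on_def)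
  ultimately show ?thesis by (simp add: card_image)
qed

lemma sum_card_conj_poly_dvd:
  assumes g: "g \<in> monic_polys n"
  shows "(\<Sum>r=1..n. card {x \<in> subfield r. conj_poly x r dvd g}) = n"
proof -
  have nz: "g \<noteq> 0" using g by (rule monic_polys_nonzero)
  define Z where "Z = {x. poly g x = 0}"
  have fin: "finite Z" unfolding Z_def by (rule poly_roots_finite[OF nz])
  have "{x \<in> subfield r. conj_poly x r dvd g} = {x \<in> Z. x \<in> subfield r \<and> conj_poly x r dvd g}" if "r \<ge> 1" for r
  proof -
    have "poly g x = 0" if "conj_poly x r dvd g" for x
    proof -
      have "[:- x, 1:] dvd conj_poly x r"
        unfolding conj_poly_def using \<open>r \<ge> 1\<close> dvd_prodI[of "{..<r}" 0 "\<lambda>i. [:- (x ^ (p ^ i)), 1:]"] by simp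
      then show ?thesis using that dvd_trans poly_eq_0_iff_dvd by blast
    qed
    then show ?thesis by (auto simp: Z_def)
  qed
  then have "(\<Sum>r=1..n. card {x \<in> subfield r. conj_poly x r dvd g}) =
        (\<Sum>r=1..n. card {x \<in> Z. x \<in> subfield r \<and> conj_poly x r dvd g})"
    by (intro sum.cong) auto
  also have "\<dots> = (\<Sum>r=1..n. \<Sum>x\<in>Z. if x \<in> subfield r \<and> conj_poly x r dvd g then 1 else 0)"
    using fin by (simp add: sum.If_cases Int_def)
  also have "\<dots> = (\<Sum>x\<in>Z. \<Sum>r=1..n. if x \<in> subfield r \<and> conj_poly x r dvd g then 1 else 0)"
    by (rule sum.swap)
  also have "\<dots> = (\<Sum>x\<in>Z. card {r \<in> {1..n}. x \<in> subfield r \<and> conj_poly x r dvd g})"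
    by (simp add: sum.If_cases Int_def)
  also have "\<dots> = (\<Sum>x\<in>Z. order x g)"
    using card_conj_poly_dvd_root[OF g] by (intro sum.cong) (auto simp: Z_def)
  also have "\<dots> = n" using alg_closed_sum_order[OF nz] g by (simp add: Z_def monic_polys_def)
  finally show ?thesis .
qed

section \<open>Coefficients of the L-function and their recurrence\<close>

lemma power_sum_fps_in_subfield:
  assumes g: "g \<in> monic_polys n"
  shows "fps_nth (power_sum_fps g) j \<in> subfield 1"
proof (induction j rule: less_induct)
  case (less j)
  define P where "P = power_sum_fps g"
  define G where "G = fps_of_poly (reflect_poly g)"
  have G: "fps_nth G i \<in> subfield 1" for i
    using g by (simp add: G_def coeff_reflect_poly monic_polys_def)
  have G0: "fps_nth G 0 = 1" using g by (auto simp: G_def monic_polys_def)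
  have "fps_nth (P * G) j = - (if j = 0 then 0 else of_nat j * fps_nth G j)"
    unfolding P_def G_def power_sum_fps_mult_self[OF monic_polys_nonzero[OF g]] by (cases j) auto
  moreover have "fps_nth (P * G) j = (\<Sum>i<j. fps_nth P i * fps_nth G (j - i)) + fps_nth P j"
    by (simp add: fps_mult_nth atLeast0AtMost lessThan_Suc_atMost[symmetric] G0)
  \<comment> \<open>Newton's identities, solved without division because the reciprocal polynomial
    has constant term 1.\<close>
  ultimately have "fps_nth P j = - (if j = 0 then 0 else of_nat j * fps_nth G j) - (\<Sum>i<j. fps_nth P i * fps_nth G (j - i))"
    by (simp add: algebra_simps)
  also have "\<dots> \<in> subfield 1"
  proof (rule subfield_closed(4))
    show "- (if j = 0 then 0 else of_nat j * fps_nth G j) \<in> subfield 1"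
      using G by auto
    show "(\<Sum>i<j. fps_nth P i * fps_nth G (j - i)) \<in> subfield 1"
      using less G by (intro subfield_sum subfield_closed(5)) (auto simp: P_def)
  qed
  finally show ?case by (simp add: P_def)
qed

text \<open>When \<open>f\<close> has no constant term and \<open>g\<close> is monic, this is the
  sum of f over the roots of \<open>g\<close> with multiplicity, written through power sums. It is
  additive on products of \<open>g\<close>, so composing with \<open>psi\<close> gives a
  multiplicative function of monic polynomials, whose L-function has the coefficients
  \<open>lfun_coeff\<close>.\<close>

definition trace_form :: "'k poly \<Rightarrow> 'k poly \<Rightarrow> 'k" where
  "trace_form f g = (\<Sum>j=1..degree f. coeff f j * fps_nth (power_sum_fps g) j)"

definition lfun_coeff :: "'k poly \<Rightarrow> nat \<Rightarrow> complex" where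
  "lfun_coeff f n = (\<Sum>g\<in>monic_polys n. psi (trace_form f g))"

lemma trace_form_in_subfield:
  "(\<And>i. coeff f i \<in> subfield 1) \<Longrightarrow> g \<in> monic_polys n \<Longrightarrow> trace_form f g \<in> subfield 1"
  unfolding trace_form_def using power_sum_fps_in_subfield by (intro subfield_sum subfield_closed(5)) auto

lemma trace_form_mult:
  "g \<noteq> 0 \<Longrightarrow> h \<noteq> 0 \<Longrightarrow> trace_form f (g * h) = trace_form f g + trace_form f h"
  by (simp add: trace_form_def power_sum_fps_mult distrib_left sum.distrib)

lemma trace_form_conj_poly:
  assumes "\<And>i. coeff f i \<in> subfield 1" "coeff f 0 = 0"
  shows "trace_form f (conj_poly x r) = tr r (poly f x)"
proof -
  have "fps_nth (power_sum_fps (conj_poly x r)) j = tr r (x ^ j)" if "j > 0" for j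
    using power_sum_fps_prod[OF _ that, of "{..<r}" "\<lambda>i. x ^ (p ^ i)"]
    by (simp add: conj_poly_def tr_def power_power_swap[of x j])
  then have "trace_form f (conj_poly x r) = (\<Sum>j=1..degree f. coeff f j * tr r (x ^ j))"
    by (simp add: trace_form_def)
  also have "\<dots> = (\<Sum>j\<le>degree f. coeff f j * tr r (x ^ j))"
    using assms(2) by (intro sum.mono_neutral_left) (auto simp: Suc_le_eq)
  also have "\<dots> = (\<Sum>j\<le>degree f. tr r (coeff f j * x ^ j))"
    using assms(1) by (simp add: tr_scale)
  also have "\<dots> = tr r (poly f x)"
    by (simp add: poly_altdef tr_sum)
  finally show ?thesis .
qed

lemma lfun_coeff_0: "lfun_coeff f 0 = 1"
  by (simp add: lfun_coeff_def monic_polys_0 trace_form_def power_sum_fps_1)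

text \<open>For \<open>n \<ge> degree f\<close> the coefficient of X^(n - d) of a monic polynomial
  of degree \<open>n\<close> can be moved freely. A suitable shift permutes these polynomials and
  raises the trace form by exactly 1, so the sum equals \<open>psi 1\<close> times itself.\<close>

lemma lfun_coeff_eq_0:
  assumes coeffs: "\<And>i. coeff f i \<in> subfield 1" and deg: "degree f > 0" "\<not> p dvd degree f"
    and n: "n \<ge> degree f"
  shows "lfun_coeff f n = 0"
proof -
  define d where "d = degree f"
  define a where "a = of_nat d * lead_coeff f"
  have "a \<noteq> 0"
    using deg of_nat_eq_0_iff_char_dvd[where 'a = 'k, of d] CHAR_K by (auto simp: a_def d_def)
  \<comment> \<open>Shifting that coefficient by \<open>t\<close> changes the d-th power sum by
    \<open>- d * t\<close>, hence the trace form by \<open>- a * t\<close>, which this choice makes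
    1.\<close>
  define t where "t = - inverse a"
  have a: "a \<in> subfield 1" using coeffs unfolding a_def by (intro subfield_closed(5)) auto
  then have t: "t \<in> subfield 1" unfolding t_def by (intro subfield_closed)
  have shift: "g + monom s (n - d) \<in> monic_polys n" if "g \<in> monic_polys n" "s \<in> subfield 1" for g s
  proof -
    have less: "n - d < degree g"
      using that deg n by (auto simp: monic_polys_def d_def)
    then have "degree (g + monom s (n - d)) = degree g"
      using degree_monom_le[of s "n - d"] by (intro degree_add_eq_left) linarith
    moreover from this less have "lead_coeff (g + monom s (n - d)) = lead_coeff g"
      by simp
    ultimately have "degree (g + monom s (n - d)) = degree g" "lead_coeff (g + monom s (n - d)) = lead_coeff g"
      by auto
    then show ?thesis using that by (auto simp: monic_polys_def)
  qed
  have shift': "g - monom t (n - d) \<in> monic_polys n" if "g \<in> monic_polys n" for g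
    using shift[OF that, of "- t"] t by (simp add: minus_monom[symmetric] subfield_closed(6))
  have tf: "trace_form f (g + monom t (n - d)) = trace_form f g + 1" if "g \<in> monic_polys n" for g
  proof -
    have "trace_form f (g + monom t (n - d)) =
      (\<Sum>j=1..d. coeff f j * (fps_nth (power_sum_fps g) j - (if j = d then of_nat d * t else 0)))"
      unfolding trace_form_def d_def[symmetric] using that deg n
      by (intro sum.cong refl) (subst power_sum_fps_change_coeff, auto simp: monic_polys_def d_def)
    also have "\<dots> = trace_form f g - (\<Sum>j=1..d. if j = d then coeff f d * (of_nat d * t) else 0)"
      unfolding trace_form_def d_def[symmetric] right_diff_distrib sum_subtractf
      by (intro arg_cong2[where f = minus] refl sum.cong) auto
    also have "(\<Sum>j=1..d. if j = d then coeff f d * (of_nat d * t) else 0) = a * t"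
      using deg by (simp add: a_def d_def)
    also have "a * t = - 1" using \<open>a \<noteq> 0\<close> by (simp add: t_def)
    finally show ?thesis by simp
  qed
  have "lfun_coeff f n = (\<Sum>g\<in>monic_polys n. psi (trace_form f (g + monom t (n - d))))"
    unfolding lfun_coeff_def
    by (rule sum.reindex_bij_witness[of _ "\<lambda>g. g + monom t (n - d)" "\<lambda>g. g - monom t (n - d)"])
       (use shift[OF _ t] shift' in auto)
  also have "\<dots> = (\<Sum>g\<in>monic_polys n. psi (trace_form f g) * psi 1)"
    using trace_form_in_subfield[OF coeffs] by (intro sum.cong refl) (simp only: tf, rule psi_add, auto)
  also have "\<dots> = lfun_coeff f n * psi 1" by (simp add: lfun_coeff_def sum_distrib_right)
  finally show ?thesis using psi_1 by simp
qed

lemma char_sum_mult_lfun_coeff: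
  assumes coeffs: "\<And>i. coeff f i \<in> subfield 1" "coeff f 0 = 0" and r: "r \<le> n"
  shows "char_sum f r * lfun_coeff f (n - r) =
         (\<Sum>x\<in>subfield r. \<Sum>g | g \<in> monic_polys n \<and> conj_poly x r dvd g. psi (trace_form f g))"
proof -
  have "(\<Sum>h\<in>monic_polys (n - r). psi (tr r (poly f x)) * psi (trace_form f h)) =
        (\<Sum>g | g \<in> monic_polys n \<and> conj_poly x r dvd g. psi (trace_form f g))" if x: "x \<in> subfield r" for x
  proof -
    have cp: "conj_poly x r \<in> monic_polys r" using conj_poly_in_monic_polys[OF x] .
    have nz: "conj_poly x r \<noteq> 0" using monic_polys_nonzero[OF cp] .
    have "psi (tr r (poly f x)) * psi (trace_form f h) = psi (trace_form f (conj_poly x r * h))"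
      if h: "h \<in> monic_polys (n - r)" for h
    proof -
      have "psi (trace_form f (conj_poly x r * h)) = psi (tr r (poly f x) + trace_form f h)"
        using trace_form_mult[OF nz monic_polys_nonzero[OF h]] trace_form_conj_poly[OF coeffs] by simp
      also have "\<dots> = psi (tr r (poly f x)) * psi (trace_form f h)"
        using trace_form_in_subfield[OF coeffs(1) cp] trace_form_in_subfield[OF coeffs(1) h]
          trace_form_conj_poly[OF coeffs] by (intro psi_add) auto
      finally show ?thesis by simp
    qed
    then have "(\<Sum>h\<in>monic_polys (n - r). psi (tr r (poly f x)) * psi (trace_form f h)) =
      (\<Sum>h\<in>monic_polys (n - r). psi (trace_form f (conj_poly x r * h)))"
      by (rule sum.cong[OF refl])
    also have "\<dots> = (\<Sum>g\<in>(\<lambda>h. conj_poly x r * h) ` monic_polys (n - r). psi (trace_form f g))"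
      using nz by (subst sum.reindex) (auto simp: inj_on_def)
    also have "(\<lambda>h. conj_poly x r * h) ` monic_polys (n - r) = {g \<in> monic_polys n. conj_poly x r dvd g}"
    proof (intro equalityI subsetI)
      fix g assume "g \<in> (\<lambda>h. conj_poly x r * h) ` monic_polys (n - r)"
      then show "g \<in> {g \<in> monic_polys n. conj_poly x r dvd g}"
        using monic_polys_mult[OF cp, of _ "n - r"] r by auto
    next
      fix g assume g: "g \<in> {g \<in> monic_polys n. conj_poly x r dvd g}"
      then obtain h where "g = conj_poly x r * h" by (elim CollectE conjE dvdE)
      then show "g \<in> (\<lambda>h. conj_poly x r * h) ` monic_polys (n - r)"
        using monic_polys_divide(1)[OF cp, of h n] g by auto
    qed
    finally show ?thesis by simp
  qed
  then show ?thesis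
    unfolding char_sum_def lfun_coeff_def sum_product by (rule sum.cong[OF refl])
qed

text \<open>The identity X L' = S L read off coefficientwise. On the right each monic
  \<open>g\<close> of degree \<open>n\<close> occurs once for every pair of \<open>r\<close> and
  \<open>x\<close> with \<open>conj_poly x r\<close> dividing it, which is \<open>n\<close> times
  altogether.\<close>

lemma lfun_coeff_recurrence:
  assumes coeffs: "\<And>i. coeff f i \<in> subfield 1" "coeff f 0 = 0"
  shows "of_nat n * lfun_coeff f n = (\<Sum>r=1..n. char_sum f r * lfun_coeff f (n - r))"
proof -
  have "(\<Sum>r=1..n. char_sum f r * lfun_coeff f (n - r)) =
    (\<Sum>r=1..n. \<Sum>x\<in>subfield r. \<Sum>g | g \<in> monic_polys n \<and> conj_poly x r dvd g. psi (trace_form f g))"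
    using char_sum_mult_lfun_coeff[OF coeffs] by (intro sum.cong) auto
  also have "\<dots> = (\<Sum>r=1..n. \<Sum>x\<in>subfield r. \<Sum>g\<in>monic_polys n. if conj_poly x r dvd g then psi (trace_form f g) else 0)"
    using finite_monic_polys by (intro sum.cong refl sum.inter_filter) auto
  also have "\<dots> = (\<Sum>r=1..n. \<Sum>g\<in>monic_polys n. \<Sum>x\<in>subfield r. if conj_poly x r dvd g then psi (trace_form f g) else 0)"
    by (intro sum.cong refl sum.swap)
  also have "\<dots> = (\<Sum>g\<in>monic_polys n. \<Sum>r=1..n. \<Sum>x\<in>subfield r. if conj_poly x r dvd g then psi (trace_form f g) else 0)"
    by (rule sum.swap)
  also have "\<dots> = (\<Sum>g\<in>monic_polys n. \<Sum>r=1..n. of_nat (card {x \<in> subfield r. conj_poly x r dvd g}) * psi (trace_form f g))"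
  proof (intro sum.cong refl)
    fix g r assume "r \<in> {1..n}"
    then have "finite (subfield r)" using finite_subfield by simp
    then show "(\<Sum>x\<in>subfield r. if conj_poly x r dvd g then psi (trace_form f g) else 0) =
        of_nat (card {x \<in> subfield r. conj_poly x r dvd g}) * psi (trace_form f g)"
      by (simp add: sum.inter_filter[symmetric])
  qed
  also have "\<dots> = (\<Sum>g\<in>monic_polys n. of_nat (\<Sum>r=1..n. card {x \<in> subfield r. conj_poly x r dvd g}) * psi (trace_form f g))"
    by (simp add: sum_distrib_right)
  also have "\<dots> = of_nat n * lfun_coeff f n"
    unfolding lfun_coeff_def sum_distrib_left by (intro sum.cong refl) (simp only: sum_card_conj_poly_dvd)
  finally show ?thesis by simp
qed

theorem char_sum_eq_power_sum:
  assumes coeffs: "\<And>i. coeff f i \<in> subfield 1" "coeff f 0 = 0" and deg: "degree f > 0" "\<not> p dvd degree f"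
  obtains zs :: "complex list" where "length zs < degree f"
    "\<And>r. r > 0 \<Longrightarrow> char_sum f r = - (\<Sum>i<length zs. (zs ! i) ^ r)"
proof -
  define L where "L = (\<Sum>n<degree f. monom (lfun_coeff f n) n)"
  have coeff_L: "coeff L n = lfun_coeff f n" for n
    using lfun_coeff_eq_0[OF coeffs(1) deg, of n] by (simp add: L_def coeff_sum)
  have deg_L: "degree L < degree f"
    unfolding L_def using deg(1) by (intro degree_sum_less) (auto intro: le_less_trans[OF degree_monom_le])
  have L0: "coeff L 0 = 1" by (simp add: coeff_L lfun_coeff_0)
  \<comment> \<open>The roots of \<open>g\<close> are the reciprocals of those of \<open>L\<close>.
    Since \<open>L\<close> has constant term 1, \<open>g\<close> is monic of the same degree and
    reflects back to \<open>L\<close>, so the recurrence identifies \<open>- S\<close> as the power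
    sum series of \<open>g\<close>.\<close>
  define g where "g = reflect_poly L"
  have g: "lead_coeff g = 1" "degree g = degree L" "reflect_poly g = L"
    using L0 by (auto simp: g_def coeff_reflect_poly)
  then have nz: "g \<noteq> 0" by auto
  obtain A where A: "size A = degree g" "g = smult (lead_coeff g) (\<Prod>x\<in>#A. [:- x, 1:])"
    using alg_closed_imp_factorization[OF nz] by blast
  obtain zs where zs: "mset zs = A" using ex_mset by blast
  have g_prod: "g = (\<Prod>i\<in>{..<length zs}. [:- (zs ! i), 1:])"
  proof -
    have "g = prod_list (map (\<lambda>x. [:- x, 1:]) zs)"
      using A(2) g(1) by (simp add: zs[symmetric] prod_mset_prod_list[symmetric])
    then show ?thesis by (simp add: prod.list_conv_set_nth atLeast0LessThan)
  qed
  define S where "S = Abs_fps (\<lambda>r. if r = 0 then 0 else char_sum f r)"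
  have "- S * fps_of_poly (reflect_poly g) = - fps_X * fps_deriv (fps_of_poly (reflect_poly g))"
  proof (rule fps_ext)
    fix n
    have "fps_nth (S * fps_of_poly L) n = (\<Sum>r=0..n. fps_nth S r * lfun_coeff f (n - r))"
      by (simp add: fps_mult_nth coeff_L)
    also have "\<dots> = (\<Sum>r=1..n. char_sum f r * lfun_coeff f (n - r))"
      by (intro sum.mono_neutral_cong_right) (auto simp: S_def)
    also have "\<dots> = of_nat n * lfun_coeff f n" using lfun_coeff_recurrence[OF coeffs] by simp
    also have "\<dots> = fps_nth (fps_X * fps_deriv (fps_of_poly L)) n" by (cases n) (auto simp: coeff_L)
    finally show "fps_nth (- S * fps_of_poly (reflect_poly g)) n = fps_nth (- fps_X * fps_deriv (fps_of_poly (reflect_poly g))) n"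
      by (simp add: g(3))
  qed
  then have "- S = power_sum_fps g" by (rule power_sum_fps_unique[OF nz])
  then have S: "fps_nth S r = - fps_nth (power_sum_fps g) r" for r by (metis fps_neg_nth minus_minus)
  show thesis
  proof (rule that[of zs])
    show "length zs < degree f" using A(1) zs g(2) deg_L by (metis size_mset)
    show "char_sum f r = - (\<Sum>i<length zs. (zs ! i) ^ r)" if "r > 0" for r
      using S[of r] that power_sum_fps_prod[OF finite_lessThan that, of "\<lambda>i. zs ! i" "length zs"] g_prod
      by (simp add: S_def)
  qed
qed

section \<open>Weil's bound over the prime field\<close>

theorem norm_char_sum_1_le:
  assumes coeffs: "\<And>i. coeff f i \<in> subfield 1" "coeff f 0 = 0" and deg: "degree f > 0" "\<not> p dvd degree f"
  shows "cmod (char_sum f 1) \<le> (real (degree f) - 1) * sqrt (real p)"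
proof -
  obtain zs :: "complex list" where zs: "length zs < degree f"
    "\<And>r. r > 0 \<Longrightarrow> char_sum f r = - (\<Sum>i<length zs. (zs ! i) ^ r)"
    using char_sum_eq_power_sum[OF assms] by blast
  define G where "G = degree f * p"
  define k0 where "k0 = (G + 1) * (G + 2) + 2 * G + 4"
  \<comment> \<open>Squares appear because the character sums are estimated for even
    \<open>r\<close> only. The constant depends on \<open>G\<close> but not on \<open>k\<close>, as
    the power sum argument requires.\<close>
  have "cmod ((zs ! i)\<^sup>2) \<le> real p" if i: "i < length zs" for i
  proof (rule bounded_power_sums_imp_bounded[where n = "length zs" and z = "\<lambda>i. (zs ! i)\<^sup>2"])
    show "real p > 0" using p_gt_0 by simp
    fix k assume k: "k \<ge> k0"
    then have "k > 0" by (simp add: k0_def)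
    have "k \<le> p ^ k" using less_exp[of k] power_mono[of 2 p k] p_gt_1 by linarith
    then have "p ^ k \<ge> (G + 1) * (G + 2) + 2 * G + 4" using k by (simp add: k0_def)
    then have "cmod (char_sum f (2 * k)) \<le> 2 * (2 * real G + 3) * real (p ^ k)"
      using norm_char_sum_le[OF coeffs(1) deg \<open>k > 0\<close> refl G_def] by simp
    moreover have "char_sum f (2 * k) = - (\<Sum>i<length zs. ((zs ! i)\<^sup>2) ^ k)"
      using zs(2)[of "2 * k"] \<open>k > 0\<close> by (simp add: power_mult)
    ultimately show "cmod (\<Sum>i<length zs. ((zs ! i)\<^sup>2) ^ k) \<le> 2 * (2 * real G + 3) * real p ^ k"
      by simp
  qed (rule i)
  then have z: "cmod (zs ! i) \<le> sqrt (real p)" if "i < length zs" for i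
    using that by (simp add: norm_power real_le_rsqrt)
  have "cmod (char_sum f 1) = cmod (\<Sum>i<length zs. zs ! i)" using zs(2)[of 1] by simp
  also have "\<dots> \<le> (\<Sum>i<length zs. sqrt (real p))"
    by (rule order.trans[OF norm_sum]) (intro sum_mono z, simp)
  also have "\<dots> = real (length zs) * sqrt (real p)" by simp
  also have "\<dots> \<le> (real (degree f) - 1) * sqrt (real p)"
    using zs(1) by (intro mult_right_mono) auto
  finally show ?thesis .
qed

text \<open>Reducing the coefficients modulo \<open>p\<close> yields a polynomial over the prime
  field without changing any summand. It has degree exactly \<open>d\<close> since \<open>p\<close>
  does not divide \<open>a d\<close>, and 0 < d < p makes this degree prime to
  \<open>p\<close>.\<close>

lemma norm_cis_poly_sum_le:
  fixes a :: "nat \<Rightarrow> int"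
  assumes d: "1 \<le> d" "d < p" and ad: "\<not> int p dvd a d"
  shows "cmod (\<Sum>n<p. cis (2 * pi * real_of_int (\<Sum>j=1..d. a j * int n ^ j) / real p)) \<le> (real d - 1) * sqrt (real p)"
proof -
  define b where "b = (\<lambda>j. nat (a j mod int p))"
  have b: "int (b j) = a j mod int p" for j using p_gt_0 by (simp add: b_def)
  define f where "f = (\<Sum>j=1..d. monom (of_nat (b j) :: 'k) j)"
  have coeff_f: "coeff f i = (if i \<in> {1..d} then of_nat (b i) else 0)" for i
    by (simp add: f_def coeff_sum)
  have bd: "\<not> p dvd b d"
    using ad b[of d] by (metis dvd_mod_iff dvd_refl int_dvd_int_iff)
  have "coeff f d \<noteq> 0" using bd d by (simp add: coeff_f of_nat_eq_0_iff_char_dvd CHAR_K)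
  then have deg: "degree f = d"
    by (intro antisym degree_le le_degree) (auto simp: coeff_f)
  have "cmod (char_sum f 1) \<le> (real (degree f) - 1) * sqrt (real p)"
    using d deg nat_dvd_not_less by (intro norm_char_sum_1_le) (auto simp: coeff_f)
  moreover have "char_sum f 1 = (\<Sum>n<p. cis (2 * pi * real_of_int (\<Sum>j=1..d. a j * int n ^ j) / real p))"
  proof -
    have "char_sum f 1 = (\<Sum>x\<in>subfield 1. psi (poly f x))"
      by (simp add: char_sum_def tr_def)
    also have "\<dots> = (\<Sum>n<p. psi (poly f (of_nat n)))"
      by (rule sum.reindex_bij_betw[OF bij_betw_of_nat_subfield, symmetric])
    also have "\<dots> = (\<Sum>n<p. cis (2 * pi * real_of_int (\<Sum>j=1..d. a j * int n ^ j) / real p))"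
    proof (rule sum.cong[OF refl])
      fix n
      define m where "m = (\<Sum>j=1..d. b j * n ^ j)"
      define m' where "m' = (\<Sum>j=1..d. a j * int n ^ j)"
      have "poly f (of_nat n) = of_nat m"
        by (simp add: f_def m_def poly_sum poly_monom)
      moreover have "int m mod int p = m' mod int p"
      proof -
        have "[(\<Sum>j=1..d. int (b j) * int n ^ j) = m'] (mod int p)"
          unfolding m'_def by (intro cong_sum cong_mult) (auto simp: b unique_euclidean_semiring_class.cong_def)
        then show ?thesis by (simp add: m_def unique_euclidean_semiring_class.cong_def)
      qed
      then obtain k where k: "m' = int m + int p * k"
        by (metis mod_eqE add.commute add_diff_cancel_left' diff_add_cancel)
      have "2 * pi * real_of_int m' / real p = 2 * pi * real m / real p + 2 * pi * of_int k"
        using p_gt_0 by (simp add: k field_simps)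
      then have "cis (2 * pi * real_of_int m' / real p) = cis (2 * pi * real m / real p)"
        by (simp flip: cis_mult)
      ultimately show "psi (poly f (of_nat n)) = cis (2 * pi * real_of_int (\<Sum>j=1..d. a j * int n ^ j) / real p)"
        by (simp add: psi_of_nat m'_def)
    qed
    finally show ?thesis .
  qed
  ultimately show ?thesis by (simp add: deg)
qed

end

text \<open>A predicate on the prime alone, free of the field type, so that \<open>bad_prime\<close>
  can be chosen among its counterexamples before any type is built.\<close>

definition weil_bound :: "nat \<Rightarrow> bool" where
  "weil_bound p \<longleftrightarrow> (\<forall>(a :: nat \<Rightarrow> int) d. 1 \<le> d \<longrightarrow> d < p \<longrightarrow> \<not> int p dvd a d \<longrightarrow>
     cmod (\<Sum>n<p. cis (2 * pi * real_of_int (\<Sum>j=1..d. a j * int n ^ j) / real p)) \<le> (real d - 1) * sqrt (real p))"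

text \<open>
  The prime field has to be a type, which cannot depend on a variable. So it is built for one fixed
  prime only: a counterexample to Weil's bound, if there is one.
\<close>

definition bad_prime :: nat where
  "bad_prime = (if \<exists>p. prime p \<and> \<not> weil_bound p then SOME p. prime p \<and> \<not> weil_bound p else 2)"

lemma prime_bad_prime: "prime bad_prime"
  unfolding bad_prime_def by (auto intro: someI2_ex)

typedef bad_index = "{..<bad_prime}"
  using prime_gt_0_nat[OF prime_bad_prime] by auto

lemma card_bad_index: "CARD(bad_index) = bad_prime"
  using type_definition.card[OF type_definition_bad_index] by simp

instance bad_index :: prime_card
  by standard (simp add: card_bad_index prime_bad_prime)

theorem weil_bound_prime:
  assumes "prime p"
  shows "weil_bound p"
proof (rule ccontr)
  assume "\<not> weil_bound p"
  then have "\<exists>p. prime p \<and> \<not> weil_bound p" using assms by blast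
  then have "\<not> weil_bound bad_prime"
    using someI_ex[of "\<lambda>p. prime p \<and> \<not> weil_bound p"] by (simp add: bad_prime_def)
  moreover interpret char_p_closed bad_prime "TYPE(bad_index mod_ring alg_closure)"
    by standard (simp_all add: card_bad_index prime_bad_prime)
  have "weil_bound bad_prime"
    unfolding weil_bound_def by (intro allI impI norm_cis_poly_sum_le)
  ultimately show False by blast
qed

section \<open>Fourier series on the cube\<close>

abbreviation unit_interval_measure :: "real measure" where
  "unit_interval_measure \<equiv> restrict_space lborel {0..1}"

lemma prob_space_unit_interval: "prob_space unit_interval_measure"
  by (rule prob_spaceI) (simp add: emeasure_restrict_space)

lemma sets_unit_interval: "A \<in> sets borel \<Longrightarrow> A \<subseteq> {0..1} \<Longrightarrow> A \<in> sets unit_interval_measure"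
  by (auto simp: sets_restrict_space image_iff intro!: bexI[of _ A])

lemma measurable_unit_interval [measurable]: "(\<lambda>x. x) \<in> borel_measurable unit_interval_measure"
  by (rule measurable_restrict_space1) simp

interpretation cube_product: product_sigma_finite "\<lambda>_::nat. unit_interval_measure"
  by (rule product_sigma_finite.intro) (rule prob_space_imp_sigma_finite[OF prob_space_unit_interval])

lemma prob_space_cube_measure: "prob_space (cube_measure s)"
  unfolding cube_measure_def by (intro prob_space_PiM prob_space_unit_interval)

lemma space_cube_measure: "space (cube_measure s) = cube s"
  by (simp add: cube_measure_def cube_def space_PiM space_restrict_space)

lemma measurable_cube_component [measurable]: "j < s \<Longrightarrow> (\<lambda>x. x j) \<in> borel_measurable (cube_measure s)"
  unfolding cube_measure_def
  by (rule measurable_compose[OF _ measurable_unit_interval]) (rule measurable_component_singleton, simp)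

text \<open>The seminorm and the Fourier expansion concern the half-open cube, the integrals the
  closed one; the faces between them are null sets.\<close>

lemma AE_half_open_cube: "AE x in cube_measure s. x \<in> half_open_cube s"
proof -
  have "AE x in unit_interval_measure. x \<noteq> 1"
    by (subst AE_restrict_space_iff) (auto intro: AE_mp[OF AE_lborel_singleton])
  then have "AE x in cube_measure s. x j \<noteq> 1" if "j < s" for j
    unfolding cube_measure_def using that
    by (intro AE_PiM_component prob_space_unit_interval) auto
  then have "AE x in cube_measure s. \<forall>j\<in>{..<s}. x j \<noteq> 1"
    by (intro AE_finite_allI) auto
  then show ?thesis
  proof (rule AE_mp, intro AE_I2 impI)
    fix x assume x: "x \<in> space (cube_measure s)" "\<forall>j\<in>{..<s}. x j \<noteq> 1"
    then have "x j < 1" if "j < s" for j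
      using that by (auto simp: space_cube_measure cube_def PiE_iff less_le)
    then show "x \<in> half_open_cube s"
      using x by (auto simp: space_cube_measure cube_def half_open_cube_def PiE_iff)
  qed
qed

section \<open>Characters of the torus\<close>

definition chr :: "nat \<Rightarrow> (nat \<Rightarrow> int) \<Rightarrow> (nat \<Rightarrow> real) \<Rightarrow> complex" where
  "chr s k x = cis (2 * pi * (\<Sum>j<s. real_of_int (k j) * x j))"

lemma norm_chr [simp]: "norm (chr s k x) = 1"
  by (simp add: chr_def)

lemma borel_measurable_cis [measurable]: "cis \<in> borel_measurable borel"
  by (intro borel_measurable_continuous_onI continuous_intros)

lemma measurable_chr [measurable]: "chr s k \<in> borel_measurable (cube_measure s)"
proof -
  have "(\<lambda>x. \<Sum>j<s. real_of_int (k j) * x j) \<in> borel_measurable (cube_measure s)"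
    by (intro borel_measurable_sum borel_measurable_times) (auto intro: measurable_cube_component)
  then show ?thesis unfolding chr_def by measurable
qed

lemma chr_mult: "chr s k x * chr s l x = chr s (\<lambda>j. k j + l j) x"
  by (simp add: chr_def cis_mult distrib_left distrib_right sum.distrib)

lemma chr_cong: "(\<And>j. j < s \<Longrightarrow> k j = l j) \<Longrightarrow> chr s k = chr s l"
  unfolding chr_def by (intro ext arg_cong[where f = cis]) simp

lemma chr_update:
  assumes "j < s"
  shows "chr s (k(j := k j + m)) x = chr s k x * cis (2 * pi * (real_of_int m * x j))"
proof -
  have "(\<Sum>i<s. real_of_int ((k(j := k j + m)) i) * x i) =
        (\<Sum>i<s. real_of_int (k i) * x i + (if i = j then real_of_int m * x j else 0))"
    by (intro sum.cong) (auto simp: algebra_simps)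
  also have "\<dots> = (\<Sum>i<s. real_of_int (k i) * x i) + real_of_int m * x j"
    using assms by (simp add: sum.distrib)
  finally show ?thesis by (simp add: chr_def cis_mult distrib_left)
qed

lemma fourier_coeff_chr: "fourier_coeff s f k = (\<integral>x. complex_of_real (f x) * chr s (\<lambda>j. - k j) x \<partial>cube_measure s)"
  unfolding fourier_coeff_def chr_def by (simp add: sum_negf)

lemma integral_cis_unit_interval:
  "(\<integral>t. cis (2 * pi * (of_int n * t)) \<partial>unit_interval_measure) = (if n = 0 then 1 else 0)"
proof (cases "n = 0")
  case True
  then show ?thesis by (simp add: measure_def emeasure_restrict_space space_restrict_space)
next
  case False
  define F where "F = (\<lambda>t. cis (2 * pi * (of_int n * t)) / (2 * pi * of_int n * \<i>))"
  have "(\<integral>t. cis (2 * pi * (of_int n * t)) \<partial>unit_interval_measure) =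
        (\<integral>t. indicator {0..1} t *\<^sub>R cis (2 * pi * (of_int n * t)) \<partial>lborel)"
    by (subst integral_restrict_space) auto
  also have "\<dots> = F 1 - F 0"
  proof (rule integral_FTC_Icc)
    fix t :: real
    have "((\<lambda>t. cis (2 * pi * (of_int n * t))) has_vector_derivative (2 * pi * of_int n) *\<^sub>R (\<i> * cis (2 * pi * (of_int n * t)))) (at t within {0..1})"
      unfolding cis_conv_exp by (rule derivative_eq_intros has_vector_derivative_real_field | simp add: scaleR_conv_of_real)+
    then have "(F has_vector_derivative ((2 * pi * of_int n) *\<^sub>R (\<i> * cis (2 * pi * (of_int n * t)))) / (2 * pi * of_int n * \<i>)) (at t within {0..1})"
      unfolding F_def by (rule has_vector_derivative_divide)
    then show "(F has_vector_derivative cis (2 * pi * (of_int n * t))) (at t within {0..1})"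
      using False by (simp add: scaleR_conv_of_real)
  qed (auto intro!: continuous_intros)
  also have "F 1 = F 0"
    using cis_multiple_2pi[of "of_int n"] by (simp add: F_def mult_ac)
  finally show ?thesis using False by simp
qed

lemma integral_chr:
  "(\<integral>x. chr s k x \<partial>cube_measure s) = (if \<forall>j<s. k j = 0 then 1 else 0)"
proof -
  have "chr s k x = (\<Prod>j<s. cis (2 * pi * (of_int (k j) * x j)))" for x
    unfolding chr_def by (induction s) (auto simp: distrib_left cis_mult[symmetric] mult.commute)
  then have "(\<integral>x. chr s k x \<partial>cube_measure s) = (\<integral>x. (\<Prod>j<s. cis (2 * pi * (of_int (k j) * x j))) \<partial>cube_measure s)"
    by simp
  also have "\<dots> = (\<Prod>j<s. (\<integral>t. cis (2 * pi * (of_int (k j) * t)) \<partial>unit_interval_measure))"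
    unfolding cube_measure_def
  proof (rule cube_product.product_integral_prod)
    fix j
    interpret prob_space unit_interval_measure by (rule prob_space_unit_interval)
    show "integrable unit_interval_measure (\<lambda>t. cis (2 * pi * (of_int (k j) * t)))"
      by (rule integrable_const_bound[of _ 1]) auto
  qed simp
  also have "\<dots> = (\<Prod>j<s. if k j = 0 then 1 else 0)" by (simp only: integral_cis_unit_interval)
  also have "\<dots> = (if \<forall>j<s. k j = 0 then 1 else 0)" by (auto simp: prod_zero_iff)
  finally show ?thesis .
qed

lemma integrable_mult_bounded:
  fixes h g :: "'a \<Rightarrow> complex"
  assumes "integrable M h" "g \<in> borel_measurable M" "\<And>x. x \<in> space M \<Longrightarrow> norm (g x) \<le> B"
  shows "integrable M (\<lambda>x. h x * g x)"
proof (rule Bochner_Integration.integrable_bound)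
  show "integrable M (\<lambda>x. B * norm (h x))" using assms(1) by auto
  show "(\<lambda>x. h x * g x) \<in> borel_measurable M" using assms(1,2) by measurable
  show "AE x in M. norm (h x * g x) \<le> norm (B * norm (h x))"
  proof (rule AE_I2)
    fix x assume "x \<in> space M"
    then have "norm (g x) \<le> \<bar>B\<bar>" using assms(3)[of x] by linarith
    then have "norm (h x) * norm (g x) \<le> norm (h x) * \<bar>B\<bar>" by (intro mult_left_mono) auto
    then show "norm (h x * g x) \<le> norm (B * norm (h x))" by (simp add: norm_mult abs_mult mult.commute)
  qed
qed

text \<open>Continuity along coordinatewise convergent sequences in the half-open cube. This is all
  that the estimates below use, and it avoids a topology on the extensional functions.\<close>

definition seq_cont :: "nat \<Rightarrow> ((nat \<Rightarrow> real) \<Rightarrow> 'b::topological_space) \<Rightarrow> (nat \<Rightarrow> real) \<Rightarrow> bool" where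
  "seq_cont s h x \<longleftrightarrow> (\<forall>T. (\<forall>n. T n \<in> half_open_cube s) \<longrightarrow> (\<forall>j<s. (\<lambda>n. T n j) \<longlonglongrightarrow> x j) \<longrightarrow> (\<lambda>n. h (T n)) \<longlonglongrightarrow> h x)"

lemma seq_contD:
  fixes h :: "(nat \<Rightarrow> real) \<Rightarrow> 'b::metric_space"
  assumes "seq_cont s h x" "\<epsilon> > 0"
  obtains \<delta> where "\<delta> > 0" "\<And>t. t \<in> half_open_cube s \<Longrightarrow> (\<And>j. j < s \<Longrightarrow> \<bar>t j - x j\<bar> < \<delta>) \<Longrightarrow> dist (h t) (h x) < \<epsilon>"
proof (rule ccontr)
  assume "\<not> thesis"
  then have "\<forall>n. \<exists>t. t \<in> half_open_cube s \<and> (\<forall>j<s. \<bar>t j - x j\<bar> < inverse (real (Suc n))) \<and> \<not> dist (h t) (h x) < \<epsilon>"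
    using that[of "inverse (real (Suc _))"] by force
  from choice[OF this] obtain T where T: "\<And>n. T n \<in> half_open_cube s"
    "\<And>n j. j < s \<Longrightarrow> \<bar>T n j - x j\<bar> < inverse (real (Suc n))" "\<And>n. \<not> dist (h (T n)) (h x) < \<epsilon>" by blast
  have "(\<lambda>n. T n j) \<longlonglongrightarrow> x j" if "j < s" for j
  proof -
    have "(\<lambda>n. T n j - x j) \<longlonglongrightarrow> 0"
      using T(2)[OF that] by (intro LIMSEQ_norm_0) (auto simp: field_simps)
    then show ?thesis by (rule LIM_zero_cancel)
  qed
  then have "(\<lambda>n. h (T n)) \<longlonglongrightarrow> h x" using assms(1) T(1) unfolding seq_cont_def by blast
  then have "\<forall>\<^sub>F n in sequentially. dist (h (T n)) (h x) < \<epsilon>" using assms(2) by (rule tendstoD)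
  then show False using T(3) by (auto simp: eventually_sequentially)
qed

section \<open>Uniqueness of Fourier coefficients at points of continuity\<close>

text \<open>
  A trigonometric polynomial with a strict maximum at $x$; its high powers concentrate there, so a
  function with vanishing Fourier coefficients cannot be nonzero at a point of continuity.
\<close>

definition peak :: "nat \<Rightarrow> (nat \<Rightarrow> real) \<Rightarrow> (nat \<Rightarrow> real) \<Rightarrow> real" where
  "peak s x t = (\<Sum>j<s. 1 + cos (2 * pi * (t j - x j)))"

lemma measurable_peak [measurable]: "peak s x \<in> borel_measurable (cube_measure s)"
proof -
  have "(\<lambda>t. 1 + cos (2 * pi * (t j - x j))) \<in> borel_measurable (cube_measure s)" if "j < s" for j
    using measurable_cube_component[OF that] by measurable
  then show ?thesis unfolding peak_def by (intro borel_measurable_sum) auto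
qed

lemma peak_bounds: "0 \<le> peak s x t" "peak s x t \<le> 2 * real s"
proof -
  show "0 \<le> peak s x t" unfolding peak_def
    by (intro sum_nonneg) (metis cos_ge_minus_one add.commute neg_le_iff_le le_add_same_cancel2 diff_ge_0_iff_ge diff_minus_eq_add)
  have "peak s x t \<le> (\<Sum>j<s. 2)" unfolding peak_def
    by (intro sum_mono) (simp add: add_le_same_cancel1 order_trans[OF add_left_mono[OF cos_le_one]])
  then show "peak s x t \<le> 2 * real s" by simp
qed

lemma integrable_peak_power_chr:
  assumes "integrable (cube_measure s) h"
  shows "integrable (cube_measure s) (\<lambda>t. h t * (of_real (peak s x t ^ n) * chr s k t))"
proof (rule integrable_mult_bounded[OF assms, where B = "(2 * real s) ^ n"])
  show "norm (of_real (peak s x t ^ n) * chr s k t) \<le> (2 * real s) ^ n" for t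
    using peak_bounds[of s x t] power_mono[of "peak s x t" "2 * real s" n] by (simp add: norm_mult norm_power)
qed measurable

text \<open>Each cosine in \<open>peak\<close> is half the sum of two exponentials, so a factor
  \<open>peak\<close> only moves the frequency by at most one in one coordinate. The induction on
  \<open>n\<close> therefore runs over all frequencies simultaneously.\<close>

lemma integral_peak_power_chr:
  assumes int: "integrable (cube_measure s) h"
    and zero: "\<And>k. (\<integral>t. h t * chr s k t \<partial>cube_measure s) = 0"
  shows "(\<integral>t. h t * (of_real (peak s x t ^ n) * chr s k t) \<partial>cube_measure s) = 0"
proof (induction n arbitrary: k)
  case 0
  then show ?case using zero by simp
next
  case (Suc n)
  define I where "I = (\<lambda>k t. h t * (of_real (peak s x t ^ n) * chr s k t))"
  have int_I: "integrable (cube_measure s) (I k)" for k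
    unfolding I_def by (rule integrable_peak_power_chr[OF int])
  have step: "h t * (of_real (peak s x t ^ Suc n) * chr s k t) =
     (\<Sum>j<s. I k t + cis (- 2 * pi * x j) / 2 * I (k(j := k j + 1)) t + cis (2 * pi * x j) / 2 * I (k(j := k j + - 1)) t)" for t
  proof -
    have "(1 + of_real (cos (2 * pi * (t j - x j)))) * chr s k t =
       chr s k t + cis (- 2 * pi * x j) / 2 * chr s (k(j := k j + 1)) t + cis (2 * pi * x j) / 2 * chr s (k(j := k j + - 1)) t"
      if "j < s" for j
    proof -
      have "complex_of_real (cos \<theta>) = (cis \<theta> + cis (- \<theta>)) / 2" for \<theta> by (simp add: complex_eq_iff)
      from this[of "2 * pi * (t j - x j)"]
      have "complex_of_real (cos (2 * pi * (t j - x j))) =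
        (cis (- 2 * pi * x j) * cis (2 * pi * (real_of_int 1 * t j)) + cis (2 * pi * x j) * cis (2 * pi * (real_of_int (- 1) * t j))) / 2"
        by (simp add: cis_mult algebra_simps)
      moreover have "(1 + (a * b + c * d) / 2) * e = e + a / 2 * (e * b) + c / 2 * (e * d)"
        for a b c d e :: complex
        by (simp add: algebra_simps add_divide_distrib)
      ultimately show ?thesis
        unfolding chr_update[OF that] by (simp only:)
    qed
    then have peak_chr: "of_real (peak s x t) * chr s k t =
      (\<Sum>j<s. chr s k t + cis (- 2 * pi * x j) / 2 * chr s (k(j := k j + 1)) t + cis (2 * pi * x j) / 2 * chr s (k(j := k j + - 1)) t)"
      unfolding peak_def by (simp add: sum_distrib_right)
    have "h t * (of_real (peak s x t ^ Suc n) * chr s k t) =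
        h t * of_real (peak s x t ^ n) * (of_real (peak s x t) * chr s k t)"
      by (simp only: power_Suc of_real_mult mult_ac)
    then have "h t * (of_real (peak s x t ^ Suc n) * chr s k t) = h t * of_real (peak s x t ^ n) *
      (\<Sum>j<s. chr s k t + cis (- 2 * pi * x j) / 2 * chr s (k(j := k j + 1)) t + cis (2 * pi * x j) / 2 * chr s (k(j := k j + - 1)) t)"
      unfolding peak_chr .
    then show ?thesis
      unfolding I_def by (simp only: sum_distrib_left distrib_left mult_ac)
  qed
  have "(\<integral>t. h t * (of_real (peak s x t ^ Suc n) * chr s k t) \<partial>cube_measure s) =
     (\<Sum>j<s. (\<integral>t. I k t + cis (- 2 * pi * x j) / 2 * I (k(j := k j + 1)) t + cis (2 * pi * x j) / 2 * I (k(j := k j + - 1)) t \<partial>cube_measure s))"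
    unfolding step by (intro Bochner_Integration.integral_sum Bochner_Integration.integrable_add integrable_mult_right int_I)
  also have "\<dots> = 0"
  proof (rule sum.neutral, rule ballI)
    fix j
    have "(\<integral>t. I k t + cis (- 2 * pi * x j) / 2 * I (k(j := k j + 1)) t + cis (2 * pi * x j) / 2 * I (k(j := k j + - 1)) t \<partial>cube_measure s)
      = (\<integral>t. I k t \<partial>cube_measure s) + cis (- 2 * pi * x j) / 2 * (\<integral>t. I (k(j := k j + 1)) t \<partial>cube_measure s)
        + cis (2 * pi * x j) / 2 * (\<integral>t. I (k(j := k j + - 1)) t \<partial>cube_measure s)"
      by (simp only: Bochner_Integration.integral_add Bochner_Integration.integrable_add integrable_mult_right int_I integral_mult_right_zero)
    also have "\<dots> = 0" using Suc by (simp add: I_def)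
    finally show "(\<integral>t. I k t + cis (- 2 * pi * x j) / 2 * I (k(j := k j + 1)) t + cis (2 * pi * x j) / 2 * I (k(j := k j + - 1)) t \<partial>cube_measure s) = 0" .
  qed
  finally show ?case .
qed

text \<open>The hypotheses keep \<open>u - y\<close> at distance at least \<delta> from every
  integer; beyond half a period the cosine is reflected.\<close>

lemma cos_outside_le:
  assumes "0 < \<delta>" "\<delta> \<le> y" "\<delta> \<le> 1 - y" "0 \<le> u" "u \<le> 1" "\<bar>u - y\<bar> \<ge> \<delta>"
  shows "cos (2 * pi * (u - y)) \<le> cos (2 * pi * \<delta>)"
proof -
  define v where "v = \<bar>u - y\<bar>"
  have v: "\<delta> \<le> v" "v \<le> 1 - \<delta>" using assms by (auto simp: v_def)
  have eq: "cos (2 * pi * (u - y)) = cos (2 * pi * v)"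
    using cos_abs_real[of "2 * pi * (u - y)"] by (simp add: v_def abs_mult)
  show ?thesis
  proof (cases "v \<le> 1 / 2")
    case True
    then have "2 * pi * v \<le> pi" by simp
    moreover have "2 * pi * \<delta> \<le> 2 * pi * v" using v by simp
    ultimately show ?thesis unfolding eq using assms(1) by (intro cos_monotone_0_pi_le) auto
  next
    case False
    have "cos (2 * pi * v) = cos (2 * pi * (1 - v))"
      by (simp add: right_diff_distrib cos_diff)
    also have "\<dots> \<le> cos (2 * pi * \<delta>)"
    proof (rule cos_monotone_0_pi_le)
      show "2 * pi * \<delta> \<le> 2 * pi * (1 - v)" using v by (intro mult_left_mono) auto
      have "2 * pi * (1 - v) \<le> 2 * pi * (1 / 2)" using False by (intro mult_left_mono) auto
      then show "2 * pi * (1 - v) \<le> pi" by simp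
    qed (use assms(1) in auto)
    finally show ?thesis unfolding eq .
  qed
qed

lemma measure_box_pos:
  assumes "\<delta> > 0" "\<And>j. j < s \<Longrightarrow> \<delta> \<le> x j \<and> \<delta> \<le> 1 - x j"
  shows "{t \<in> space (cube_measure s). \<forall>j<s. \<bar>t j - x j\<bar> < \<delta>} \<in> sets (cube_measure s)"
    "measure (cube_measure s) {t \<in> space (cube_measure s). \<forall>j<s. \<bar>t j - x j\<bar> < \<delta>} > 0"
proof -
  define B where "B = (\<lambda>j. {x j - \<delta><..<x j + \<delta>})"
  have sub: "B j \<subseteq> {0..1}" if "j < s" for j using assms(2)[OF that] by (auto simp: B_def)
  have B_sets: "B j \<in> sets unit_interval_measure" if "j < s" for j
    using sub[OF that] by (intro sets_unit_interval) (auto simp: B_def)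
  have eq: "{t \<in> space (cube_measure s). \<forall>j<s. \<bar>t j - x j\<bar> < \<delta>} = PiE {..<s} B"
  proof (intro equalityI subsetI)
    fix t assume "t \<in> {t \<in> space (cube_measure s). \<forall>j<s. \<bar>t j - x j\<bar> < \<delta>}"
    then show "t \<in> PiE {..<s} B"
      by (auto simp: space_cube_measure cube_def PiE_iff B_def abs_less_iff)
  next
    fix t assume t: "t \<in> PiE {..<s} B"
    then have "t j \<in> B j" if "j < s" for j using that by (auto simp: PiE_iff)
    then have "\<bar>t j - x j\<bar> < \<delta>" "t j \<in> {0..1}" if "j < s" for j
      using that sub[OF that] by (force simp: B_def)+
    then show "t \<in> {t \<in> space (cube_measure s). \<forall>j<s. \<bar>t j - x j\<bar> < \<delta>}"
      using t by (auto simp: space_cube_measure cube_def PiE_iff)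
  qed
  show "{t \<in> space (cube_measure s). \<forall>j<s. \<bar>t j - x j\<bar> < \<delta>} \<in> sets (cube_measure s)"
    unfolding eq unfolding cube_measure_def using B_sets by (intro sets_PiM_I_finite) auto
  have "emeasure (cube_measure s) (PiE {..<s} B) = (\<Prod>j<s. emeasure unit_interval_measure (B j))"
    unfolding cube_measure_def using B_sets by (intro cube_product.emeasure_PiM) auto
  also have "\<dots> = (\<Prod>j<s. ennreal (2 * \<delta>))"
    using sub assms(1) by (intro prod.cong) (auto simp: emeasure_restrict_space B_def)
  also have "\<dots> = ennreal ((2 * \<delta>) ^ s)" using assms(1) by (simp add: ennreal_power)
  finally have "measure (cube_measure s) (PiE {..<s} B) = (2 * \<delta>) ^ s"
    using assms(1) by (simp add: measure_def)
  then show "measure (cube_measure s) {t \<in> space (cube_measure s). \<forall>j<s. \<bar>t j - x j\<bar> < \<delta>} > 0"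
    unfolding eq using assms(1) by simp
qed

lemma fourier_zero_imp_zero_interior:
  fixes h :: "(nat \<Rightarrow> real) \<Rightarrow> complex"
  assumes s: "s \<ge> 1" and int: "integrable (cube_measure s) h"
    and zero: "\<And>k. (\<integral>t. h t * chr s k t \<partial>cube_measure s) = 0"
    and x: "\<And>j. j < s \<Longrightarrow> 0 < x j \<and> x j < 1" and cont: "seq_cont s h x"
  shows "h x = 0"
proof (rule ccontr)
  assume nz: "h x \<noteq> 0"
  define c where "c = (cmod (h x))\<^sup>2 / 2"
  have c: "c > 0" using nz by (simp add: c_def)
  \<comment> \<open>Rotating by the conjugate of \<open>h x\<close> gives a real function that is at
    least \<open>c\<close> near \<open>x\<close>.\<close>
  define H where "H = (\<lambda>t. Re (cnj (h x) * h t))"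
  obtain \<delta>0 where \<delta>0: "\<delta>0 > 0" "\<And>t. t \<in> half_open_cube s \<Longrightarrow> (\<And>j. j < s \<Longrightarrow> \<bar>t j - x j\<bar> < \<delta>0) \<Longrightarrow> dist (h t) (h x) < cmod (h x) / 2"
    using seq_contD[OF cont, of "cmod (h x) / 2"] nz by auto
  define \<delta> where "\<delta> = Min (insert \<delta>0 ((\<lambda>j. min (x j) (1 - x j)) ` {..<s}))"
  have \<delta>: "\<delta> > 0" "\<delta> \<le> \<delta>0" "\<And>j. j < s \<Longrightarrow> \<delta> \<le> x j \<and> \<delta> \<le> 1 - x j"
  proof -
    show "\<delta> > 0" unfolding \<delta>_def using \<delta>0 x by (subst Min_gr_iff) auto
    show "\<delta> \<le> \<delta>0" unfolding \<delta>_def by (rule Min_le) auto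
    fix j assume "j < s"
    then have "\<delta> \<le> min (x j) (1 - x j)" unfolding \<delta>_def by (intro Min_le) auto
    then show "\<delta> \<le> x j \<and> \<delta> \<le> 1 - x j" by simp
  qed
  have H_ge: "H t \<ge> c" if "t \<in> half_open_cube s" "\<And>j. j < s \<Longrightarrow> \<bar>t j - x j\<bar> < \<delta>" for t
  proof -
    have "dist (h t) (h x) < cmod (h x) / 2"
      using that \<delta>(2) by (intro \<delta>0(2)) (auto intro: less_le_trans)
    then have "cmod (cnj (h x) * (h t - h x)) \<le> cmod (h x) * (cmod (h x) / 2)"
      unfolding norm_mult dist_norm by (intro mult_mono) auto
    moreover have "\<bar>Re (cnj (h x) * (h t - h x))\<bar> \<le> cmod (cnj (h x) * (h t - h x))" by (rule abs_Re_le_cmod)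
    moreover have "H t = Re (cnj (h x) * h x) + Re (cnj (h x) * (h t - h x))"
      by (simp add: H_def algebra_simps)
    moreover have "Re (cnj (h x) * h x) = (cmod (h x))\<^sup>2"
      by (simp add: cmod_power2 flip: power2_eq_square)
    ultimately show ?thesis by (simp add: c_def power2_eq_square)
  qed
  have "\<delta> \<le> 1 / 2" using \<delta>(3)[of 0] s by linarith
  \<comment> \<open>The loss in \<open>peak\<close> caused by a single coordinate at distance at
    least \<delta>. The smaller radius \<open>\<delta>'\<close> is chosen so that all
    \<open>s\<close> coordinates together lose less than half of it; hence
    \<open>\<rho> < \<rho>'\<close>.\<close>
  define \<eta> where "\<eta> = 1 - cos (2 * pi * \<delta>)"
  have \<eta>: "\<eta> > 0" "\<eta> \<le> 2"
  proof -
    have "cos (2 * pi * \<delta>) < cos 0"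
      using \<delta>(1) \<open>\<delta> \<le> 1 / 2\<close> by (intro cos_monotone_0_pi) auto
    then show "\<eta> > 0" by (simp add: \<eta>_def)
    show "\<eta> \<le> 2" using cos_ge_minus_one[of "2 * pi * \<delta>"] by (simp add: \<eta>_def)
  qed
  have "((\<lambda>y. real s * (1 - cos (2 * pi * y))) \<longlongrightarrow> real s * (1 - cos (2 * pi * 0))) (at_right 0)"
    by (intro tendsto_intros)
  then have "((\<lambda>y. real s * (1 - cos (2 * pi * y))) \<longlongrightarrow> 0) (at_right 0)" by simp
  then have "\<forall>\<^sub>F y in at_right 0. real s * (1 - cos (2 * pi * y)) < \<eta> / 2"
    using \<eta>(1) by (intro order_tendstoD(2)) auto
  moreover have "\<forall>\<^sub>F y in at_right 0. y < \<delta> \<and> 0 < (y::real)"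
    using \<delta>(1) by (simp add: eventually_at_right_field) (metis)
  ultimately have "\<forall>\<^sub>F y in at_right 0. real s * (1 - cos (2 * pi * y)) < \<eta> / 2 \<and> y < \<delta> \<and> 0 < y"
    by (rule eventually_conj)
  then obtain \<delta>' where \<delta>': "real s * (1 - cos (2 * pi * \<delta>')) < \<eta> / 2" "\<delta>' < \<delta>" "0 < \<delta>'"
    using eventually_happens[of _ "at_right (0::real)"] by auto
  define \<rho> where "\<rho> = 2 * real s - \<eta>"
  define \<rho>' where "\<rho>' = 2 * real s - \<eta> / 2"
  have \<rho>: "0 \<le> \<rho>" "\<rho> < \<rho>'" using s \<eta> by (auto simp: \<rho>_def \<rho>'_def)
  define U where "U = {t \<in> space (cube_measure s). \<forall>j<s. \<bar>t j - x j\<bar> < \<delta>'}"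
  have U: "U \<in> sets (cube_measure s)" "measure (cube_measure s) U > 0"
    unfolding U_def using \<delta>' \<delta>(3) by (intro measure_box_pos; fastforce)+
  have outside: "peak s x t \<le> \<rho>" if t: "t \<in> half_open_cube s" "j < s" "\<bar>t j - x j\<bar> \<ge> \<delta>" for t j
  proof -
    have "t j \<in> {0..<1}" using t(1,2) by (auto simp: half_open_cube_def PiE_iff)
    then have "cos (2 * pi * (t j - x j)) \<le> 1 - \<eta>"
      unfolding \<eta>_def using cos_outside_le[of \<delta> "x j" "t j"] \<delta>(1) \<delta>(3)[OF t(2)] t(3) by simp
    then have "peak s x t \<le> (\<Sum>i<s. 2 - (if i = j then \<eta> else 0))"
      unfolding peak_def using cos_le_one by (intro sum_mono) auto
    also have "\<dots> = \<rho>" using t(2) by (simp add: sum_subtractf \<rho>_def)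
    finally show ?thesis .
  qed
  have inside: "peak s x t \<ge> \<rho>'" if "t \<in> U" for t
  proof -
    have "cos (2 * pi * (t j - x j)) \<ge> cos (2 * pi * \<delta>')" if "j < s" for j
    proof -
      have "\<bar>t j - x j\<bar> < \<delta>'" using \<open>t \<in> U\<close> that by (auto simp: U_def)
      then have "cos (2 * pi * \<bar>t j - x j\<bar>) \<ge> cos (2 * pi * \<delta>')"
        using \<delta>' \<open>\<delta> \<le> 1 / 2\<close> by (intro cos_monotone_0_pi_le) auto
      moreover have "cos (2 * pi * \<bar>t j - x j\<bar>) = cos (2 * pi * (t j - x j))"
        using cos_abs_real[of "2 * pi * (t j - x j)"] by (simp add: abs_mult)
      ultimately show ?thesis by simp
    qed
    then have "peak s x t \<ge> (\<Sum>j<s. 1 + cos (2 * pi * \<delta>'))"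
      unfolding peak_def by (intro sum_mono) auto
    then show ?thesis using \<delta>'(1) by (simp add: \<rho>'_def algebra_simps)
  qed
  have int_H: "integrable (cube_measure s) H"
    unfolding H_def using int by auto
  \<comment> \<open>The integral of H against the n-th power of the peak vanishes, so the positive
    mass over \<open>U\<close> must be balanced from outside the \<delta>-box, where the peak is at
    most \<rho>. The zone between \<open>U\<close> and the \<delta>-box contributes nonnegatively.
    Letting \<open>n\<close> grow contradicts \<open>\<rho> < \<rho>'\<close>.\<close>
  have bound: "c * measure (cube_measure s) U * \<rho>' ^ n \<le> (\<integral>t. \<bar>H t\<bar> \<partial>cube_measure s) * \<rho> ^ n" for n
  proof -
    have eq: "Re (cnj (h x) * (h t * (of_real (peak s x t ^ n) * chr s (\<lambda>_. 0) t))) = H t * peak s x t ^ n" for t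
      by (simp add: H_def chr_def algebra_simps flip: of_real_power)
    have int1: "integrable (cube_measure s) (\<lambda>t. cnj (h x) * (h t * (of_real (peak s x t ^ n) * chr s (\<lambda>_. 0) t)))"
      using integrable_peak_power_chr[OF int] by auto
    have "(\<integral>t. H t * peak s x t ^ n \<partial>cube_measure s) =
      Re (\<integral>t. cnj (h x) * (h t * (of_real (peak s x t ^ n) * chr s (\<lambda>_. 0) t)) \<partial>cube_measure s)"
      using integral_Re[OF int1] unfolding eq by simp
    also have "\<dots> = 0" using integral_peak_power_chr[OF int zero, of x n "\<lambda>_. 0"] by simp
    finally have z: "(\<integral>t. H t * peak s x t ^ n \<partial>cube_measure s) = 0" .
    have int2: "integrable (cube_measure s) (\<lambda>t. H t * peak s x t ^ n)"
      using integrable_Re[OF int1] unfolding eq .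
    have int_U: "integrable (cube_measure s) (\<lambda>t. indicator U t * (c * \<rho>' ^ n))"
      using finite_measure.emeasure_real[OF prob_space.finite_measure[OF prob_space_cube_measure], of s U] U(1)
      by (intro integrable_mult_left integrable_real_indicator) auto
    have int_HR: "integrable (cube_measure s) (\<lambda>t. \<bar>H t\<bar> * \<rho> ^ n)" using int_H by auto
    have "(\<integral>t. indicator U t * (c * \<rho>' ^ n) - \<bar>H t\<bar> * \<rho> ^ n \<partial>cube_measure s) \<le> (\<integral>t. H t * peak s x t ^ n \<partial>cube_measure s)"
    proof (rule integral_mono_AE)
      show "AE t in cube_measure s. indicator U t * (c * \<rho>' ^ n) - \<bar>H t\<bar> * \<rho> ^ n \<le> H t * peak s x t ^ n"
        using AE_half_open_cube
      proof (rule AE_mp, intro AE_I2 impI)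
        fix t assume t: "t \<in> half_open_cube s"
        have pos: "\<bar>H t\<bar> * \<rho> ^ n \<ge> 0" using \<rho> by simp
        show "indicator U t * (c * \<rho>' ^ n) - \<bar>H t\<bar> * \<rho> ^ n \<le> H t * peak s x t ^ n"
        proof (cases "\<forall>j<s. \<bar>t j - x j\<bar> < \<delta>")
          case True
          then have Ht: "H t \<ge> c" using t by (intro H_ge) auto
          have "indicator U t * (c * \<rho>' ^ n) \<le> H t * peak s x t ^ n"
          proof (cases "t \<in> U")
            case True
            have "c * \<rho>' ^ n \<le> H t * peak s x t ^ n"
              using Ht c inside[OF True] \<rho> by (intro mult_mono power_mono) auto
            then show ?thesis using True by simp
          next
            case False
            then show ?thesis using Ht c peak_bounds(1)[of s x t] by simp
          qed
          then show ?thesis using pos by linarith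
        next
          case False
          then obtain j where j: "j < s" "\<bar>t j - x j\<bar> \<ge> \<delta>" by force
          have "t \<notin> U"
          proof
            assume "t \<in> U"
            then have "\<bar>t j - x j\<bar> < \<delta>'" using j by (simp add: U_def)
            then show False using j \<delta>' by simp
          qed
          have "- (H t * peak s x t ^ n) \<le> \<bar>H t\<bar> * peak s x t ^ n"
            using peak_bounds(1)[of s x t] abs_ge_minus_self[of "H t"]
            by (metis minus_mult_left mult_right_mono zero_le_power)
          also have "\<dots> \<le> \<bar>H t\<bar> * \<rho> ^ n"
            using outside[OF t j] peak_bounds(1)[of s x t] by (intro mult_left_mono power_mono) auto
          finally show ?thesis using \<open>t \<notin> U\<close> by simp
        qed
      qed
    qed (use int_U int_HR int2 in auto)
    also have "\<dots> = 0" by (rule z)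
    also have "(\<integral>t. indicator U t * (c * \<rho>' ^ n) - \<bar>H t\<bar> * \<rho> ^ n \<partial>cube_measure s) =
       measure (cube_measure s) U * (c * \<rho>' ^ n) - (\<integral>t. \<bar>H t\<bar> \<partial>cube_measure s) * \<rho> ^ n"
      using int_U int_HR U(1) sets.sets_into_space[OF U(1)] by (simp add: Bochner_Integration.integral_diff Int_absorb2)
    finally show ?thesis by (simp add: mult_ac)
  qed
  define q where "q = \<rho> / \<rho>'"
  have q: "0 \<le> q" "q < 1" using \<rho> by (auto simp: q_def)
  have le: "c * measure (cube_measure s) U \<le> (\<integral>t. \<bar>H t\<bar> \<partial>cube_measure s) * q ^ n" for n
    using bound[of n] \<rho> by (simp add: q_def power_divide field_simps)
  have lim: "(\<lambda>n. (\<integral>t. \<bar>H t\<bar> \<partial>cube_measure s) * q ^ n) \<longlonglongrightarrow> (\<integral>t. \<bar>H t\<bar> \<partial>cube_measure s) * 0"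
    using q by (intro tendsto_intros LIMSEQ_power_zero) auto
  have "c * measure (cube_measure s) U \<le> (\<integral>t. \<bar>H t\<bar> \<partial>cube_measure s) * 0"
    by (rule LIMSEQ_le_const[OF lim]) (intro exI[of _ 0] allI impI le)
  then have "c * measure (cube_measure s) U \<le> 0" by simp
  then show False using c U(2) by (simp add: mult_le_0_iff)
qed

lemma fourier_zero_imp_zero:
  fixes h :: "(nat \<Rightarrow> real) \<Rightarrow> complex"
  assumes s: "s \<ge> 1" and int: "integrable (cube_measure s) h"
    and zero: "\<And>k. (\<integral>t. h t * chr s k t \<partial>cube_measure s) = 0"
    and cont: "\<And>x. x \<in> half_open_cube s \<Longrightarrow> seq_cont s h x" and x: "x \<in> half_open_cube s"
  shows "h x = 0"
proof -
  \<comment> \<open>Points on the lower faces are reached from the interior by moving towards the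
    corner of ones. The double successor makes the step factor strictly less than 1, so the upper
    faces are not hit.\<close>
  define T where "T = (\<lambda>n. \<lambda>j\<in>{..<s}. x j + (1 - x j) * inverse (real (Suc (Suc n))))"
  have x01: "0 \<le> x j \<and> x j < 1" if "j < s" for j
    using x that by (auto simp: half_open_cube_def PiE_iff)
  have T01: "0 < T n j \<and> T n j < 1" if "j < s" for n j
  proof -
    have "inverse (real (Suc (Suc n))) < 1" by (simp add: field_simps)
    define w where "w = (1 - x j) * inverse (real (Suc (Suc n)))"
    have "w < (1 - x j) * 1"
      unfolding w_def using x01[OF that] \<open>inverse (real (Suc (Suc n))) < 1\<close>
      by (intro mult_strict_left_mono) auto
    moreover have "w > 0" unfolding w_def using x01[OF that] by simp
    moreover have "T n j = x j + w" using that by (simp add: T_def w_def)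
    ultimately show ?thesis using x01[OF that] by simp
  qed
  have T_in: "T n \<in> half_open_cube s" for n
    using T01[of _ n] by (auto simp: half_open_cube_def PiE_iff T_def less_imp_le extensional_def)
  have "h (T n) = 0" for n
    using T01 by (intro fourier_zero_imp_zero_interior[OF s int zero _ cont[OF T_in]])
  moreover have "(\<lambda>n. T n j) \<longlonglongrightarrow> x j" if "j < s" for j
  proof -
    have "(\<lambda>n. x j + (1 - x j) * inverse (real (Suc (Suc n)))) \<longlonglongrightarrow> x j + (1 - x j) * 0"
      by (intro tendsto_intros LIMSEQ_Suc[OF LIMSEQ_inverse_real_of_nat])
    then show ?thesis using that by (simp add: T_def)
  qed
  then have "(\<lambda>n. h (T n)) \<longlonglongrightarrow> h x"
    using cont[OF x] T_in unfolding seq_cont_def by blast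
  ultimately show ?thesis using LIMSEQ_unique[of "\<lambda>n. h (T n)" "h x" 0] by simp
qed

section \<open>The Hoelder seminorm as a modulus of continuity\<close>

definition lp_const :: "nat \<Rightarrow> ereal \<Rightarrow> real" where
  "lp_const s p = (if p = \<infinity> then 1 else real s powr (1 / real_of_ereal p))"

lemma lp_const_nonneg: "0 \<le> lp_const s p"
  by (simp add: lp_const_def)

lemma real_of_ereal_ge_1: "1 \<le> p \<Longrightarrow> p \<noteq> \<infinity> \<Longrightarrow> 1 \<le> real_of_ereal p"
  by (cases p) auto

text \<open>For \<open>s \<ge> 1\<close> the constant \<open>lp_const s p\<close> is the norm of the
  all-ones vector; with \<delta> = 1/N this is the origin of s^(\<alpha>/p) / N^\<alpha> in the
  final bound.\<close>

lemma lp_norm_le: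
  assumes p: "1 \<le> p" and \<delta>: "0 \<le> \<delta>" and h: "\<And>j. j < s \<Longrightarrow> \<bar>h j\<bar> \<le> \<delta>"
  shows "lp_norm s p h \<le> lp_const s p * \<delta>"
proof (cases "p = \<infinity>")
  case True
  have "Max (insert 0 ((\<lambda>j. \<bar>h j\<bar>) ` {..<s})) \<le> \<delta>" using \<delta> h by (subst Max_le_iff) auto
  then show ?thesis using True by (simp add: lp_norm_def lp_const_def)
next
  case False
  define q where "q = real_of_ereal p"
  have q: "q \<ge> 1" using real_of_ereal_ge_1[OF p False] by (simp add: q_def)
  have "(\<Sum>j<s. \<bar>h j\<bar> powr q) \<le> (\<Sum>j<s. \<delta> powr q)"
    using h q by (intro sum_mono powr_mono2) auto
  then have "(\<Sum>j<s. \<bar>h j\<bar> powr q) powr (1 / q) \<le> (real s * \<delta> powr q) powr (1 / q)"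
    using q by (intro powr_mono2) (auto intro: sum_nonneg)
  also have "\<dots> = real s powr (1 / q) * \<delta>"
    using q \<delta> by (simp add: powr_mult powr_powr)
  finally show ?thesis using False by (simp add: lp_norm_def lp_const_def q_def)
qed

lemma lp_norm_pos:
  assumes p: "1 \<le> p" and j: "j < s" "h j \<noteq> 0"
  shows "0 < lp_norm s p h"
proof (cases "p = \<infinity>")
  case True
  have "\<bar>h j\<bar> \<le> Max (insert 0 ((\<lambda>j. \<bar>h j\<bar>) ` {..<s}))" using j by (intro Max_ge) auto
  moreover have "0 < \<bar>h j\<bar>" using j by simp
  ultimately show ?thesis using True unfolding lp_norm_def by simp
next
  case False
  have "0 < (\<Sum>j<s. \<bar>h j\<bar> powr real_of_ereal p)"
    using j by (intro sum_pos2[of _ j]) auto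
  then show ?thesis using False by (simp add: lp_norm_def)
qed

lemma holder_bound:
  assumes p: "1 \<le> p" and fin: "holder_seminorm s \<alpha> p f < \<infinity>"
    and x: "x \<in> half_open_cube s" and t: "t \<in> half_open_cube s" and ne: "t \<noteq> x"
  shows "ereal (\<bar>f t - f x\<bar> / lp_norm s p (\<lambda>j\<in>{..<s}. t j - x j) powr \<alpha>) \<le> holder_seminorm s \<alpha> p f"
    "0 < lp_norm s p (\<lambda>j\<in>{..<s}. t j - x j)"
proof -
  define h where "h = (\<lambda>j\<in>{..<s}. t j - x j)"
  have ext: "x \<in> extensional {..<s}" "t \<in> extensional {..<s}"
    using x t by (auto simp: half_open_cube_def PiE_def)
  have t_eq: "(\<lambda>j\<in>{..<s}. x j + h j) = t"
    using ext by (auto simp: h_def fun_eq_iff restrict_def extensional_def)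
  obtain j where "t j \<noteq> x j" using ne by (auto simp: fun_eq_iff)
  then have j: "j < s" "h j \<noteq> 0"
    using ext by (auto simp: h_def extensional_def) (metis)+
  then have "h \<noteq> (\<lambda>_\<in>{..<s}. 0)" by (auto simp: fun_eq_iff intro!: exI[of _ j])
  then have mem: "(x, h) \<in> {(x, h). x \<in> half_open_cube s \<and> h \<in> PiE {..<s} (\<lambda>_. UNIV)
       \<and> h \<noteq> (\<lambda>_\<in>{..<s}. 0) \<and> (\<lambda>j\<in>{..<s}. x j + h j) \<in> half_open_cube s}"
    using x t t_eq by (auto simp: h_def)
  show "ereal (\<bar>f t - f x\<bar> / lp_norm s p (\<lambda>j\<in>{..<s}. t j - x j) powr \<alpha>) \<le> holder_seminorm s \<alpha> p f"
    unfolding holder_seminorm_def by (rule SUP_upper2[OF mem]) (simp add: t_eq h_def[symmetric])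
  show "0 < lp_norm s p (\<lambda>j\<in>{..<s}. t j - x j)"
    using lp_norm_pos[of p j s h] p j unfolding h_def by blast
qed

lemma holder_seminorm_real:
  assumes p: "1 \<le> p" and fin: "holder_seminorm s \<alpha> p f < \<infinity>" and s: "1 \<le> s"
  obtains H where "holder_seminorm s \<alpha> p f = ereal H" "0 \<le> H"
    "\<And>x t \<delta>. x \<in> half_open_cube s \<Longrightarrow> t \<in> half_open_cube s \<Longrightarrow> 0 \<le> \<alpha> \<Longrightarrow> 0 \<le> \<delta> \<Longrightarrow>
       (\<And>j. j < s \<Longrightarrow> \<bar>t j - x j\<bar> \<le> \<delta>) \<Longrightarrow> \<bar>f t - f x\<bar> \<le> H * (lp_const s p * \<delta>) powr \<alpha>"
proof -
  \<comment> \<open>Two distinct points show that the supremum is nonnegative; over an empty index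
    set it would be minus infinity. Here \<open>s \<ge> 1\<close> enters.\<close>
  define x0 :: "nat \<Rightarrow> real" where "x0 = (\<lambda>j\<in>{..<s}. 0)"
  define t0 :: "nat \<Rightarrow> real" where "t0 = (\<lambda>j\<in>{..<s}. 1 / 2)"
  have "t0 0 \<noteq> x0 0" using s by (auto simp: x0_def t0_def)
  then have "t0 \<noteq> x0" by auto
  moreover have "x0 \<in> half_open_cube s" "t0 \<in> half_open_cube s"
    unfolding half_open_cube_def x0_def t0_def by simp_all
  ultimately have "ereal (\<bar>f t0 - f x0\<bar> / lp_norm s p (\<lambda>j\<in>{..<s}. t0 j - x0 j) powr \<alpha>) \<le> holder_seminorm s \<alpha> p f"
    using holder_bound(1)[OF p fin] by blast
  moreover have "0 \<le> ereal (\<bar>f t0 - f x0\<bar> / lp_norm s p (\<lambda>j\<in>{..<s}. t0 j - x0 j) powr \<alpha>)"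
    by simp
  ultimately have "0 \<le> holder_seminorm s \<alpha> p f" by (rule order_trans[rotated])
  then obtain H where H: "holder_seminorm s \<alpha> p f = ereal H" "0 \<le> H"
    using fin by (cases "holder_seminorm s \<alpha> p f") auto
  moreover have "\<bar>f t - f x\<bar> \<le> H * (lp_const s p * \<delta>) powr \<alpha>"
    if xt: "x \<in> half_open_cube s" "t \<in> half_open_cube s" and "0 \<le> \<alpha>" "0 \<le> \<delta>"
      "\<And>j. j < s \<Longrightarrow> \<bar>t j - x j\<bar> \<le> \<delta>" for x t \<delta>
  proof (cases "t = x")
    case True
    then show ?thesis using H by simp
  next
    case False
    define L where "L = lp_norm s p (\<lambda>j\<in>{..<s}. t j - x j)"
    have L: "\<bar>f t - f x\<bar> / L powr \<alpha> \<le> H" "L > 0"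
      using holder_bound[OF p fin xt False] by (simp_all add: L_def H(1))
    then have "\<bar>f t - f x\<bar> \<le> H * L powr \<alpha>" by (simp add: field_simps)
    also have "\<dots> \<le> H * (lp_const s p * \<delta>) powr \<alpha>"
      using H(2) \<open>0 \<le> \<alpha>\<close> L(2) lp_norm_le[OF p \<open>0 \<le> \<delta>\<close>, of s "\<lambda>j\<in>{..<s}. t j - x j"] that(5)
      by (intro mult_left_mono powr_mono2) (auto simp: L_def)
    finally show ?thesis .
  qed
  ultimately show ?thesis using that by blast
qed

lemma seq_cont_holder:
  assumes p: "1 \<le> p" and fin: "holder_seminorm s \<alpha> p f < \<infinity>" and s: "1 \<le> s" and \<alpha>: "0 < \<alpha>"
    and x: "x \<in> half_open_cube s"
  shows "seq_cont s f x"
  unfolding seq_cont_def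
proof (intro allI impI)
  fix T assume T: "\<forall>n. T n \<in> half_open_cube s" "\<forall>j<s. (\<lambda>n. T n j) \<longlonglongrightarrow> x j"
  obtain H where H: "0 \<le> H"
    "\<And>x t \<delta>. x \<in> half_open_cube s \<Longrightarrow> t \<in> half_open_cube s \<Longrightarrow> 0 \<le> \<alpha> \<Longrightarrow> 0 \<le> \<delta> \<Longrightarrow>
       (\<And>j. j < s \<Longrightarrow> \<bar>t j - x j\<bar> \<le> \<delta>) \<Longrightarrow> \<bar>f t - f x\<bar> \<le> H * (lp_const s p * \<delta>) powr \<alpha>"
    using holder_seminorm_real[OF p fin s] by metis
  define \<delta> where "\<delta> = (\<lambda>n. \<Sum>j<s. \<bar>T n j - x j\<bar>)"
  have \<delta>_nonneg: "0 \<le> \<delta> n" for n by (simp add: \<delta>_def sum_nonneg)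
  have bound: "norm (f (T n) - f x) \<le> H * (lp_const s p * \<delta> n) powr \<alpha>" for n
    unfolding real_norm_def
  proof (rule H(2))
    show "\<bar>T n j - x j\<bar> \<le> \<delta> n" if "j < s" for j
      unfolding \<delta>_def using that member_le_sum[of j "{..<s}" "\<lambda>j. \<bar>T n j - x j\<bar>"] by simp
  qed (use x T \<alpha> \<delta>_nonneg in auto)
  have "\<delta> \<longlonglongrightarrow> (\<Sum>j<s. \<bar>x j - x j\<bar>)"
    unfolding \<delta>_def using T(2) by (intro tendsto_intros) auto
  then have "\<delta> \<longlonglongrightarrow> 0" by simp
  then have "(\<lambda>n. H * (lp_const s p * \<delta> n) powr \<alpha>) \<longlonglongrightarrow> H * (lp_const s p * 0) powr \<alpha>"
    using \<alpha> \<delta>_nonneg lp_const_nonneg by (intro tendsto_mult tendsto_const tendsto_powr') auto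
  then have "(\<lambda>n. H * (lp_const s p * \<delta> n) powr \<alpha>) \<longlonglongrightarrow> 0" by simp
  then have "(\<lambda>n. f (T n) - f x) \<longlonglongrightarrow> 0"
    by (rule Lim_null_comparison[rotated]) (intro always_eventually allI bound)
  then show "(\<lambda>n. f (T n)) \<longlonglongrightarrow> f x" by (rule LIM_zero_cancel)
qed

section \<open>Pointwise Fourier expansion\<close>

lemma integrable_in_K:
  assumes "in_K s \<alpha> p f"
  shows "integrable (cube_measure s) f"
proof -
  interpret prob_space "cube_measure s" by (rule prob_space_cube_measure)
  have "f \<in> borel_measurable (cube_measure s)" "integrable (cube_measure s) (\<lambda>x. (f x)\<^sup>2)"
    using assms unfolding in_K_def by simp_all
  then show ?thesis by (rule square_integrable_imp_integrable)
qed

lemma countable_int_lattice: "countable (int_lattice s)"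
  unfolding int_lattice_def by (intro countable_PiE) auto

lemma infinite_int_lattice:
  assumes "1 \<le> s" shows "infinite (int_lattice s)"
proof
  assume "finite (int_lattice s)"
  moreover have "range (\<lambda>n::int. \<lambda>j\<in>{..<s}. n) \<subseteq> int_lattice s"
    unfolding int_lattice_def by (rule image_subsetI) simp
  ultimately have "finite (range (\<lambda>n::int. \<lambda>j\<in>{..<s}. n))" by (rule finite_subset[rotated])
  moreover have "inj (\<lambda>n::int. \<lambda>j\<in>{..<s}. n)"
  proof (rule injI)
    fix m n :: int assume "(\<lambda>j\<in>{..<s}. m) = (\<lambda>j\<in>{..<s}. n)"
    from fun_cong[OF this, of 0] show "m = n" using assms by simp
  qed
  ultimately show False using finite_imageD infinite_UNIV_int by blast
qed

text \<open>The quadrature rule evaluates \<open>f\<close> at points, so equality almost everywhere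
  would not do. The function and the sum of its absolutely convergent series are both continuous on
  the half-open cube and have the same Fourier coefficients, hence agree at each of its
  points.\<close>

theorem fourier_series:
  assumes s: "1 \<le> s" and \<alpha>: "0 < \<alpha>" and p: "1 \<le> p" and f: "in_K s \<alpha> p f"
  obtains \<kappa> :: "nat \<Rightarrow> nat \<Rightarrow> int" where "bij_betw \<kappa> UNIV (int_lattice s)"
    "summable (\<lambda>n. norm (fourier_coeff s f (\<kappa> n)))"
    "\<And>x. x \<in> half_open_cube s \<Longrightarrow> (\<lambda>n. fourier_coeff s f (\<kappa> n) * chr s (\<kappa> n) x) sums of_real (f x)"
proof -
  interpret prob_space "cube_measure s" by (rule prob_space_cube_measure)
  \<comment> \<open>An enumeration of the lattice turns the unordered sum into a series, to which
    termwise integration and Tannery's theorem apply.\<close>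
  define \<kappa> where "\<kappa> = from_nat_into (int_lattice s)"
  have bij: "bij_betw \<kappa> UNIV (int_lattice s)"
    unfolding \<kappa>_def using countable_int_lattice infinite_int_lattice[OF s] by (rule bij_betw_from_nat_into)
  define a where "a = (\<lambda>n. fourier_coeff s f (\<kappa> n))"
  have "(\<lambda>k. norm (fourier_coeff s f k)) summable_on int_lattice s" using f by (simp add: in_K_def)
  then have "(\<lambda>n. norm (a n)) summable_on UNIV"
    unfolding a_def using summable_on_reindex_bij_betw[OF bij, of "\<lambda>k. norm (fourier_coeff s f k)"] by simp
  then have sum_a: "summable (\<lambda>n. norm (a n))"
    by (subst (asm) summable_on_UNIV_nonneg_real_iff) auto
  define g where "g = (\<lambda>x. \<Sum>n. a n * chr s (\<kappa> n) x)"
  have sum_g: "summable (\<lambda>n. a n * chr s (\<kappa> n) x)" for x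
    by (rule summable_norm_cancel) (simp add: norm_mult sum_a)
  have int_f: "integrable (cube_measure s) (\<lambda>x. complex_of_real (f x))"
    using integrable_in_K[OF f] by simp
  have int_g_chr: "integrable (cube_measure s) (\<lambda>x. g x * chr s k x)"
    and integral_g_chr: "(\<integral>x. g x * chr s k x \<partial>cube_measure s) = (\<Sum>n. a n * (if \<forall>j<s. \<kappa> n j + k j = 0 then 1 else 0))" for k
  proof -
    have eq: "g x * chr s k x = (\<Sum>n. a n * chr s (\<lambda>j. \<kappa> n j + k j) x)" for x
      unfolding g_def using suminf_mult2[OF sum_g, of _ "chr s k x"] by (simp add: mult.assoc chr_mult)
    have i1: "integrable (cube_measure s) (\<lambda>x. a n * chr s (\<lambda>j. \<kappa> n j + k j) x)" for n
      by (intro integrable_mult_right integrable_const_bound[of _ 1]) auto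
    have i2: "AE x in cube_measure s. summable (\<lambda>n. norm (a n * chr s (\<lambda>j. \<kappa> n j + k j) x))"
      by (simp add: norm_mult sum_a)
    have i3: "summable (\<lambda>n. \<integral>x. norm (a n * chr s (\<lambda>j. \<kappa> n j + k j) x) \<partial>cube_measure s)"
      by (simp add: norm_mult sum_a prob_space)
    show "integrable (cube_measure s) (\<lambda>x. g x * chr s k x)"
      unfolding eq by (rule integrable_suminf[OF i1 i2 i3])
    show "(\<integral>x. g x * chr s k x \<partial>cube_measure s) = (\<Sum>n. a n * (if \<forall>j<s. \<kappa> n j + k j = 0 then 1 else 0))"
      unfolding eq integral_suminf[OF i1 i2 i3] by (simp only: integral_mult_right_zero integral_chr)
  qed
  have int_g: "integrable (cube_measure s) g"
    using int_g_chr[of "\<lambda>_. 0"] by (simp add: chr_def)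
  define h where "h = (\<lambda>x. complex_of_real (f x) - g x)"
  have int_h: "integrable (cube_measure s) h" unfolding h_def using int_f int_g by auto
  have zero: "(\<integral>x. h x * chr s k x \<partial>cube_measure s) = 0" for k
  proof -
    \<comment> \<open>The one frequency of the series whose product with the character of
      \<open>k\<close> has a nonzero mean; the restriction puts it into the lattice, whose elements
      are extensional.\<close>
    define k' where "k' = (\<lambda>j\<in>{..<s}. - k j)"
    have "k' \<in> int_lattice s" by (simp add: k'_def int_lattice_def)
    then obtain m where m: "\<kappa> m = k'" using bij by (metis bij_betw_imp_surj_on imageE)
    have "(\<forall>j<s. \<kappa> n j + k j = 0) \<longleftrightarrow> n = m" for n
    proof
      assume *: "\<forall>j<s. \<kappa> n j + k j = 0"
      have "\<kappa> n \<in> int_lattice s" using bij by (auto simp: bij_betw_def)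
      then have "\<kappa> n \<in> extensional {..<s}" by (auto simp: int_lattice_def PiE_def)
      then have "\<kappa> n = k'"
        using * unfolding k'_def by (intro extensionalityI[of _ "{..<s}"]) (auto simp: eq_neg_iff_add_eq_0)
      then show "n = m" using m bij by (metis bij_betw_imp_inj_on injD)
    next
      assume "n = m"
      then show "\<forall>j<s. \<kappa> n j + k j = 0" using m by (simp add: k'_def)
    qed
    then have "(\<integral>x. g x * chr s k x \<partial>cube_measure s) = (\<Sum>n. if n = m then a m else 0)"
      unfolding integral_g_chr by (intro suminf_cong) simp
    also have "\<dots> = a m" using sums_If_finite_set[of "{m}" "\<lambda>_. a m"] by (auto simp: sums_iff)
    also have "a m = (\<integral>x. complex_of_real (f x) * chr s (\<lambda>j. - k' j) x \<partial>cube_measure s)"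
      by (simp add: a_def m fourier_coeff_chr)
    also have "chr s (\<lambda>j. - k' j) = chr s k" by (rule chr_cong) (simp add: k'_def)
    finally have "(\<integral>x. g x * chr s k x \<partial>cube_measure s) = (\<integral>x. complex_of_real (f x) * chr s k x \<partial>cube_measure s)" .
    moreover have "integrable (cube_measure s) (\<lambda>x. complex_of_real (f x) * chr s k x)"
      by (rule integrable_mult_bounded[OF int_f, of _ 1]) auto
    ultimately show ?thesis
      unfolding h_def left_diff_distrib using int_g_chr by (simp add: Bochner_Integration.integral_diff)
  qed
  have cont_g: "seq_cont s g x" for x
    unfolding seq_cont_def
  proof (intro allI impI)
    fix T assume T: "\<forall>j<s. (\<lambda>n. T n j) \<longlonglongrightarrow> x j"
    have "((\<lambda>n. \<Sum>k. a k * chr s (\<kappa> k) (T n)) \<longlonglongrightarrow> (\<Sum>k. a k * chr s (\<kappa> k) x))"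
    proof (rule tannerys_theorem[THEN conjunct2, THEN conjunct2])
      show "((\<lambda>n. a k * chr s (\<kappa> k) (T n)) \<longlonglongrightarrow> a k * chr s (\<kappa> k) x)" for k
        unfolding chr_def using T by (intro tendsto_intros tendsto_cis) auto
      show "\<forall>\<^sub>F (k, n) in sequentially \<times>\<^sub>F sequentially. norm (a k * chr s (\<kappa> k) (T n)) \<le> norm (a k)"
        by (rule always_eventually) (simp add: norm_mult)
    qed (use sum_a in auto)
    then show "(\<lambda>n. g (T n)) \<longlonglongrightarrow> g x" by (simp add: g_def)
  qed
  have cont_h: "seq_cont s h x" if "x \<in> half_open_cube s" for x
  proof -
    have "seq_cont s f x" using f that by (intro seq_cont_holder[OF p _ s \<alpha>]) (auto simp: in_K_def)
    then show ?thesis using cont_g[of x] unfolding seq_cont_def h_def by (auto intro!: tendsto_diff tendsto_of_real)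
  qed
  have "of_real (f x) = g x" if "x \<in> half_open_cube s" for x
    using fourier_zero_imp_zero[OF s int_h zero cont_h that] by (simp add: h_def)
  then have "(\<lambda>n. a n * chr s (\<kappa> n) x) sums of_real (f x)" if "x \<in> half_open_cube s" for x
    using that summable_sums[OF sum_g, of x] by (simp add: g_def)
  then show thesis using that[OF bij] sum_a by (simp add: a_def)
qed

section \<open>The error of the Korobov points\<close>

definition grid :: "nat \<Rightarrow> nat \<Rightarrow> (nat \<Rightarrow> nat) set" where
  "grid N s = PiE {..<s} (\<lambda>_. {..<N})"

definition grid_pt :: "nat \<Rightarrow> nat \<Rightarrow> (nat \<Rightarrow> nat) \<Rightarrow> nat \<Rightarrow> real" where
  "grid_pt N s g = (\<lambda>j\<in>{..<s}. real (g j) / real N)"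

lemma grid_pt_in: "0 < N \<Longrightarrow> g \<in> grid N s \<Longrightarrow> grid_pt N s g \<in> half_open_cube s"
  unfolding grid_pt_def half_open_cube_def by (subst restrict_PiE_iff) (auto simp: grid_def PiE_iff)

lemma finite_grid [simp]: "finite (grid N s)"
  by (simp add: grid_def finite_PiE)

text \<open>The grid average is the integral of the step function \<open>F\<close> that is constant
  on each half-open box of side 1/N, with the value of \<open>f\<close> at the lower corner.
  Pointwise \<open>F\<close> differs from \<open>f\<close> by at most \<open>B\<close>.\<close>

lemma grid_average_error:
  assumes N: "0 < N" and int: "integrable (cube_measure s) f"
    and H: "\<And>x t. x \<in> half_open_cube s \<Longrightarrow> t \<in> half_open_cube s \<Longrightarrow> (\<And>j. j < s \<Longrightarrow> \<bar>t j - x j\<bar> \<le> 1 / real N) \<Longrightarrow>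
        \<bar>f t - f x\<bar> \<le> (B::real)"
  shows "\<bar>(1 / real N ^ s) * (\<Sum>g\<in>grid N s. f (grid_pt N s g)) - integral\<^sup>L (cube_measure s) f\<bar> \<le> B"
proof -
  interpret prob_space "cube_measure s" by (rule prob_space_cube_measure)
  define box where "box = (\<lambda>g. PiE {..<s} (\<lambda>j. {real (g j) / real N ..< (real (g j) + 1) / real N}))"
  have box: "box g \<in> sets (cube_measure s) \<and> measure (cube_measure s) (box g) = 1 / real N ^ s"
    if g: "g \<in> grid N s" for g
  proof -
    have sub: "{real (g j) / real N ..< (real (g j) + 1) / real N} \<subseteq> {0..1}" if "j < s" for j
    proof -
      have "g j < N" using g that by (auto simp: grid_def PiE_iff)
      then have "(real (g j) + 1) / real N \<le> 1" by simp
      moreover have "0 \<le> real (g j) / real N" by simp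
      ultimately show ?thesis unfolding subset_iff atLeastLessThan_iff atLeastAtMost_iff by linarith
    qed
    have B: "{real (g j) / real N ..< (real (g j) + 1) / real N} \<in> sets unit_interval_measure" if "j < s" for j
      using sub[OF that] by (intro sets_unit_interval) auto
    have box_sets: "box g \<in> sets (cube_measure s)"
      unfolding box_def cube_measure_def using B by (intro sets_PiM_I_finite) auto
    have "emeasure (cube_measure s) (box g) = (\<Prod>j<s. emeasure unit_interval_measure {real (g j) / real N ..< (real (g j) + 1) / real N})"
      unfolding box_def cube_measure_def using B by (intro cube_product.emeasure_PiM) auto
    also have "\<dots> = (\<Prod>j<s. ennreal (1 / real N))"
    proof (rule prod.cong[OF refl])
      fix j assume "j \<in> {..<s}"
      then have "emeasure unit_interval_measure {real (g j) / real N ..< (real (g j) + 1) / real N} =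
        emeasure lborel {real (g j) / real N ..< (real (g j) + 1) / real N}"
        using sub[of j] by (intro emeasure_restrict_space) auto
      also have "\<dots> = ennreal (1 / real N)"
        using N by (subst emeasure_lborel_Ico) (auto simp: field_simps)
      finally show "emeasure unit_interval_measure {real (g j) / real N ..< (real (g j) + 1) / real N} = ennreal (1 / real N)" .
    qed
    also have "\<dots> = ennreal ((1 / real N) ^ s)" by (simp add: ennreal_power)
    finally have "measure (cube_measure s) (box g) = (1 / real N) ^ s" by (simp add: measure_def)
    then show ?thesis using box_sets by (simp add: power_divide)
  qed
  define F where "F = (\<lambda>t. \<Sum>g\<in>grid N s. indicator (box g) t * f (grid_pt N s g))"
  have int_ind: "integrable (cube_measure s) (\<lambda>t. indicator (box g) t * f (grid_pt N s g))" if "g \<in> grid N s" for g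
    using box[OF that] emeasure_real[of "box g"] by (intro integrable_mult_left integrable_real_indicator) auto
  have int_F: "integrable (cube_measure s) F"
    unfolding F_def by (intro Bochner_Integration.integrable_sum int_ind)
  have "integral\<^sup>L (cube_measure s) F = (\<Sum>g\<in>grid N s. measure (cube_measure s) (box g) * f (grid_pt N s g))"
  proof -
    have "integral\<^sup>L (cube_measure s) F = (\<Sum>g\<in>grid N s. \<integral>t. indicator (box g) t * f (grid_pt N s g) \<partial>cube_measure s)"
      unfolding F_def using int_ind by (intro Bochner_Integration.integral_sum) auto
    also have "\<dots> = (\<Sum>g\<in>grid N s. measure (cube_measure s) (box g) * f (grid_pt N s g))"
    proof (rule sum.cong[OF refl])
      fix g assume "g \<in> grid N s"
      then have "box g \<inter> space (cube_measure s) = box g" using box[of g] sets.sets_into_space by blast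
      then show "(\<integral>t. indicator (box g) t * f (grid_pt N s g) \<partial>cube_measure s) = measure (cube_measure s) (box g) * f (grid_pt N s g)"
        by simp
    qed
    finally show ?thesis .
  qed
  also have "\<dots> = (1 / real N ^ s) * (\<Sum>g\<in>grid N s. f (grid_pt N s g))"
    unfolding sum_distrib_left using box by (intro sum.cong) auto
  finally have F_integral: "integral\<^sup>L (cube_measure s) F = (1 / real N ^ s) * (\<Sum>g\<in>grid N s. f (grid_pt N s g))" .
  have close: "\<bar>F t - f t\<bar> \<le> B" if t: "t \<in> half_open_cube s" for t
  proof -
    define g0 where "g0 = (\<lambda>j\<in>{..<s}. nat \<lfloor>real N * t j\<rfloor>)"
    have t01: "0 \<le> t j" "t j < 1" if "j < s" for j using t that by (auto simp: half_open_cube_def PiE_iff)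
    have fl: "real (g0 j) \<le> real N * t j \<and> real N * t j < real (g0 j) + 1" if "j < s" for j
    proof -
      have "real (g0 j) = of_int \<lfloor>real N * t j\<rfloor>" using that t01[OF that] by (simp add: g0_def)
      then show ?thesis by linarith
    qed
    have g0: "g0 \<in> grid N s"
    proof -
      have "nat \<lfloor>real N * t j\<rfloor> < N" if "j < s" for j
      proof -
        have "real N * t j < real N * 1" using t01[OF that] N by (intro mult_strict_left_mono) auto
        then have "real (g0 j) < real N" using fl[OF that] by linarith
        then show ?thesis using that by (simp add: g0_def)
      qed
      then show ?thesis unfolding grid_def g0_def by (subst restrict_PiE_iff) auto
    qed
    have mem: "t \<in> box g \<longleftrightarrow> g = g0" if g: "g \<in> grid N s" for g
    proof
      assume tb: "t \<in> box g"
      show "g = g0"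
      proof (rule extensionalityI[of _ "{..<s}"])
        fix j assume "j \<in> {..<s}"
        then have j: "j < s" by simp
        have "real (g j) / real N \<le> t j \<and> t j < (real (g j) + 1) / real N"
          using tb j by (auto simp: box_def PiE_iff)
        then have "real (g j) \<le> real N * t j \<and> real N * t j < real (g j) + 1"
          using N by (simp add: field_simps)
        then have "\<lfloor>real N * t j\<rfloor> = int (g j)" by linarith
        then show "g j = g0 j" using j by (simp add: g0_def)
      qed (use g in \<open>auto simp: grid_def PiE_def g0_def\<close>)
    next
      assume "g = g0"
      moreover have "real (g0 j) / real N \<le> t j \<and> t j < (real (g0 j) + 1) / real N" if "j < s" for j
        using fl[OF that] N by (simp add: field_simps)
      ultimately show "t \<in> box g"
        using t by (auto simp: box_def half_open_cube_def PiE_iff)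
    qed
    have "F t = (\<Sum>g\<in>grid N s. if g = g0 then f (grid_pt N s g0) else 0)"
      unfolding F_def using mem by (intro sum.cong) (auto simp: indicator_def)
    then have "F t = f (grid_pt N s g0)" using g0 by simp
    moreover have "\<bar>f (grid_pt N s g0) - f t\<bar> \<le> B"
    proof (rule H[OF t grid_pt_in[OF N g0]])
      fix j assume "j < s"
      then have "real (g0 j) / real N \<le> t j \<and> t j < (real (g0 j) + 1) / real N"
        using fl[of j] N by (simp add: field_simps)
      then have "\<bar>real (g0 j) / real N - t j\<bar> \<le> 1 / real N"
        unfolding add_divide_distrib by linarith
      then show "\<bar>grid_pt N s g0 j - t j\<bar> \<le> 1 / real N" using \<open>j < s\<close> by (simp add: grid_pt_def)
    qed
    ultimately show ?thesis by simp
  qed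
  have "\<bar>integral\<^sup>L (cube_measure s) F - integral\<^sup>L (cube_measure s) f\<bar> = \<bar>\<integral>t. F t - f t \<partial>cube_measure s\<bar>"
    using int_F int by simp
  also have "\<dots> \<le> (\<integral>t. \<bar>F t - f t\<bar> \<partial>cube_measure s)" by (rule integral_abs_bound)
  also have "\<dots> \<le> (\<integral>t. B \<partial>cube_measure s)"
  proof (rule integral_mono_AE)
    show "AE t in cube_measure s. \<bar>F t - f t\<bar> \<le> B"
      using AE_half_open_cube by (rule AE_mp) (simp add: close)
  qed (use int_F int in auto)
  also have "\<dots> = B" by (simp add: prob_space)
  finally show ?thesis by (simp add: F_integral)
qed

section \<open>Characters summed over the grid and over the Korobov points\<close>

lemma cis_eq_if_diff_Int:
  assumes "u - v \<in> \<int>"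
  shows "cis (2 * pi * u) = cis (2 * pi * v)"
proof -
  have "cis (2 * pi * u) = cis (2 * pi * v) * cis (2 * pi * (u - v))"
    by (simp add: cis_mult algebra_simps)
  then show ?thesis using cis_multiple_2pi[OF assms] by simp
qed

lemma sum_cis_residues:
  assumes "0 < N"
  shows "(\<Sum>a<N. cis (2 * pi * (of_int k * (real a / real N)))) = (if int N dvd k then of_nat N else 0)"
proof (cases "int N dvd k")
  case True
  then obtain m where "k = int N * m" by (rule dvdE)
  then have "of_int k * (real a / real N) - 0 \<in> \<int>" for a
    using assms by simp
  then have "cis (2 * pi * (of_int k * (real a / real N))) = cis (2 * pi * 0)" for a
    by (rule cis_eq_if_diff_Int)
  then show ?thesis using True by simp
next
  case False
  define z where "z = cis (2 * pi * of_int k / real N)"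
  have "z \<noteq> 1"
  proof
    assume "z = 1"
    then have "cos (2 * pi * of_int k / real N) = 1" by (simp add: z_def complex_eq_iff)
    then obtain m :: int where "2 * pi * of_int k / real N = of_int m * 2 * pi"
      using cos_one_2pi_int by auto
    then have "real_of_int k = real_of_int (int N * m)" using assms by (simp add: field_simps)
    then have "k = int N * m" by (simp only: of_int_eq_iff)
    then show False using False by simp
  qed
  have "(\<Sum>a<N. cis (2 * pi * (of_int k * (real a / real N)))) = (\<Sum>a<N. z ^ a)"
    by (intro sum.cong refl) (simp add: z_def Complex.DeMoivre mult_ac)
  also have "\<dots> = (z ^ N - 1) / (z - 1)" using \<open>z \<noteq> 1\<close> by (rule geometric_sum)
  also have "z ^ N = 1"
    using assms cis_multiple_2pi[of "of_int k"] by (simp add: z_def Complex.DeMoivre)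
  finally show ?thesis using False by simp
qed

lemma sum_chr_grid:
  assumes "0 < N"
  shows "(\<Sum>g\<in>grid N s. chr s k (grid_pt N s g)) = (if \<forall>j<s. int N dvd k j then of_nat N ^ s else 0)"
proof -
  have "(\<Sum>g\<in>grid N s. chr s k (grid_pt N s g)) = (\<Sum>g\<in>grid N s. \<Prod>j<s. cis (2 * pi * (of_int (k j) * (real (g j) / real N))))"
  proof (rule sum.cong[OF refl])
    fix g :: "nat \<Rightarrow> nat"
    have "cis (\<Sum>j<m. u j) = (\<Prod>j<m. cis (u j))" for u and m :: nat
      by (induction m) (auto simp: cis_mult[symmetric])
    then show "chr s k (grid_pt N s g) = (\<Prod>j<s. cis (2 * pi * (of_int (k j) * (real (g j) / real N))))"
      by (simp add: chr_def grid_pt_def sum_distrib_left)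
  qed
  also have "\<dots> = (\<Prod>j<s. \<Sum>a<N. cis (2 * pi * (of_int (k j) * (real a / real N))))"
    unfolding grid_def by (rule prod_sum_PiE[symmetric]) auto
  also have "\<dots> = (\<Prod>j<s. if int N dvd k j then of_nat N else 0)"
    using sum_cis_residues[OF assms] by simp
  also have "\<dots> = (if \<forall>j<s. int N dvd k j then of_nat N ^ s else 0)"
    by (auto simp: prod_zero_iff)
  finally show ?thesis .
qed

lemma korobov_pt_in: "korobov_pt N s n \<in> half_open_cube s"
  unfolding korobov_pt_def half_open_cube_def by (subst restrict_PiE_iff) (auto simp: frac_lt_1)

text \<open>Fractional parts disappear because the frequencies are integers, and coordinates from
  \<open>d\<close> on contribute whole turns. What remains is a polynomial in \<open>n\<close>
  without constant term; coordinate \<open>j\<close> carries the exponent \<open>j + 1\<close>. The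
  case \<open>d = 0\<close> gives the value 1.\<close>

lemma chr_korobov_pt:
  assumes N: "0 < N" and dvd: "\<And>j. d \<le> j \<Longrightarrow> j < s \<Longrightarrow> int N dvd k j" and d: "d \<le> s"
  shows "chr s k (korobov_pt N s n) = cis (2 * pi * real_of_int (\<Sum>j=1..d. k (j - 1) * int n ^ j) / real N)"
proof -
  define v where "v = (\<Sum>j<s. if j < d then of_int (k j) * (real (n ^ (j + 1)) / real N) else 0)"
  have "of_int (k j) * frac (real (n ^ (j + 1)) / real N) -
      (if j < d then of_int (k j) * (real (n ^ (j + 1)) / real N) else 0) \<in> \<int>" if js: "j < s" for j
  proof -
    have *: "of_int (k j) * frac y - of_int (k j) * y \<in> \<int>" for y :: real
      by (simp add: frac_def right_diff_distrib)
    show ?thesis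
    proof (cases "j < d")
      case True
      then show ?thesis using *[of "real (n ^ (j + 1)) / real N"] by simp
    next
      case False
      then have "int N dvd k j" using dvd[of j] js by simp
      then obtain m where "k j = int N * m" by (rule dvdE)
      then have "of_int (k j) * (real (n ^ (j + 1)) / real N) = of_int (m * int (n ^ (j + 1)))" using N by simp
      then have "of_int (k j) * (real (n ^ (j + 1)) / real N) \<in> \<int>" by (metis Ints_of_int)
      from Ints_add[OF *[of "real (n ^ (j + 1)) / real N"] this] show ?thesis using False by simp
    qed
  qed
  then have "(\<Sum>j<s. of_int (k j) * korobov_pt N s n j) - v \<in> \<int>"
    unfolding v_def sum_subtractf[symmetric] by (intro Ints_sum) (simp add: korobov_pt_def)
  then have "chr s k (korobov_pt N s n) = cis (2 * pi * v)"
    unfolding chr_def by (rule cis_eq_if_diff_Int)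
  also have "v = (\<Sum>j<d. of_int (k j) * (real (n ^ (j + 1)) / real N))"
    unfolding v_def using d by (intro sum.mono_neutral_cong_right) auto
  also have "\<dots> = (\<Sum>j=1..d. of_int (k (j - 1)) * (real (n ^ j) / real N))"
    by (rule sum.reindex_bij_witness[of _ "\<lambda>j. j - 1" "\<lambda>j. j + 1"]) auto
  also have "2 * pi * \<dots> = 2 * pi * real_of_int (\<Sum>j=1..d. k (j - 1) * int n ^ j) / real N"
    by (simp add: sum_divide_distrib sum_distrib_left)
  finally show ?thesis .
qed

lemma norm_korobov_sum_le:
  assumes weil: "weil_bound N" and N: "0 < N" and s: "s < N" and k: "\<not> (\<forall>j<s. int N dvd k j)"
  shows "cmod (1 / of_nat N * (\<Sum>n<N. chr s k (korobov_pt N s n))) \<le> (real s - 1) / sqrt (real N)"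
proof -
  define J where "J = {j. j < s \<and> \<not> int N dvd k j}"
  have J: "finite J" "J \<noteq> {}" using k by (auto simp: J_def)
  \<comment> \<open>Discarding the frequencies divisible by N at the top leaves a polynomial whose
    leading coefficient is prime to N. The summand 1 passes from the zero-based coordinate to the
    exponent, so \<open>1 \<le> d \<le> s\<close>.\<close>
  define d where "d = Max J + 1"
  have "Max J \<in> J" using J by (rule Max_in)
  then have d: "1 \<le> d" "d \<le> s" "\<not> int N dvd k (d - 1)" by (auto simp: d_def J_def)
  have dvd: "int N dvd k j" if "d \<le> j" "j < s" for j
  proof (rule ccontr)
    assume "\<not> int N dvd k j"
    then have "j \<in> J" using that by (simp add: J_def)
    then show False using Max_ge[OF J(1)] that by (fastforce simp: d_def)
  qed
  have "cmod (\<Sum>n<N. cis (2 * pi * real_of_int (\<Sum>j=1..d. k (j - 1) * int n ^ j) / real N)) \<le> (real d - 1) * sqrt (real N)"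
    using weil[unfolded weil_bound_def, rule_format, of d "\<lambda>j. k (j - 1)"] d s by simp
  then have "cmod (\<Sum>n<N. chr s k (korobov_pt N s n)) \<le> (real d - 1) * sqrt (real N)"
    by (simp add: chr_korobov_pt[OF N dvd d(2)])
  also have "\<dots> \<le> (real s - 1) * sqrt (real N)" using d by (intro mult_right_mono) auto
  finally have "cmod (1 / of_nat N * (\<Sum>n<N. chr s k (korobov_pt N s n))) \<le> (real s - 1) * sqrt (real N) / real N"
    using N by (simp add: norm_mult norm_divide divide_right_mono)
  also have "\<dots> = (real s - 1) / sqrt (real N)"
    using N by (simp add: field_simps flip: real_sqrt_mult)
  finally show ?thesis .
qed

lemma korobov_error:
  assumes weil: "weil_bound N" and \<alpha>: "0 < \<alpha>" and p: "1 \<le> p" and s: "1 \<le> s" "s < N"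
    and f: "in_K s \<alpha> p f" "K_norm s \<alpha> p f \<le> 1"
  shows "\<bar>integral\<^sup>L (cube_measure s) f - (1 / real N) * (\<Sum>n<N. f (korobov_pt N s n))\<bar>
    \<le> max ((real s - 1) / sqrt (real N)) ((lp_const s p / real N) powr \<alpha>)"
proof -
  have N: "0 < N" using s by simp
  obtain \<kappa> where bij: "bij_betw \<kappa> (UNIV :: nat set) (int_lattice s)"
    and sum_a: "summable (\<lambda>n. norm (fourier_coeff s f (\<kappa> n)))"
    and f_sums: "\<And>x. x \<in> half_open_cube s \<Longrightarrow> (\<lambda>n. fourier_coeff s f (\<kappa> n) * chr s (\<kappa> n) x) sums of_real (f x)"
    using fourier_series[OF s(1) \<alpha> p f(1)] by blast
  have "holder_seminorm s \<alpha> p f < \<infinity>" using f(1) by (simp add: in_K_def)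
  from holder_seminorm_real[OF p this s(1)]
  obtain H where H: "holder_seminorm s \<alpha> p f = ereal H" "0 \<le> H"
    "\<And>x t \<delta>. x \<in> half_open_cube s \<Longrightarrow> t \<in> half_open_cube s \<Longrightarrow> 0 \<le> \<alpha> \<Longrightarrow> 0 \<le> \<delta> \<Longrightarrow>
       (\<And>j. j < s \<Longrightarrow> \<bar>t j - x j\<bar> \<le> \<delta>) \<Longrightarrow> \<bar>f t - f x\<bar> \<le> H * (lp_const s p * \<delta>) powr \<alpha>"
    by metis
  define a where "a = (\<lambda>n. fourier_coeff s f (\<kappa> n))"
  define A where "A = (\<Sum>n. norm (a n))"
  have A: "0 \<le> A" unfolding A_def using sum_a by (intro suminf_nonneg) (auto simp: a_def)
  have "(\<Sum>\<^sub>\<infinity>k\<in>int_lattice s. norm (fourier_coeff s f k)) = (\<Sum>\<^sub>\<infinity>n. norm (a n))"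
    unfolding a_def by (rule infsum_reindex_bij_betw[OF bij, symmetric])
  also have "\<dots> = A"
    unfolding A_def using sum_a by (intro infsumI norm_summable_imp_has_sum) (auto simp: a_def summable_sums)
  finally have AH: "A + H \<le> 1" using f(2) by (simp add: K_norm_def H(1))
  define W where "W = (real s - 1) / sqrt (real N)"
  define V where "V = (lp_const s p / real N) powr \<alpha>"
  define cK where "cK = (\<lambda>n. 1 / of_nat N * (\<Sum>m<N. chr s (\<kappa> n) (korobov_pt N s m)))"
  define cG where "cG = (\<lambda>n. 1 / of_nat N ^ s * (\<Sum>g\<in>grid N s. chr s (\<kappa> n) (grid_pt N s g)))"
  define QK where "QK = (1 / real N) * (\<Sum>m<N. f (korobov_pt N s m))"
  define QG where "QG = (1 / real N ^ s) * (\<Sum>g\<in>grid N s. f (grid_pt N s g))"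
  have W: "0 \<le> W" using s by (simp add: W_def)
  have sumsK: "(\<lambda>n. a n * cK n) sums of_real QK"
  proof -
    have "(\<lambda>n. 1 / of_nat N * (\<Sum>m<N. a n * chr s (\<kappa> n) (korobov_pt N s m))) sums (1 / of_nat N * (\<Sum>m<N. of_real (f (korobov_pt N s m))))"
      unfolding a_def by (intro sums_mult sums_sum f_sums korobov_pt_in)
    then show ?thesis by (simp add: cK_def QK_def sum_distrib_left mult_ac)
  qed
  have sumsG: "(\<lambda>n. a n * cG n) sums of_real QG"
  proof -
    have "(\<lambda>n. 1 / of_nat N ^ s * (\<Sum>g\<in>grid N s. a n * chr s (\<kappa> n) (grid_pt N s g))) sums (1 / of_nat N ^ s * (\<Sum>g\<in>grid N s. of_real (f (grid_pt N s g))))"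
      unfolding a_def by (intro sums_mult sums_sum f_sums grid_pt_in N)
    then show ?thesis by (simp add: cG_def QG_def sum_distrib_left mult_ac)
  qed
  \<comment> \<open>Both rules integrate a character with all frequencies divisible by N to 1, so
    these cancel. On every other character the grid average is 0 and only the normalised exponential
    sum is left.\<close>
  have diff: "norm (cK n - cG n) \<le> W" for n
  proof (cases "\<forall>j<s. int N dvd \<kappa> n j")
    case True
    have "cG n = 1" unfolding cG_def sum_chr_grid[OF N] using True N by simp
    moreover have "cK n = 1"
      unfolding cK_def using True N by (subst chr_korobov_pt[where d = 0]) auto
    ultimately show ?thesis using W by simp
  next
    case False
    then have "cG n = 0" unfolding cG_def sum_chr_grid[OF N] by (simp only: if_False mult_zero_right)
    then show ?thesis
      using norm_korobov_sum_le[OF weil N s(2) False] by (simp add: cK_def W_def)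
  qed
  have "\<bar>QK - QG\<bar> \<le> W * A"
  proof -
    have sums: "(\<lambda>n. a n * (cK n - cG n)) sums of_real (QK - QG)"
      using sums_diff[OF sumsK sumsG] by (simp add: right_diff_distrib)
    have le: "norm (a n * (cK n - cG n)) \<le> norm (a n) * W" for n
      unfolding norm_mult by (intro mult_left_mono diff) auto
    have sum_aW: "summable (\<lambda>n. norm (a n) * W)" using sum_a by (intro summable_mult2) (simp add: a_def)
    have "\<bar>QK - QG\<bar> = norm (\<Sum>n. a n * (cK n - cG n))"
      using sums by (simp only: sums_iff norm_of_real)
    also have "\<dots> \<le> (\<Sum>n. norm (a n) * W)"
      by (rule norm_suminf_le[OF le sum_aW])
    also have "\<dots> = A * W"
      unfolding A_def using sum_a by (intro suminf_mult2[symmetric]) (simp add: a_def)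
    finally show ?thesis by (simp add: mult.commute)
  qed
  moreover have "\<bar>QG - integral\<^sup>L (cube_measure s) f\<bar> \<le> V * H"
    unfolding QG_def
  proof (rule grid_average_error[OF N integrable_in_K[OF f(1)]])
    fix x t assume "x \<in> half_open_cube s" "t \<in> half_open_cube s" "\<And>j. j < s \<Longrightarrow> \<bar>t j - x j\<bar> \<le> 1 / real N"
    then have "\<bar>f t - f x\<bar> \<le> H * (lp_const s p * (1 / real N)) powr \<alpha>"
      using \<alpha> by (intro H(3)) auto
    then show "\<bar>f t - f x\<bar> \<le> V * H" by (simp add: V_def mult.commute)
  qed
  ultimately have "\<bar>integral\<^sup>L (cube_measure s) f - QK\<bar> \<le> W * A + V * H" by linarith
  \<comment> \<open>The unit ball condition is \<open>A + H \<le> 1\<close>, so the weighted sum is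
    at most the larger of the two rates.\<close>
  also have "\<dots> \<le> max W V * A + max W V * H"
    using A H(2) by (intro add_mono mult_right_mono) auto
  also have "\<dots> = max W V * (A + H)" by (simp add: distrib_left)
  also have "\<dots> \<le> max W V * 1" using AH W by (intro mult_left_mono) auto
  finally show ?thesis by (simp add: W_def V_def QK_def)
qed

lemma lp_const_powr:
  assumes "1 \<le> p" "0 < \<alpha>" "0 < N"
  shows "(lp_const s p / real N) powr \<alpha> = (if p = \<infinity> then 1 else real s powr (\<alpha> / real_of_ereal p)) / real N powr \<alpha>"
  using assms by (simp add: lp_const_def powr_divide powr_powr)

theorem mainTheorem2:
  fixes \<alpha> :: real and p :: ereal and N s :: nat
  assumes "0 < \<alpha>" "\<alpha> \<le> 1" "1 \<le> p"
    and "prime N" "1 \<le> s" "s < N"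
  shows "wce_K s \<alpha> p (korobov_pt N s) N \<le>
    ereal (max ((real s - 1) / sqrt (real N))
      ((if p = \<infinity> then 1 else real s powr (\<alpha> / real_of_ereal p)) / real N powr \<alpha>))"
  unfolding wce_K_def
proof (rule SUP_least)
  fix f assume "f \<in> {f. in_K s \<alpha> p f \<and> K_norm s \<alpha> p f \<le> 1}"
  then have "\<bar>integral\<^sup>L (cube_measure s) f - (1 / real N) * (\<Sum>n<N. f (korobov_pt N s n))\<bar>
      \<le> max ((real s - 1) / sqrt (real N)) ((lp_const s p / real N) powr \<alpha>)"
    using assms weil_bound_prime[OF assms(4)] by (intro korobov_error) auto
  moreover have "0 < N" using assms(5,6) by simp
  ultimately show "ereal \<bar>integral\<^sup>L (cube_measure s) f - (1 / real N) * (\<Sum>n<N. f (korobov_pt N s n))\<bar> \<le>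
    ereal (max ((real s - 1) / sqrt (real N))
      ((if p = \<infinity> then 1 else real s powr (\<alpha> / real_of_ereal p)) / real N powr \<alpha>))"
    using lp_const_powr[OF assms(3,1), of N s] by (simp only: ereal_less_eq)
qed

end
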